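(* If a finite index subgroup of Thompson's group \(F\) is isomorphic to \(\langle X\rangle\) for some geometrically proper set \(X\subseteq\operatorname{Homeo}_+(I)\), then it is isomorphic to \(F\).
   Context: \(I=[0,1]\); \(\operatorname{Homeo}_+(I)\) is the group of orientation preserving homeomorphisms of \(I\). The support of \(f\) is \(\{t\in I: tf\neq t\}\). A left (right) transition point of \(f\) is a point \(t\) not in the support of \(f\) such that for every \(\epsilon>0\), \((t,t+\epsilon)\) (resp. \((t-\epsilon,t)\)) meets the support of \(f\). A set \(X\) is geometrically proper if no point of \(I\) is a left transition point of two distinct elements of \(X\) and no point is a right transition point of two distinct elements of \(X\). *)

theory Defs
  imports "HOL-Analysis.Analysis" "HOL-Algebra.Algebra"
begin

definition Homeo_plus :: "(real \<Rightarrow> real) set" where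
  "Homeo_plus = {f. (\<exists>g. homeomorphism {0..1} {0..1} f g) \<and> mono_on {0..1} f
                     \<and> (\<forall>t. t \<notin> {0..1} \<longrightarrow> f t = t)}"

definition Homeo_grp :: "(real \<Rightarrow> real) monoid" where
  "Homeo_grp = \<lparr>carrier = Homeo_plus, mult = (\<lambda>f g. f \<circ> g), one = id\<rparr>"

definition supp :: "(real \<Rightarrow> real) \<Rightarrow> real set" where
  "supp f = {t \<in> {0..1}. f t \<noteq> t}"

definition left_transition :: "(real \<Rightarrow> real) \<Rightarrow> real \<Rightarrow> bool" where
  "left_transition f t \<longleftrightarrow> t \<in> {0..1} \<and> t \<notin> supp f \<and>
     (\<forall>e>0. {t<..<t+e} \<inter> supp f \<noteq> {})"

definition right_transition :: "(real \<Rightarrow> real) \<Rightarrow> real \<Rightarrow> bool" where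
  "right_transition f t \<longleftrightarrow> t \<in> {0..1} \<and> t \<notin> supp f \<and>
     (\<forall>e>0. {t-e<..<t} \<inter> supp f \<noteq> {})"

definition geometrically_proper :: "(real \<Rightarrow> real) set \<Rightarrow> bool" where
  "geometrically_proper S \<longleftrightarrow>
     (\<forall>u\<in>S. \<forall>v\<in>S. \<forall>t. u \<noteq> v \<longrightarrow>
        \<not> (left_transition u t \<and> left_transition v t) \<and>
        \<not> (right_transition u t \<and> right_transition v t))"

definition dyadic :: "real \<Rightarrow> bool" where
  "dyadic x \<longleftrightarrow> (\<exists>(a::int) (n::nat). x = real_of_int a / 2 ^ n)"

definition Thompson_F_set :: "(real \<Rightarrow> real) set" where
  "Thompson_F_set = {f \<in> Homeo_plus. \<exists>xs :: real list.
      sorted_wrt (<) xs \<and> xs \<noteq> [] \<and> hd xs = 0 \<and> last xs = 1 \<and> (\<forall>x\<in>set xs. dyadic x) \<and>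
      (\<forall>i. Suc i < length xs \<longrightarrow> (\<exists>(k::int) (c::real).
          \<forall>t\<in>{xs ! i .. xs ! Suc i}. f t = 2 powr (real_of_int k) * t + c))}"

definition Thompson_F :: "(real \<Rightarrow> real) monoid" where
  "Thompson_F = Homeo_grp\<lparr>carrier := Thompson_F_set\<rparr>"

end

theory Submission
  imports Defs "HOL-Computational_Algebra.Group_Closure"
begin

text \<open>
  Conjugated to the line, Thompson's group consists of dyadic piecewise linear homeomorphisms that are
  integer translations near both ends. The elements of compact support form a perfect group that is
  contained in every subgroup \<open>H\<close> of finite index and in every nontrivial normal subgroup of \<open>H\<close>, so
  \<open>H\<close> is determined by the pairs of translation lengths that it realizes.

  Let \<open>G\<close> be generated by a geometrically proper set and isomorphic to \<open>H\<close>. Then \<open>G\<close> acts faithfully on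
  some component \<open>(p, q)\<close> of its support. By properness at most one generator has a nontrivial germ at \<open>p\<close>,
  and at most one at \<open>q\<close>, so both groups of germs are cyclic. Two elements with trivial germ at
  \<open>p\<close> commute with a common nontrivial element of the derived subgroup, and in \<open>H\<close> this forces the kernel
  of the germ at \<open>p\<close> to be the kernel of one of the two translation lengths; likewise for \<open>q\<close>, with the other
  one. Each generator therefore has translation length zero at one of the ends, so \<open>H\<close> is given by
  divisibility conditions \<open>a dvd chi at_bot f\<close> and \<open>b dvd chi at_top f\<close>. Such a group is conjugate to the whole
  group by a map that turns translation by \<open>1\<close> into translation by \<open>a\<close> at one end and by \<open>b\<close> at
  the other.
\<close>

section \<open>The group of increasing bijections of the line\<close>

text \<open>On the line the end data are integers that add up, so finite index subgroups can be
  described by divisibility, and compact supports can be moved and shrunk freely. The obstacle: the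
  isomorphism is abstract and says nothing about how the action of \<open>G\<close> on
  \<open>(p, q)\<close> resembles that of \<open>H\<close> on the line. Every geometric fact about
  \<open>G\<close> has to be carried over through commutation. Two tests suffice. If both lengths of
  \<open>f\<close> are nonzero, some \<open>g\<close> in \<open>FC\<close> has no nontrivial element
  of \<open>FC\<close> commuting with both \<open>f\<close> and \<open>g\<close>. If exactly one
  length is nonzero, \<open>f\<close> has an extreme fixed point, and this prevents any conjugate of
  \<open>f\<close> from commuting with both \<open>f\<close> and a certain other conjugate. The
  first test identifies each germ kernel with the kernel of one length; the second shows that the
  two sides of the component give different ones. A generator with both lengths nonzero would be the
  only generator with a nontrivial germ at either side, so the pairs of lengths in \<open>H\<close>
  would all be integer multiples of one pair. Finite index excludes this: powers of elements with
  exactly one nonzero length lie in \<open>H\<close>.\<close>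

typedef incr = "{f :: real \<Rightarrow> real. strict_mono f \<and> surj f}"
  morphisms app Incr
  by (rule exI[of _ id]) (auto simp: strict_mono_def)

lemma strict_mono_app: "strict_mono (app f)" and surj_app: "surj (app f)"
  using app[of f] by auto

lemma app_less_iff [simp]: "app f s < app f t \<longleftrightarrow> s < t"
  by (simp add: strict_mono_app strict_mono_less)

lemma app_le_iff [simp]: "app f s \<le> app f t \<longleftrightarrow> s \<le> t"
  by (simp add: strict_mono_app strict_mono_less_eq)

lemma app_eq_iff [simp]: "app f s = app f t \<longleftrightarrow> s = t"
  by (simp add: strict_mono_app strict_mono_eq)

lemma app_Incr: "strict_mono f \<Longrightarrow> surj f \<Longrightarrow> app (Incr f) = f"
  by (simp add: Incr_inverse)

lemma incr_eqI: "(\<And>t. app f t = app g t) \<Longrightarrow> f = g"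
  by (metis app_inject ext)

instantiation incr :: group_add
begin

text \<open>Composition is written additively, since \<^class>\<open>group_add\<close> is the type class of not necessarily
  commutative groups.\<close>

definition plus_incr :: "incr \<Rightarrow> incr \<Rightarrow> incr" where "f + g = Incr (app f \<circ> app g)"
definition zero_incr :: incr where "0 = Incr id"
definition uminus_incr :: "incr \<Rightarrow> incr" where "- f = Incr (inv_into UNIV (app f))"
definition minus_incr :: "incr \<Rightarrow> incr \<Rightarrow> incr" where "f - g = f + - (g :: incr)"

lemma app_plus_aux: "app (f + g) t = app f (app g t)"
proof -
  have "strict_mono (app f \<circ> app g)" "surj (app f \<circ> app g)"
    by (simp add: strict_mono_def, rule comp_surj[OF surj_app surj_app])
  then show ?thesis
    by (simp add: plus_incr_def app_Incr)
qed

lemma app_zero_aux: "app 0 t = t"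
  unfolding zero_incr_def by (subst app_Incr) (auto simp: strict_mono_def)

lemma app_uminus_aux: "app (- f) (app f t) = t"
proof -
  have *: "inj (app f)" by (rule injI) simp
  have "strict_mono (inv_into UNIV (app f))"
    by (rule strict_monoI) (metis app_less_iff surj_app surj_f_inv_f)
  then show ?thesis
    unfolding uminus_incr_def
    by (subst app_Incr) (auto simp: * inj_imp_surj_inv)
qed

instance
  by intro_classes (auto intro!: incr_eqI simp: app_plus_aux app_zero_aux app_uminus_aux minus_incr_def)

end

lemma app_plus [simp]: "app (f + g) t = app f (app g t)"
  by (rule app_plus_aux)

lemma app_zero [simp]: "app 0 t = t"
  by (rule app_zero_aux)

lemma app_uminus_app [simp]: "app (- f) (app f t) = t"
  by (rule app_uminus_aux)

lemma app_app_uminus [simp]: "app f (app (- f) t) = t"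
  using app_uminus_app[of "- f" t] by simp

lemma app_minus [simp]: "app (f - g) t = app f (app (- g) t)"
  unfolding minus_incr_def by (rule app_plus)

lemma app_uminus_eq_iff: "app (- f) s = t \<longleftrightarrow> s = app f t"
  by (metis app_app_uminus app_uminus_app)

lemma eq_app_uminus_iff: "t = app (- f) s \<longleftrightarrow> app f t = s"
  by (metis app_app_uminus app_uminus_app)

lemma app_uminus_le_iff: "app (- f) s \<le> t \<longleftrightarrow> s \<le> app f t"
  by (metis app_app_uminus app_le_iff)

lemma app_uminus_less_iff: "app (- f) s < t \<longleftrightarrow> s < app f t"
  by (metis app_app_uminus app_less_iff)

lemma le_app_uminus_iff: "t \<le> app (- f) s \<longleftrightarrow> app f t \<le> s"
  by (metis app_app_uminus app_le_iff)

lemma less_app_uminus_iff: "t < app (- f) s \<longleftrightarrow> app f t < s"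
  by (metis app_app_uminus app_less_iff)

text \<open>An increasing map onto the line has no jumps, which is why the type carries no
  continuity condition.\<close>

lemma continuous_on_app: "continuous_on S (app f)"
proof -
  have "mono (app f)"
    by (rule monoI) simp
  then have "continuous_on UNIV (app f)"
    by (intro continuous_onI_mono) (auto simp: surj_app mono_def)
  then show ?thesis
    using continuous_on_subset by blast
qed

lemma incr_commute_iff: "f + g = g + f \<longleftrightarrow> (\<forall>t. app f (app g t) = app g (app f t))"
  by (metis app_plus incr_eqI)

lemma strict_mono_glue:
  fixes f g :: "real \<Rightarrow> real"
  assumes "strict_mono f" "strict_mono g" "f p = g p"
  shows "strict_mono (\<lambda>t. if t \<le> p then f t else g t)"
proof (rule strict_monoI)
  fix x y :: real
  assume "x < y"
  then have "f x < f y" "g x < g y" "x \<le> p \<Longrightarrow> f x \<le> g p" "p < y \<Longrightarrow> g p < g y"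
    using assms(1,2) by (auto simp: strict_mono_less) (metis assms(1,3) strict_mono_less_eq)
  then show "(if x \<le> p then f x else g x) < (if y \<le> p then f y else g y)"
    using assms(3) \<open>x < y\<close> by auto
qed

lemma surj_glue:
  fixes f g :: "real \<Rightarrow> real"
  assumes "strict_mono f" "strict_mono g" "surj f" "surj g" "f p = g p"
  shows "surj (\<lambda>t. if t \<le> p then f t else g t)"
proof -
  have "\<exists>t. (if t \<le> p then f t else g t) = y" for y
  proof (cases "y \<le> f p")
    case True
    obtain t where "y = f t" using assms(3) by (meson surjD)
    with True assms(1) show ?thesis
      by (intro exI[of _ t]) (simp add: strict_mono_less_eq)
  next
    case False
    obtain t where "y = g t" using assms(4) by (meson surjD)
    with False assms(2,5) show ?thesis
      by (intro exI[of _ t]) (simp add: strict_mono_less not_le)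
  qed
  then show ?thesis
    unfolding surj_def by metis
qed

text \<open>If the two values at \<open>p\<close> differ, the function has a gap or fails to
  increase, and \<open>Incr\<close> returns an unspecified element; hence the hypothesis of
  \<open>app_glue\<close>.\<close>

definition glue :: "real \<Rightarrow> incr \<Rightarrow> incr \<Rightarrow> incr" where
  "glue p f g = Incr (\<lambda>t. if t \<le> p then app f t else app g t)"

lemma app_glue:
  assumes "app f p = app g p"
  shows "app (glue p f g) t = (if t \<le> p then app f t else app g t)"
proof -
  have "strict_mono (\<lambda>t. if t \<le> p then app f t else app g t)" "surj (\<lambda>t. if t \<le> p then app f t else app g t)"
    using assms strict_mono_glue surj_glue strict_mono_app surj_app by blast+
  then show ?thesis
    by (simp add: glue_def app_Incr)
qed

subsection \<open>Subgroups\<close>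

definition add_subgroup :: "'a::group_add set \<Rightarrow> bool" where
  "add_subgroup S \<longleftrightarrow> 0 \<in> S \<and> (\<forall>x\<in>S. \<forall>y\<in>S. x + y \<in> S) \<and> (\<forall>x\<in>S. - x \<in> S)"

definition add_normalizes :: "'a::group_add set \<Rightarrow> 'a set \<Rightarrow> bool" where
  "add_normalizes G N \<longleftrightarrow> (\<forall>g\<in>G. \<forall>x\<in>N. g + x - g \<in> N)"

lemma add_subgroupD:
  assumes "add_subgroup S"
  shows "0 \<in> S" "x \<in> S \<Longrightarrow> y \<in> S \<Longrightarrow> x + y \<in> S" "x \<in> S \<Longrightarrow> - x \<in> S"
    "x \<in> S \<Longrightarrow> y \<in> S \<Longrightarrow> x - y \<in> S"
  using assms unfolding add_subgroup_def
  by (auto simp del: add_uminus_conv_diff simp: diff_conv_add_uminus)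

inductive_set span_group :: "'a::group_add set \<Rightarrow> 'a set" for S where
  zero: "0 \<in> span_group S"
| base: "x \<in> S \<Longrightarrow> x \<in> span_group S"
| plus: "x \<in> span_group S \<Longrightarrow> y \<in> span_group S \<Longrightarrow> x + y \<in> span_group S"
| uminus: "x \<in> span_group S \<Longrightarrow> - x \<in> span_group S"

lemma add_subgroup_span_group: "add_subgroup (span_group S)"
  by (auto simp: add_subgroup_def intro: span_group.intros)

lemma span_group_minimal:
  assumes "add_subgroup T" "S \<subseteq> T"
  shows "span_group S \<subseteq> T"
proof
  fix x assume "x \<in> span_group S"
  then show "x \<in> T"
    by induction (use assms in \<open>auto dest: add_subgroupD\<close>)
qed

section \<open>Multiples of an element and cyclic quotients\<close>

primrec nmult :: "nat \<Rightarrow> 'a::group_add \<Rightarrow> 'a" where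
  "nmult 0 z = 0"
| "nmult (Suc n) z = z + nmult n z"

definition zmult :: "int \<Rightarrow> 'a::group_add \<Rightarrow> 'a" where
  "zmult n z = (if n \<ge> 0 then nmult (nat n) z else - nmult (nat (- n)) z)"

lemma nmult_commute: "nmult n z + z = z + nmult n z"
  by (induction n) (auto simp: add.assoc)

lemma zmult_0 [simp]: "zmult 0 z = 0" and zmult_1 [simp]: "zmult 1 z = z"
  by (simp_all add: zmult_def)

lemma zmult_succ: "zmult (n + 1) z = z + zmult n z"
proof (cases "n \<ge> 0")
  case True
  then show ?thesis by (simp add: zmult_def nat_add_distrib)
next
  case False
  then obtain k where k: "n = - int (Suc k)"
    by (metis int_cases linorder_not_less of_nat_0_le_iff)
  have "z + - nmult (Suc k) z = - nmult k z"
    by (simp add: minus_add nmult_commute[symmetric] diff_conv_add_uminus del: add_uminus_conv_diff)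
  with k show ?thesis
    by (cases k) (auto simp: zmult_def nat_add_distrib)
qed

lemma zmult_pred: "zmult (n - 1) z = - z + zmult n z"
  using zmult_succ[of "n - 1" z] by (simp add: add.assoc[symmetric])

lemma zmult_add: "zmult (m + n) z = zmult m z + zmult n z"
proof (induction m rule: int_induct[where k = 0])
  case base
  then show ?case by simp
next
  case (step1 i)
  then show ?case
    using zmult_succ[of "i + n" z] zmult_succ[of i z] by (simp add: add.assoc algebra_simps)
next
  case (step2 i)
  then show ?case
    using zmult_pred[of "i + n" z] zmult_pred[of i z] by (simp add: add.assoc algebra_simps)
qed

lemma zmult_minus: "zmult (- n) z = - zmult n z"
  by (rule minus_unique[symmetric]) (simp add: zmult_add[symmetric])

lemma zmult_in_add_subgroup:
  assumes "add_subgroup S" "z \<in> S"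
  shows "zmult n z \<in> S"
proof -
  have "nmult k z \<in> S" for k
    by (induction k) (use assms in \<open>auto dest: add_subgroupD\<close>)
  then show ?thesis
    using assms by (auto simp: zmult_def dest: add_subgroupD)
qed

lemma add_conjugate_uminus:
  assumes "add_subgroup G" "add_normalizes G N" "g \<in> G" "x \<in> N"
  shows "- g + x + g \<in> N"
  using assms add_subgroupD(3)[of G g] unfolding add_normalizes_def
  by (metis diff_minus_eq_add)

text \<open>A factor from \<open>N\<close> is moved past a multiple of \<open>z\<close> by
  conjugation, which keeps it in \<open>N\<close>. Thus the quotient by \<open>N\<close> is cyclic
  as soon as every generator is a multiple of \<open>z\<close> modulo \<open>N\<close>; the
  statement avoids forming the quotient.\<close>

lemma span_group_cyclic_mod:
  assumes "add_subgroup G" "add_subgroup N" "add_normalizes G N" "z \<in> G"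
    and S: "\<And>s. s \<in> S \<Longrightarrow> \<exists>n. \<exists>x\<in>N. s = zmult n z + x" and w: "w \<in> span_group S"
  shows "\<exists>n. \<exists>x\<in>N. w = zmult n z + x"
  using w
proof induction
  case zero
  show ?case
    by (rule exI[of _ 0]) (use assms(2) in \<open>auto dest: add_subgroupD\<close>)
next
  case (base x)
  then show ?case by (rule S)
next
  case (plus u v)
  then obtain n x m y where *: "x \<in> N" "y \<in> N" "u = zmult n z + x" "v = zmult m z + y"
    by auto
  have "- zmult m z + x + zmult m z \<in> N"
    by (rule add_conjugate_uminus[OF assms(1,3)]) (use * assms zmult_in_add_subgroup in auto)
  then have "- zmult m z + x + zmult m z + y \<in> N"
    using * assms(2) by (auto dest: add_subgroupD)
  moreover have "u + v = zmult (n + m) z + (- zmult m z + x + zmult m z + y)"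
    by (simp add: * zmult_add add.assoc)
  ultimately show ?case by blast
next
  case (uminus u)
  then obtain n x where *: "x \<in> N" "u = zmult n z + x"
    by auto
  have "zmult n z + - x - zmult n z \<in> N"
    using assms * zmult_in_add_subgroup[of G z n] add_subgroupD(3)[of N x]
    unfolding add_normalizes_def by blast
  moreover have "- u = zmult (- n) z + (zmult n z + - x - zmult n z)"
    by (simp add: * zmult_minus minus_add diff_conv_add_uminus add.assoc[symmetric] del: add_uminus_conv_diff)
  ultimately show ?case by blast
qed

text \<open>A cyclic quotient is abelian; the argument is carried out on representatives.\<close>

lemma commutator_cyclic_mod:
  assumes "add_subgroup G" "add_subgroup N" "add_normalizes G N" "z \<in> G" "N \<subseteq> G"
    and "\<exists>n. \<exists>x\<in>N. u = zmult n z + x" "\<exists>n. \<exists>x\<in>N. v = zmult n z + x"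
  shows "u + v - u - v \<in> N"
proof -
  obtain n x m y where *: "x \<in> N" "y \<in> N" "u = zmult n z + x" "v = zmult m z + y"
    using assms by blast
  let ?n = "zmult n z" and ?m = "zmult m z"
  have nm: "?n \<in> G" "?m \<in> G"
    using assms zmult_in_add_subgroup by auto
  have comm: "?n + ?m = ?m + ?n"
    by (simp add: zmult_add[symmetric] add.commute)
  \<comment> \<open>Both products are \<open>zmult (n + m) z\<close> up to a factor in \<open>N\<close> on the right.\<close>
  have "- ?m + x + ?m \<in> N" "- ?n + y + ?n \<in> N"
    by (rule add_conjugate_uminus[OF assms(1,3)], use * nm in auto)+
  then have a: "(- ?m + x + ?m) + y - ((- ?n + y + ?n) + x) \<in> N" (is "?a \<in> N")
    using assms(2) * by (auto dest: add_subgroupD)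
  have 1: "u + v = (?n + ?m) + ((- ?m + x + ?m) + y)"
    by (simp add: * add.assoc)
  have 2: "v + u = (?n + ?m) + ((- ?n + y + ?n) + x)"
    unfolding comm by (simp add: * add.assoc)
  have "u + v - u - v = u + v - (v + u)"
    by (simp only: minus_add diff_conv_add_uminus add.assoc)
  also have "\<dots> = (?n + ?m) + ?a - (?n + ?m)"
    unfolding 1 2 by (simp only: diff_conv_add_uminus minus_add add.assoc)
  also have "\<dots> \<in> N"
    using a assms(1,3) nm add_subgroupD(2)[OF assms(1), of ?n ?m] unfolding add_normalizes_def by blast
  finally show ?thesis .
qed

lemmas add_group_simps = diff_conv_add_uminus minus_add add.assoc

section \<open>Additive maps on subgroups\<close>

definition additive_on :: "'a::group_add set \<Rightarrow> ('a \<Rightarrow> 'b::group_add) \<Rightarrow> bool" where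
  "additive_on S h \<longleftrightarrow> (\<forall>x\<in>S. \<forall>y\<in>S. h (x + y) = h x + h y)"

lemma additive_on_zero:
  assumes "add_subgroup S" "additive_on S h"
  shows "h 0 = 0"
proof -
  have "h 0 + h 0 = h 0 + 0"
    using assms unfolding additive_on_def by (metis add.right_neutral add_subgroupD(1))
  then show ?thesis by (simp only: add_left_cancel)
qed

lemma additive_on_uminus:
  assumes "add_subgroup S" "additive_on S h" "x \<in> S"
  shows "h (- x) = - h x"
proof -
  have "h x + h (- x) = h (x + - x)"
    using assms add_subgroupD(3)[OF assms(1,3)] unfolding additive_on_def by metis
  then show ?thesis
    using additive_on_zero[OF assms(1,2)] by (simp add: minus_unique)
qed

lemma additive_on_diff:
  assumes "add_subgroup S" "additive_on S h" "x \<in> S" "y \<in> S"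
  shows "h (x - y) = h x - h y"
proof -
  have "h (x + - y) = h x + h (- y)"
    using assms add_subgroupD(3)[OF assms(1,4)] unfolding additive_on_def by metis
  then show ?thesis using additive_on_uminus[OF assms(1,2,4)] by simp
qed

lemma additive_on_nmult:
  assumes "add_subgroup S" "additive_on S h" "x \<in> S"
  shows "nmult n x \<in> S" "h (nmult n x) = nmult n (h x)"
proof -
  show *: "nmult n x \<in> S" for n
    by (induction n) (use assms in \<open>auto dest: add_subgroupD\<close>)
  show "h (nmult n x) = nmult n (h x)"
    by (induction n) (use assms * in \<open>auto simp: additive_on_zero additive_on_def\<close>)
qed

lemma additive_on_image:
  assumes "add_subgroup S" "additive_on S h"
  shows "add_subgroup (h ` S)"
  unfolding add_subgroup_def
proof (intro conjI ballI)
  show "0 \<in> h ` S"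
    using additive_on_zero[OF assms] add_subgroupD(1)[OF assms(1)] by (metis imageI)
  fix a assume "a \<in> h ` S"
  then obtain x where x: "x \<in> S" "a = h x" by blast
  then show "- a \<in> h ` S"
    using additive_on_uminus[OF assms] add_subgroupD(3)[OF assms(1)] by (metis imageI)
  fix b assume "b \<in> h ` S"
  then obtain y where "y \<in> S" "b = h y" by blast
  then show "a + b \<in> h ` S"
    using x assms add_subgroupD(2)[OF assms(1)] unfolding additive_on_def by (metis imageI)
qed

subsection \<open>Homeomorphisms of the interval\<close>

definition homeo_incr :: "incr set" where
  "homeo_incr = {g. \<forall>t. t \<notin> {0..1} \<longrightarrow> app g t = t}"

lemma homeo_incr_sub: "add_subgroup homeo_incr"
  by (auto simp: add_subgroup_def homeo_incr_def app_uminus_eq_iff)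

lemma homeo_incr_endpoints:
  assumes "g \<in> homeo_incr"
  shows "app g 0 = 0" "app g 1 = 1"
proof -
  have le: "app g 0 \<ge> 0" if "g \<in> homeo_incr" for g
  proof (rule ccontr)
    assume *: "\<not> ?thesis"
    then have "app g (app g 0) = app g 0" using that by (auto simp: homeo_incr_def)
    then show False using * by simp
  qed
  have ge: "app g 1 \<le> 1" if "g \<in> homeo_incr" for g
  proof (rule ccontr)
    assume *: "\<not> ?thesis"
    then have "app g (app g 1) = app g 1" using that by (auto simp: homeo_incr_def)
    then show False using * by simp
  qed
  note m = add_subgroupD(3)[OF homeo_incr_sub assms]
  show "app g 0 = 0"
    using le[OF assms] le[OF m] by (simp add: le_app_uminus_iff)
  show "app g 1 = 1"
    using ge[OF assms] ge[OF m] by (simp add: app_uminus_le_iff)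
qed

section \<open>Dyadic piecewise linear maps\<close>

lemma dyadic_of_int [simp]: "dyadic (of_int a)"
  unfolding dyadic_def by (intro exI[of _ a] exI[of _ 0]) simp

lemma dyadic_0 [simp]: "dyadic 0" and dyadic_1 [simp]: "dyadic 1"
  using dyadic_of_int[of 0] dyadic_of_int[of 1] by simp_all

lemma dyadic_of_nat [simp]: "dyadic (of_nat n)"
  using dyadic_of_int[of "int n"] by simp

lemma dyadic_numeral [simp]: "dyadic (numeral n)"
  using dyadic_of_nat[of "numeral n"] by simp

lemma dyadic_uminus: "dyadic x \<Longrightarrow> dyadic (- x)"
  unfolding dyadic_def by (metis minus_divide_left of_int_minus)

lemma dyadic_add:
  assumes "dyadic x" "dyadic y"
  shows "dyadic (x + y)"
proof -
  obtain a n b m where *: "x = of_int a / 2 ^ n" "y = of_int b / 2 ^ m"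
    using assms unfolding dyadic_def by blast
  have "x + y = of_int (a * 2 ^ m + b * 2 ^ n) / 2 ^ (n + m)"
    by (simp add: * field_simps power_add)
  then show ?thesis
    unfolding dyadic_def by blast
qed

lemma dyadic_diff: "dyadic x \<Longrightarrow> dyadic y \<Longrightarrow> dyadic (x - y)"
  using dyadic_add[of x "- y"] dyadic_uminus[of y] by simp

lemma dyadic_mult:
  assumes "dyadic x" "dyadic y"
  shows "dyadic (x * y)"
proof -
  obtain a n b m where *: "x = of_int a / 2 ^ n" "y = of_int b / 2 ^ m"
    using assms unfolding dyadic_def by blast
  have "x * y = of_int (a * b) / 2 ^ (n + m)"
    by (simp add: * field_simps power_add)
  then show ?thesis
    unfolding dyadic_def by blast
qed

lemma dyadic_power2: "dyadic (2 ^ n)"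
  using dyadic_of_int[of "2 ^ n"] by simp

lemma dyadic_powr2: "dyadic (2 powr of_int k)"
proof (cases "k \<ge> 0")
  case True
  then show ?thesis
    using dyadic_power2[of "nat k"] by (simp add: powr_real_of_int)
next
  case False
  have "2 powr real_of_int k = of_int 1 / 2 ^ nat (- k)"
    using False by (simp add: powr_real_of_int powr_minus divide_simps)
  then show ?thesis
    unfolding dyadic_def by blast
qed

lemmas dyadic_intros = dyadic_add dyadic_diff dyadic_mult dyadic_uminus dyadic_powr2 dyadic_power2

lemma dyadic_between:
  fixes x y :: real
  assumes "x < y"
  obtains d where "dyadic d" "x < d" "d < y"
proof -
  obtain n :: nat where n: "1 / (y - x) < 2 ^ n"
    using real_arch_pow[of 2] by auto
  let ?a = "\<lfloor>x * 2 ^ n\<rfloor> + 1"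
  have "x * 2 ^ n < of_int ?a" "of_int ?a \<le> x * 2 ^ n + 1"
    by linarith+
  moreover have "x * 2 ^ n + 1 < y * 2 ^ n"
    using n assms by (simp add: field_simps)
  ultimately have "x * 2 ^ n < of_int ?a" "of_int ?a < y * 2 ^ n"
    by linarith+
  then have "x < of_int ?a / 2 ^ n" "of_int ?a / 2 ^ n < y"
    by (simp_all add: pos_less_divide_eq pos_divide_less_eq)
  then show ?thesis
    using that dyadic_def by blast
qed

section \<open>Dyadic affine maps and their germs\<close>

definition dyadic_affine :: "(real \<Rightarrow> real) set" where
  "dyadic_affine = {A. \<exists>(k::int) c. dyadic c \<and> A = (\<lambda>x. 2 powr of_int k * x + c)}"

lemma dyadic_affineI: "dyadic c \<Longrightarrow> (\<lambda>x. 2 powr of_int k * x + c) \<in> dyadic_affine"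
  unfolding dyadic_affine_def by blast

lemma dyadic_affine_id: "(\<lambda>x. x) \<in> dyadic_affine"
  using dyadic_affineI[of 0 0] by simp

lemma dyadic_affine_comp:
  assumes "A \<in> dyadic_affine" "B \<in> dyadic_affine"
  shows "A \<circ> B \<in> dyadic_affine"
proof -
  obtain k c l d where *: "dyadic c" "dyadic d"
    "A = (\<lambda>x. 2 powr of_int k * x + c)" "B = (\<lambda>x. 2 powr of_int l * x + d)"
    using assms unfolding dyadic_affine_def by blast
  have "A \<circ> B = (\<lambda>x. 2 powr of_int (k + l) * x + (2 powr of_int k * d + c))"
    by (auto simp: * powr_add algebra_simps)
  moreover have "\<dots> \<in> dyadic_affine"
    by (intro dyadic_affineI dyadic_intros *)
  ultimately show ?thesis by simp
qed

lemma dyadic_affine_inverse: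
  assumes "A \<in> dyadic_affine"
  obtains B where "B \<in> dyadic_affine" "\<And>x. A (B x) = x" "\<And>x. B (A x) = x"
proof -
  obtain k c where *: "dyadic c" "A = (\<lambda>x. 2 powr of_int k * x + c)"
    using assms unfolding dyadic_affine_def by blast
  let ?B = "\<lambda>x. 2 powr of_int (- k) * x + - (2 powr of_int (- k) * c)"
  have kk: "2 powr - real_of_int k * 2 powr real_of_int k = 1"
    by (simp add: powr_add[symmetric])
  have "?B \<in> dyadic_affine"
    by (rule dyadic_affineI) (intro dyadic_intros *)
  moreover have "A (?B x) = x" for x
    using kk by (simp add: * algebra_simps)
  moreover have "?B (A x) = x" for x
    using kk by (simp add: * algebra_simps)
  ultimately show ?thesis using that by blast
qed

lemma dyadic_affine_slope:
  assumes "A \<in> dyadic_affine"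
  obtains s where "s > 0" "\<And>x y. A y = A x + s * (y - x)"
proof -
  obtain k c where *: "A = (\<lambda>x. 2 powr of_int k * x + c)"
    using assms unfolding dyadic_affine_def by blast
  show ?thesis
    by (rule that[of "2 powr of_int k"]) (auto simp: * algebra_simps)
qed

text \<open>The inverse is of the same kind, so nondyadic points stay nondyadic. This carries the
  alternative in \<open>pl_at\<close> through compositions and inverses.\<close>

lemma dyadic_affine_dyadic_iff:
  assumes "A \<in> dyadic_affine"
  shows "dyadic (A x) \<longleftrightarrow> dyadic x"
proof -
  have *: "dyadic (A x)" if "A \<in> dyadic_affine" "dyadic x" for A x
    using that unfolding dyadic_affine_def by (auto intro!: dyadic_intros)
  from assms obtain B where B: "B \<in> dyadic_affine" "\<And>x. B (A x) = x"
    using dyadic_affine_inverse by metis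
  show ?thesis
    using *[OF assms, of x] *[OF B(1), of "A x"] B(2)[of x] by auto
qed

text \<open>\<open>agree f g t d\<close> says that \<open>f\<close> and \<open>g\<close> coincide near \<open>t\<close> in direction \<open>d\<close>; it is used with
  \<open>d = 1\<close> (to the right) and \<open>d = - 1\<close> (to the left).\<close>

definition agree :: "(real \<Rightarrow> real) \<Rightarrow> (real \<Rightarrow> real) \<Rightarrow> real \<Rightarrow> real \<Rightarrow> bool" where
  "agree f g t d \<longleftrightarrow> (\<exists>e>0. \<forall>u. 0 \<le> u \<longrightarrow> u \<le> e \<longrightarrow> f (t + d * u) = g (t + d * u))"

lemma agree_same: "agree f g t d \<Longrightarrow> f t = g t"
  unfolding agree_def by (metis add.right_neutral less_imp_le mult_zero_right order_refl)

lemma agree_trans: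
  assumes "agree f g t d" "agree g h t d"
  shows "agree f h t d"
proof -
  obtain e e' where "e > 0" "e' > 0" "\<And>u. 0 \<le> u \<Longrightarrow> u \<le> e \<Longrightarrow> f (t + d * u) = g (t + d * u)"
    "\<And>u. 0 \<le> u \<Longrightarrow> u \<le> e' \<Longrightarrow> g (t + d * u) = h (t + d * u)"
    using assms unfolding agree_def by metis
  then show ?thesis
    unfolding agree_def by (intro exI[of _ "min e e'"]) auto
qed

lemma agree_comp:
  assumes A: "A \<in> dyadic_affine" "agree g A t d" and B: "agree f B (g t) d"
  shows "agree (f \<circ> g) (B \<circ> A) t d"
proof -
  obtain s where s: "s > 0" "\<And>x y. A y = A x + s * (y - x)"
    using A dyadic_affine_slope by blast
  obtain e where e: "e > 0" "\<And>u. 0 \<le> u \<Longrightarrow> u \<le> e \<Longrightarrow> g (t + d * u) = A (t + d * u)"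
    using A unfolding agree_def by blast
  obtain e' where e': "e' > 0" "\<And>u. 0 \<le> u \<Longrightarrow> u \<le> e' \<Longrightarrow> f (g t + d * u) = B (g t + d * u)"
    using B unfolding agree_def by blast
  have "f (g (t + d * u)) = B (A (t + d * u))" if "0 \<le> u" "u \<le> min e (e' / s)" for u
  proof -
    have "A (t + d * u) = g t + d * (s * u)"
      using s(2)[of "t + d * u" t] agree_same[OF A(2)] by (simp add: algebra_simps)
    moreover have "0 \<le> s * u" "s * u \<le> e'"
      using that s by (auto simp: field_simps)
    ultimately show ?thesis
      using e' e that by simp
  qed
  then show ?thesis
    unfolding agree_def using e e' s by (intro exI[of _ "min e (e' / s)"]) auto
qed

lemma agree_inverse:
  assumes A: "A \<in> dyadic_affine" "agree f A t d"
    and g: "\<And>s. g (f s) = s" and B: "\<And>s. B (A s) = s"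
  shows "agree g B (f t) d"
proof -
  obtain s where s: "s > 0" "\<And>x y. A y = A x + s * (y - x)"
    using A dyadic_affine_slope by blast
  obtain e where e: "e > 0" "\<And>u. 0 \<le> u \<Longrightarrow> u \<le> e \<Longrightarrow> f (t + d * u) = A (t + d * u)"
    using A unfolding agree_def by blast
  have "g (f t + d * u) = B (f t + d * u)" if "0 \<le> u" "u \<le> s * e" for u
  proof -
    have "A (t + d * (u / s)) = f t + d * u"
      using s(1) s(2)[of "t + d * (u / s)" t] agree_same[OF A(2)] by simp
    moreover have "f (t + d * (u / s)) = A (t + d * (u / s))"
      by (rule e) (use that s in \<open>auto simp: field_simps\<close>)
    ultimately show ?thesis
      using g B by metis
  qed
  then show ?thesis
    unfolding agree_def using e s by (intro exI[of _ "s * e"]) auto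
qed

text \<open>A local condition in place of a finite list of breakpoints: it can be composed and
  inverted point by point, and compactness recovers a finite subdivision in \<open>grid\<close>. The
  last conjunct says that breakpoints are dyadic.\<close>

definition pl_at :: "(real \<Rightarrow> real) \<Rightarrow> real \<Rightarrow> bool" where
  "pl_at f t \<longleftrightarrow> (\<exists>A\<in>dyadic_affine. \<exists>B\<in>dyadic_affine.
     agree f A t (-1) \<and> agree f B t 1 \<and> (dyadic t \<or> A = B))"

lemma pl_at_comp:
  assumes "pl_at g t" "pl_at f (g t)"
  shows "pl_at (f \<circ> g) t"
proof -
  obtain A B where AB: "A \<in> dyadic_affine" "B \<in> dyadic_affine"
     "agree g A t (-1)" "agree g B t 1" "dyadic t \<or> A = B"
    using assms unfolding pl_at_def by blast
  obtain A' B' where AB': "A' \<in> dyadic_affine" "B' \<in> dyadic_affine"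
     "agree f A' (g t) (-1)" "agree f B' (g t) 1" "dyadic (g t) \<or> A' = B'"
    using assms unfolding pl_at_def by blast
  have "dyadic (g t) \<longleftrightarrow> dyadic t"
    using AB agree_same dyadic_affine_dyadic_iff by metis
  then have "dyadic t \<or> A' \<circ> A = B' \<circ> B"
    using AB AB' by auto
  then show ?thesis
    unfolding pl_at_def using AB AB' agree_comp dyadic_affine_comp by blast
qed

lemma pl_at_inverse:
  assumes "pl_at f t" and g: "\<And>s. g (f s) = s"
  shows "pl_at g (f t)"
proof -
  obtain A B where AB: "A \<in> dyadic_affine" "B \<in> dyadic_affine"
     "agree f A t (-1)" "agree f B t 1" "dyadic t \<or> A = B"
    using assms unfolding pl_at_def by blast
  obtain A' where A': "A' \<in> dyadic_affine" "\<And>x. A (A' x) = x" "\<And>x. A' (A x) = x"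
    using AB dyadic_affine_inverse by blast
  obtain B' where B': "B' \<in> dyadic_affine" "\<And>x. B (B' x) = x" "\<And>x. B' (B x) = x"
    using AB dyadic_affine_inverse by blast
  have "dyadic (f t) \<longleftrightarrow> dyadic t"
    using AB agree_same dyadic_affine_dyadic_iff by metis
  moreover have "A' = B'" if "A = B"
    using that A' B' by (metis ext)
  ultimately have "dyadic (f t) \<or> A' = B'"
    using AB by auto
  moreover have "agree g A' (f t) (-1)" "agree g B' (f t) 1"
    using agree_inverse[OF AB(1,3) g A'(3)] agree_inverse[OF AB(2,4) g B'(3)] by auto
  ultimately show ?thesis
    unfolding pl_at_def using A' B' by blast
qed

lemma pl_at_affine: "A \<in> dyadic_affine \<Longrightarrow> pl_at A t"
  unfolding pl_at_def agree_def by (auto intro!: bexI[of _ A] exI[of _ 1])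

lemma pl_at_glue:
  assumes "dyadic p" "e > 0" "pl_at g p" "pl_at h p"
    and l: "\<And>s. p - e \<le> s \<Longrightarrow> s \<le> p \<Longrightarrow> f s = g s" and r: "\<And>s. p \<le> s \<Longrightarrow> s \<le> p + e \<Longrightarrow> f s = h s"
  shows "pl_at f p"
proof -
  have "agree f g p (-1)" "agree f h p 1"
    unfolding agree_def using assms by (auto intro!: exI[of _ e])
  then show ?thesis
    using assms(1,3,4) unfolding pl_at_def by (meson agree_trans)
qed

lemma pl_at_cong:
  assumes "pl_at g t" "e > 0" "\<And>s. \<bar>s - t\<bar> < e \<Longrightarrow> f s = g s"
  shows "pl_at f t"
proof -
  have "agree f g t (-1)" "agree f g t 1"
    unfolding agree_def using assms by (auto intro!: exI[of _ "e / 2"])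
  then show ?thesis
    using assms(1) unfolding pl_at_def by (meson agree_trans)
qed

text \<open>Breakpoints need only be locally finite. Maps such as \<open>dilate\<close>, which can
  have infinitely many, belong to \<open>PL\<close> without being eventual translations.\<close>

definition PL :: "incr set" where
  "PL = {f. \<forall>t. pl_at (app f) t}"

lemma PL_add_subgroup: "add_subgroup PL"
  unfolding add_subgroup_def
proof (intro conjI ballI)
  have "app 0 = (\<lambda>x. x)" by auto
  then show "0 \<in> PL"
    using pl_at_affine[OF dyadic_affine_id] by (auto simp: PL_def)
  fix f assume f: "f \<in> PL"
  have "pl_at (app (- f)) (app f t)" for t
    by (rule pl_at_inverse) (use f in \<open>auto simp: PL_def\<close>)
  from this[of "app (- f) t" for t] show "- f \<in> PL"
    by (auto simp: PL_def)
  fix g assume g: "g \<in> PL"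
  have "app (f + g) = app f \<circ> app g" by auto
  then show "f + g \<in> PL"
    using f g by (auto simp: PL_def intro!: pl_at_comp)
qed

lemmas PL_D = add_subgroupD[OF PL_add_subgroup]

lemma PL_dyadic_iff:
  assumes "f \<in> PL"
  shows "dyadic (app f t) \<longleftrightarrow> dyadic t"
proof -
  obtain A where "A \<in> dyadic_affine" "agree (app f) A t 1"
    using assms unfolding PL_def pl_at_def by blast
  then show ?thesis
    using agree_same[of "app f" A t 1] dyadic_affine_dyadic_iff[of A t] by simp
qed

lemma PL_glue:
  assumes "f \<in> PL" "g \<in> PL" "dyadic p" "app f p = app g p"
  shows "glue p f g \<in> PL"
  unfolding PL_def
proof (intro CollectI allI)
  fix t
  consider "t < p" | "t = p" | "t > p" by linarith
  then show "pl_at (app (glue p f g)) t"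
  proof cases
    case 1
    show ?thesis
      by (rule pl_at_cong[of "app f" t "p - t"]) (use assms 1 in \<open>auto simp: PL_def app_glue\<close>)
  next
    case 2
    show ?thesis unfolding 2
      by (rule pl_at_glue[of p 1 "app f" "app g"]) (use assms in \<open>auto simp: PL_def app_glue\<close>)
  next
    case 3
    show ?thesis
      by (rule pl_at_cong[of "app g" t "t - p"]) (use assms 3 in \<open>auto simp: PL_def app_glue\<close>)
  qed
qed

section \<open>Explicit piecewise linear maps\<close>

definition aff :: "int \<Rightarrow> real \<Rightarrow> incr" where
  "aff k c = Incr (\<lambda>x. 2 powr of_int k * x + c)"

lemma app_aff [simp]: "app (aff k c) x = 2 powr of_int k * x + c"
proof -
  have "surj (\<lambda>x. 2 powr of_int k * x + c)"
    by (rule surjI[of _ "\<lambda>y. (y - c) / 2 powr of_int k"]) simp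
  then show ?thesis
    unfolding aff_def by (subst app_Incr) (auto simp: strict_mono_def)
qed

lemma aff_PL: "dyadic c \<Longrightarrow> aff k c \<in> PL"
proof -
  assume "dyadic c"
  moreover have "app (aff k c) = (\<lambda>x. 2 powr of_int k * x + c)" by auto
  ultimately show ?thesis
    using pl_at_affine[OF dyadic_affineI, of c k] by (auto simp: PL_def)
qed

text \<open>The additive constants make the three pieces meet at \<open>p\<close> and
  \<open>p + d\<close>: an interval of length \<open>d\<close> is magnified by \<open>2 ^ k\<close>,
  and everything to its right is pushed along.\<close>

definition stretch :: "real \<Rightarrow> real \<Rightarrow> nat \<Rightarrow> incr" where
  "stretch p d k = glue p 0 (glue (p + d) (aff k (p - 2 ^ k * p)) (aff 0 ((2 ^ k - 1) * d)))"

lemma app_stretch: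
  assumes "d \<ge> 0"
  shows "app (stretch p d k) t =
    (if t \<le> p then t else if t \<le> p + d then p + 2 ^ k * (t - p) else t + (2 ^ k - 1) * d)"
proof -
  let ?g = "glue (p + d) (aff k (p - 2 ^ k * p)) (aff 0 ((2 ^ k - 1) * d))"
  have g: "app ?g t = (if t \<le> p + d then p + 2 ^ k * (t - p) else t + (2 ^ k - 1) * d)" for t
    by (subst app_glue) (auto simp: powr_realpow algebra_simps)
  show ?thesis
    unfolding stretch_def by (subst app_glue) (use assms g in \<open>auto\<close>)
qed

lemma stretch_PL:
  assumes "dyadic p" "dyadic d" "d \<ge> 0"
  shows "stretch p d k \<in> PL"
proof -
  let ?g = "glue (p + d) (aff k (p - 2 ^ k * p)) (aff 0 ((2 ^ k - 1) * d))"
  have 1: "app (aff k (p - 2 ^ k * p)) (p + d) = app (aff 0 ((2 ^ k - 1) * d)) (p + d)"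
    by (auto simp: powr_realpow algebra_simps)
  have g: "?g \<in> PL"
    by (rule PL_glue[OF _ _ _ 1]) (intro aff_PL dyadic_intros assms dyadic_1)+
  have "app ?g p = p"
    by (subst app_glue[OF 1]) (use assms in \<open>auto simp: powr_realpow\<close>)
  then show ?thesis
    unfolding stretch_def
    by (intro PL_glue g assms) (auto simp: PL_D(1))
qed

section \<open>Thompson's group on the line\<close>

definition ends :: "real filter set" where
  "ends = {at_bot, at_top}"

lemma ends_simps [simp]: "at_bot \<in> ends" "at_top \<in> ends"
  by (auto simp: ends_def)

lemma ends_ne_bot: "F \<in> ends \<Longrightarrow> F \<noteq> bot"
  unfolding ends_def using trivial_limit_at_bot_linorder trivial_limit_at_top_linorder
  by (auto simp: trivial_limit_def)

lemma filterlim_app: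
  assumes "F \<in> ends"
  shows "filterlim (app f) F F"
proof -
  have "filterlim (app f) at_top at_top"
    unfolding filterlim_at_top eventually_at_top_linorder
    by (metis app_app_uminus app_le_iff)
  moreover have "filterlim (app f) at_bot at_bot"
    unfolding filterlim_at_bot eventually_at_bot_linorder
    by (metis app_app_uminus app_le_iff)
  ultimately show ?thesis
    using assms by (auto simp: ends_def)
qed

lemma eventually_app: "F \<in> ends \<Longrightarrow> eventually P F \<Longrightarrow> eventually (\<lambda>t. P (app f t)) F"
  using filterlim_app[of F f] by (simp add: eventually_compose_filterlim)

definition translates :: "real filter \<Rightarrow> incr \<Rightarrow> int \<Rightarrow> bool" where
  "translates F f k \<longleftrightarrow> (\<forall>\<^sub>F t in F. app f t = t + of_int k)"

lemma translates_unique: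
  assumes "F \<in> ends" "translates F f k" "translates F f l"
  shows "k = l"
proof -
  have "\<forall>\<^sub>F t in F. k = l"
    using assms(2,3) unfolding translates_def by eventually_elim simp
  then show ?thesis
    using ends_ne_bot[OF assms(1)] by (simp add: eventually_const_iff)
qed

lemma translates_add:
  assumes "F \<in> ends" "translates F f k" "translates F g l"
  shows "translates F (f + g) (k + l)"
  using eventually_app[OF assms(1) assms(2)[unfolded translates_def], of g] assms(3)
  unfolding translates_def by eventually_elim simp

lemma translates_uminus:
  assumes "F \<in> ends" "translates F f k"
  shows "translates F (- f) (- k)"
  using eventually_app[OF assms(1) assms(2)[unfolded translates_def], of "- f"]
  unfolding translates_def by eventually_elim simp

lemma translates_zero: "translates F 0 0"
  by (simp add: translates_def)

text \<open>In this model of Thompson's group on the line, the binary logarithms of the slopes at \<open>0\<close> and \<open>1\<close>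
  become, up to sign, the translation lengths \<open>chi\<close> near the two ends; \<open>FC\<close> plays the role of the
  commutator subgroup.\<close>

definition FR :: "incr set" where
  "FR = {f \<in> PL. \<forall>F\<in>ends. \<exists>k. translates F f k}"

definition chi :: "real filter \<Rightarrow> incr \<Rightarrow> int" where
  "chi F f = (THE k. translates F f k)"

lemma chi_eqI: "F \<in> ends \<Longrightarrow> translates F f k \<Longrightarrow> chi F f = k"
  unfolding chi_def using translates_unique by (intro the_equality) auto

lemma translates_chi: "F \<in> ends \<Longrightarrow> f \<in> FR \<Longrightarrow> translates F f (chi F f)"
  unfolding FR_def using chi_eqI by auto

lemma FR_add_subgroup: "add_subgroup FR"
  using PL_add_subgroup translates_add translates_uminus translates_zero
  unfolding add_subgroup_def FR_def by blast

lemmas FR_D = add_subgroupD[OF FR_add_subgroup]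

lemma chi_zero [simp]: "F \<in> ends \<Longrightarrow> chi F 0 = 0"
  by (rule chi_eqI) (auto simp: translates_zero)

lemma chi_add: "F \<in> ends \<Longrightarrow> f \<in> FR \<Longrightarrow> g \<in> FR \<Longrightarrow> chi F (f + g) = chi F f + chi F g"
  by (intro chi_eqI translates_add translates_chi)

lemma chi_uminus: "F \<in> ends \<Longrightarrow> f \<in> FR \<Longrightarrow> chi F (- f) = - chi F f"
  by (intro chi_eqI translates_uminus translates_chi)

lemma chi_diff: "F \<in> ends \<Longrightarrow> f \<in> FR \<Longrightarrow> g \<in> FR \<Longrightarrow> chi F (f - g) = chi F f - chi F g"
  using chi_add[of F f "- g"] chi_uminus[of F g] add_subgroupD(3)[OF FR_add_subgroup, of g] by simp

lemma chi_zmult: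
  assumes "F \<in> ends" "f \<in> FR"
  shows "chi F (zmult n f) = n * chi F f"
proof -
  have n: "nmult k f \<in> FR" for k
    by (induction k) (use assms FR_D in auto)
  have "chi F (nmult k f) = int k * chi F f" for k
    by (induction k) (use assms n in \<open>auto simp: chi_add algebra_simps\<close>)
  then show ?thesis
    using assms n by (auto simp: zmult_def chi_uminus)
qed

definition FC :: "incr set" where
  "FC = {f \<in> FR. \<forall>F\<in>ends. chi F f = 0}"

lemma FC_subset_FR: "FC \<subseteq> FR"
  by (auto simp: FC_def)

lemma FC_add_subgroup: "add_subgroup FC"
  using FR_add_subgroup unfolding add_subgroup_def FC_def by (auto simp: chi_add chi_uminus)

lemma FC_normal: "add_normalizes FR FC"
  using FR_D
  unfolding add_normalizes_def FC_def by (auto simp: chi_add chi_diff)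

lemma commutator_FC: "f \<in> FR \<Longrightarrow> g \<in> FR \<Longrightarrow> f + g - f - g \<in> FC"
  using FR_D unfolding FC_def by (auto simp: chi_add chi_diff)

lemma FC_iff: "f \<in> FC \<longleftrightarrow> f \<in> PL \<and> (\<exists>M. \<forall>t. \<bar>t\<bar> \<ge> M \<longrightarrow> app f t = t)"
proof
  assume f: "f \<in> FC"
  then have "translates F f 0" if "F \<in> ends" for F
    using that translates_chi[of F f] by (auto simp: FC_def)
  from this[of at_bot] this[of at_top] obtain a b where
    ab: "\<And>t. t \<le> a \<Longrightarrow> app f t = t" "\<And>t. t \<ge> b \<Longrightarrow> app f t = t"
    by (auto simp: translates_def eventually_at_bot_linorder eventually_at_top_linorder)
  have "app f t = t" if "\<bar>t\<bar> \<ge> max (- a) b" for t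
    using that ab[of t] by (cases "t \<ge> 0") auto
  then show "f \<in> PL \<and> (\<exists>M. \<forall>t. \<bar>t\<bar> \<ge> M \<longrightarrow> app f t = t)"
    using f unfolding FC_def FR_def by blast
next
  assume "f \<in> PL \<and> (\<exists>M. \<forall>t. \<bar>t\<bar> \<ge> M \<longrightarrow> app f t = t)"
  then obtain M where *: "f \<in> PL" "\<And>t. \<bar>t\<bar> \<ge> M \<Longrightarrow> app f t = t"
    by blast
  have "translates at_bot f 0"
    unfolding translates_def eventually_at_bot_linorder by (rule exI[of _ "- \<bar>M\<bar>"]) (auto intro!: *)
  moreover have "translates at_top f 0"
    unfolding translates_def eventually_at_top_linorder by (rule exI[of _ "\<bar>M\<bar>"]) (auto intro!: *)
  ultimately have "translates F f 0" if "F \<in> ends" for F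
    using that by (auto simp: ends_def)
  then show "f \<in> FC"
    using * chi_eqI unfolding FC_def FR_def by blast
qed

lemma FC_bounded:
  assumes "f \<in> FC"
  obtains M where "M > 0" "\<And>t. \<bar>t\<bar> \<ge> M \<Longrightarrow> app f t = t"
proof -
  obtain M where "\<And>t. \<bar>t\<bar> \<ge> M \<Longrightarrow> app f t = t"
    using assms FC_iff by blast
  then show ?thesis
    using that[of "max M 1"] by auto
qed

section \<open>Moving dyadic points, cut-off and contraction\<close>

lemma PL_move_left:
  assumes "dyadic x" "dyadic y"
  shows "\<exists>g L. g \<in> PL \<and> app g x = y \<and> (\<forall>t\<le>L. app g t = t)"
proof (cases "x \<le> y")
  case True
  \<comment> \<open>Doubling the interval of length \<open>y - x\<close> that ends at
    \<open>x\<close> pushes \<open>x\<close> to \<open>y\<close>. If \<open>y < x\<close>, the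
    inverse of the map that takes \<open>y\<close> to \<open>x\<close> is used.\<close>
  let ?d = "y - x"
  show ?thesis
  proof (intro exI[of _ "stretch (x - ?d) ?d 1"] exI[of _ "x - ?d"] conjI)
    show "stretch (x - ?d) ?d 1 \<in> PL"
      by (intro stretch_PL dyadic_intros assms) (use True in auto)
  qed (use True in \<open>auto simp: app_stretch\<close>)
next
  case False
  let ?d = "x - y"
  have "stretch (y - ?d) ?d 1 \<in> PL"
    by (intro stretch_PL dyadic_intros assms) (use False in auto)
  then have "- stretch (y - ?d) ?d 1 \<in> PL"
    using PL_D by blast
  then show ?thesis
    by (intro exI[of _ "- stretch (y - ?d) ?d 1"] exI[of _ "y - ?d"] conjI)
       (use False in \<open>auto simp: app_uminus_eq_iff app_stretch\<close>)
qed

lemma PL_move_right: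
  assumes "dyadic x" "dyadic y"
  shows "\<exists>g L. g \<in> PL \<and> app g x = y \<and> (\<forall>t\<ge>L. app g t = t)"
proof -
  have *: "\<exists>g\<in>PL. app g x = y \<and> (\<exists>L. \<forall>t\<ge>L. app g t = t)"
    if d: "dyadic x" "dyadic y" "x \<le> y" for x y
  proof -
    \<comment> \<open>The inverse of the stretch fixes \<open>x\<close> and shifts back by
      \<open>y - x\<close> far to the right, where the translation then cancels it.\<close>
    let ?g = "aff 0 (y - x) - stretch x (y - x) 1"
    have "aff 0 (y - x) \<in> PL" "stretch x (y - x) 1 \<in> PL"
      by (auto intro!: aff_PL stretch_PL dyadic_intros d simp: d)
    then have "?g \<in> PL"
      using PL_D by blast
    moreover have "app (- stretch x (y - x) 1) x = x"
      by (auto simp: app_uminus_eq_iff app_stretch d)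
    then have "app ?g x = y" by simp
    moreover have "app ?g t = t" if "t \<ge> x + 2 * (y - x)" for t
    proof -
      have "app (- stretch x (y - x) 1) t = t - (y - x)"
        using that d by (auto simp: app_uminus_eq_iff app_stretch)
      then show ?thesis by simp
    qed
    ultimately show ?thesis by blast
  qed
  show ?thesis
  proof (cases "x \<le> y")
    case True
    then show ?thesis using *[OF assms] by blast
  next
    case False
    then obtain g L where g: "g \<in> PL" "app g y = x" "\<And>t. t \<ge> L \<Longrightarrow> app g t = t"
      using *[OF assms(2,1)] by auto
    then have "- g \<in> PL"
      using PL_D by blast
    then show ?thesis
      by (intro exI[of _ "- g"] exI[of _ L] conjI) (use g in \<open>auto simp: app_uminus_eq_iff\<close>)
  qed
qed

text \<open>Cut-off: outside a window with dyadic end points, \<open>f\<close> is replaced by maps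
  that carry these points to their images and are the identity far out. It lets a compactly
  supported conjugator stand in for an arbitrary one.\<close>

lemma FC_agree:
  assumes f: "f \<in> PL"
  obtains g where "g \<in> FC" "\<And>t. \<bar>t\<bar> \<le> M \<Longrightarrow> app g t = app f t"
proof -
  obtain m :: nat where "real m \<ge> max M 1"
    using real_arch_simple by blast
  then have m: "real m \<ge> M" "real m > 0" by auto
  have "dyadic (- real m)"
    by (rule dyadic_uminus) simp
  then have d: "dyadic (- real m)" "dyadic (real m)" "dyadic (app f (- real m))" "dyadic (app f (real m))"
    by (simp_all add: PL_dyadic_iff[OF f])
  obtain g L where g: "g \<in> PL" "app g (- real m) = app f (- real m)" "\<And>t. t \<le> L \<Longrightarrow> app g t = t"
    using PL_move_left[OF d(1,3)] by blast
  obtain h R where h: "h \<in> PL" "app h (real m) = app f (real m)" "\<And>t. t \<ge> R \<Longrightarrow> app h t = t"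
    using PL_move_right[OF d(2,4)] by blast
  let ?k = "glue (real m) f h" and ?l = "glue (- real m) g (glue (real m) f h)"
  have k: "app ?k t = (if t \<le> real m then app f t else app h t)" for t
    using h by (subst app_glue) auto
  have l: "app ?l t = (if t \<le> - real m then app g t else app ?k t)" for t
    using g m by (subst app_glue) (auto simp: k)
  have "?k \<in> PL"
    by (intro PL_glue f h d) (simp add: h)
  then have "?l \<in> PL"
    by (rule PL_glue[OF g(1) _ d(1)]) (use g m in \<open>simp add: k\<close>)
  moreover have "app ?l t = t" if "\<bar>t\<bar> \<ge> max \<bar>L\<bar> (max \<bar>R\<bar> (real m + 1))" for t
    using that g(3)[of t] h(3)[of t] m by (auto simp: k l)
  ultimately have "?l \<in> FC"
    using FC_iff by blast
  moreover have "app ?l t = app f t" if "\<bar>t\<bar> \<le> M" for t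
    using that m g(2) by (cases "t = - real m") (auto simp: k l)
  ultimately show ?thesis using that by blast
qed

text \<open>The map sending \<open>t\<close> to \<open>t / 2 ^ n + d\<close>, with \<open>d\<close>
  dyadic between \<open>a\<close> and \<open>b\<close>, is cut off by \<open>FC_agree\<close>.
  Conjugation by the result squeezes a given compact support into \<open>(a, b)\<close>.\<close>

lemma FC_shrink:
  fixes a b :: real
  assumes "a < b"
  obtains g where "g \<in> FC" "\<And>t. \<bar>t\<bar> \<le> M \<Longrightarrow> a < app g t \<and> app g t < b"
proof -
  obtain d where d: "dyadic d" "a < d" "d < b"
    using dyadic_between[OF assms] .
  define e where "e = min (d - a) (b - d)"
  have e: "e > 0" "e \<le> d - a" "e \<le> b - d"
    using d by (auto simp: e_def)
  obtain n :: nat where n: "\<bar>M\<bar> / e < 2 ^ n"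
    using real_arch_pow[of 2] by auto
  have p: "2 powr of_int (- int n) = 1 / (2 ^ n :: real)"
    by (simp add: powr_minus powr_realpow divide_simps)
  have "aff (- int n) d \<in> PL"
    by (intro aff_PL d)
  then obtain g where g: "g \<in> FC" "\<And>t. \<bar>t\<bar> \<le> M \<Longrightarrow> app g t = app (aff (- int n) d) t"
    using FC_agree[of _ M] by metis
  have "a < app g t \<and> app g t < b" if "\<bar>t\<bar> \<le> M" for t
  proof -
    have "\<bar>M\<bar> < 2 ^ n * e"
      using n e by (simp add: pos_divide_less_eq)
    then have "\<bar>t\<bar> < 2 ^ n * e"
      using that by linarith
    then have "\<bar>t / 2 ^ n\<bar> < e"
      by (simp add: pos_divide_less_eq mult.commute)
    moreover have "app g t = t / 2 ^ n + d"
      using g(2)[OF that] p by simp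
    ultimately show ?thesis using e by linarith
  qed
  then show ?thesis using g that by blast
qed

text \<open>On the line these are the classical infinite generating family of Thompson's group, here
  indexed by all integers.\<close>

definition lam :: "int \<Rightarrow> incr" where
  "lam i = stretch (of_int i) 1 1"

lemma app_lam: "app (lam i) t =
    (if t \<le> of_int i then t else if t \<le> of_int i + 1 then of_int i + 2 * (t - of_int i) else t + 1)"
  by (simp add: lam_def app_stretch)

lemma translates_lam: "translates at_bot (lam i) 0" "translates at_top (lam i) 1"
  unfolding translates_def eventually_at_bot_linorder eventually_at_top_linorder
  by (rule exI[of _ "of_int i"], simp add: app_lam) (rule exI[of _ "of_int i + 2"], simp add: app_lam)

lemma lam_FR: "lam i \<in> FR"
  using translates_lam[of i] stretch_PL[of "of_int i" 1 1] by (auto simp: FR_def ends_def lam_def)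

lemma chi_lam [simp]: "chi at_bot (lam i) = 0" "chi at_top (lam i) = 1"
  using translates_lam by (auto intro!: chi_eqI)

text \<open>\<open>lam i\<close> moves only points to the right of \<open>i\<close>, and there
  \<open>lam j\<close> is the translation by one, because \<open>j + 1 \<le> i\<close>.\<close>

lemma lam_conj:
  assumes "j < i"
  shows "lam j + lam i - lam j = lam (i + 1)"
proof -
  have "real_of_int j + 1 \<le> real_of_int i"
    using assms by linarith
  then have "lam j + lam i = lam (i + 1) + lam j"
    by (intro incr_eqI) (auto simp: app_lam)
  then show ?thesis by (simp add: add_diff_eq diff_eq_eq)
qed

text \<open>Modulo a normal subgroup containing all commutators of \<^const>\<open>FR\<close> with \<^const>\<open>FC\<close>, consecutive
  elements \<^const>\<open>lam\<close> agree, because their quotient is itself such a commutator.\<close>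

lemma lam_succ_minus_lam: "lam (i + 1) - lam i =
    lam (i - 1) + (lam i - lam (i - 1)) - lam (i - 1) - (lam i - lam (i - 1))"
  using lam_conj[of "i - 1" i]
  by (simp add: add_group_simps del: add_uminus_conv_diff)

subsection \<open>Generation\<close>

abbreviation Lam :: "incr set" where
  "Lam \<equiv> span_group (range lam)"

lemmas Lam_D = add_subgroupD[OF add_subgroup_span_group[of "range lam"]]

lemma stretch_1_Lam: "stretch (of_int m) (real L) 1 \<in> Lam"
proof (induction L)
  case 0
  have "stretch (of_int m) 0 1 = 0"
    by (rule incr_eqI) (auto simp: app_stretch)
  then show ?case
    using Lam_D by auto
next
  case (Suc L)
  \<comment> \<open>The last unit interval is doubled first; the stretch of the first
    \<open>L\<close> units then merely shifts its image.\<close>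
  have "stretch (of_int m) (real (Suc L)) 1 = stretch (of_int m) (real L) 1 + lam (m + int L)"
    by (rule incr_eqI) (auto simp: app_stretch app_lam)
  then show ?case
    using Suc Lam_D by (metis rangeI span_group.base)
qed

lemma stretch_Lam: "stretch (of_int m) (real L) k \<in> Lam"
proof (induction k)
  case 0
  have "stretch (of_int m) (real L) 0 = 0"
    by (rule incr_eqI) (auto simp: app_stretch)
  then show ?case
    using Lam_D by auto
next
  case (Suc k)
  \<comment> \<open>The image of the interval under slope \<open>2 ^ k\<close> has length
    \<open>2 ^ k * L\<close>; this image is doubled.\<close>
  have "stretch (of_int m) (real L) (Suc k) = stretch (of_int m) (real (2 ^ k * L)) 1 + stretch (of_int m) (real L) k"
  proof (rule incr_eqI)
    fix t :: real
    have p: "(2 :: real) ^ k \<ge> 1" by simp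
    consider "t \<le> m" | "m < t" "t \<le> m + real L" | "t > m + real L" by linarith
    then show "app (stretch (of_int m) (real L) (Suc k)) t =
        app (stretch (of_int m) (real (2 ^ k * L)) 1 + stretch (of_int m) (real L) k) t"
    proof cases
      case 2
      define y where "y = m + 2 ^ k * (t - m)"
      have "y > m" "y \<le> m + real (2 ^ k * L)"
        using 2 by (auto simp: y_def)
      then have "app (stretch (of_int m) (real (2 ^ k * L)) 1) y = m + 2 * (y - m)"
        by (subst app_stretch) auto
      then show ?thesis
        using 2 by (simp add: app_stretch y_def)
    next
      case 3
      define y where "y = t + (2 ^ k - 1) * real L"
      have "y > m + real (2 ^ k * L)"
        using 3 by (simp add: y_def algebra_simps)
      moreover from this have "y > m"
        by (smt (verit) of_nat_0_le_iff)
      ultimately have "app (stretch (of_int m) (real (2 ^ k * L)) 1) y = y + real (2 ^ k * L)"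
        by (subst app_stretch) auto
      moreover have "real_of_int m < t" using 3 by linarith
      ultimately show ?thesis
        using 3 by (simp add: app_stretch y_def algebra_simps)
    qed (auto simp: app_stretch)
  qed
  then show ?case
    using Suc stretch_1_Lam Lam_D by metis
qed

text \<open>The leftmost unit interval is peeled off: with \<open>e\<close> the stretch of that
  interval, \<open>- e + g\<close> is the identity one unit further. Beyond the stretched interval
  \<open>e\<close> is a translation, so the other slopes survive with their index shifted. After
  \<open>w\<close> rounds nothing is left.\<close>

lemma integral_slopes_Lam:
  assumes "\<And>t. t \<le> of_int m \<Longrightarrow> app g t = t"
    and "\<And>i t. of_int m + real i \<le> t \<Longrightarrow> t \<le> of_int m + real i + 1 \<Longrightarrow>
       app g t = app g (of_int m + real i) + 2 ^ j i * (t - (of_int m + real i))"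
    and "\<And>i. i \<ge> w \<Longrightarrow> j i = (0::nat)"
  shows "g \<in> Lam"
  using assms
proof (induction w arbitrary: m g j)
  case 0
  note prems = 0
  have *: "app g (of_int m + real i) = of_int m + real i" for i
  proof (induction i)
    case 0
    then show ?case using prems(1)[of "of_int m"] by simp
  next
    case (Suc i)
    then show ?case
      using prems(2)[of i "of_int m + real (Suc i)"] prems(3)[of i] by simp
  qed
  have "app g t = t" for t
  proof (cases "t \<le> of_int m")
    case False
    define i where "i = nat \<lfloor>t - of_int m\<rfloor>"
    have "of_int m + real i \<le> t" "t \<le> of_int m + real i + 1"
      using False unfolding i_def by linarith+
    then show ?thesis
      using prems(2)[of i t] prems(3)[of i] * by simp
  qed (use prems in auto)
  then have "g = 0" by (intro incr_eqI) auto
  then show ?case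
    using Lam_D by auto
next
  case (Suc w)
  define e where "e = stretch (of_int m) (real 1) (j 0)"
  let ?c = "2 ^ j 0 - 1 :: real"
  have e: "app e t = (if t \<le> of_int m then t else if t \<le> of_int m + 1 then of_int m + 2 ^ j 0 * (t - of_int m)
      else t + ?c)" for t
    by (simp add: app_stretch e_def)
  have c: "?c \<ge> 0" by simp
  have gm: "app g (of_int m) = of_int m" using Suc.prems(1)[of "of_int m"] by simp
  have "app g t = app e t" if "t \<le> of_int m + 1" for t
    using that Suc.prems(1)[of t] Suc.prems(2)[of 0 t] gm by (auto simp: e)
  then have 1: "app (- e + g) t = t" if "t \<le> of_int (m + 1)" for t
    using that by (simp add: app_uminus_eq_iff)
  have 2: "app (- e + g) t = app g t - ?c" if t: "t \<ge> of_int m + 1" for t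
  proof -
    have "app g t \<ge> app g (of_int m + 1)" using that by simp
    also have "app g (of_int m + 1) = of_int m + 1 + ?c"
      using Suc.prems(2)[of 0 "of_int m + 1"] gm by simp
    finally have "app g t = of_int m + 1 + ?c \<or> app g t > of_int m + 1 + ?c" by linarith
    then have "app e (app g t - ?c) = app g t"
      using c by (elim disjE) (auto simp: e)
    then show ?thesis by (simp add: app_uminus_eq_iff)
  qed
  have "- e + g \<in> Lam"
  proof (rule Suc.IH[of "m + 1" _ "\<lambda>i. j (Suc i)"])
    fix i t
    assume "of_int (m + 1) + real i \<le> t" "t \<le> of_int (m + 1) + real i + 1"
    then show "app (- e + g) t = app (- e + g) (of_int (m + 1) + real i)
        + 2 ^ j (Suc i) * (t - (of_int (m + 1) + real i))"
      using Suc.prems(2)[of "Suc i" t] by (subst (1 2) 2) (auto simp: algebra_simps)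
  qed (use 1 Suc.prems(3) in auto)
  then have "e + (- e + g) \<in> Lam"
    using stretch_Lam[of m 1 "j 0"] e_def Lam_D by metis
  then show ?case by (simp add: add.assoc[symmetric])
qed

text \<open>Bolzano's principle turns the local condition into a uniform dyadic subdivision.
  Quantifying over all \<open>N \<ge> n\<close> lets two adjacent intervals be merged at the larger
  level; a cell belongs to an interval when its left end does, and may protrude on the
  right.\<close>

lemma grid:
  fixes f :: "real \<Rightarrow> real"
  assumes "a \<le> b" and "\<And>t. a \<le> t \<Longrightarrow> t \<le> b \<Longrightarrow> pl_at f t"
  shows "\<exists>n. \<forall>N\<ge>n. \<forall>i::int. a \<le> of_int i / 2 ^ N \<longrightarrow> of_int i / 2 ^ N \<le> b \<longrightarrow>
    (\<exists>A\<in>dyadic_affine. \<forall>t\<in>{of_int i / 2 ^ N .. (of_int i + 1) / 2 ^ N}. f t = A t)"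
  using assms(1)
proof (induction rule: Bolzano[consumes 1])
  case (trans a b c)
  then obtain n m where
    "\<And>N i. N \<ge> n \<Longrightarrow> a \<le> real_of_int i / 2 ^ N \<Longrightarrow> real_of_int i / 2 ^ N \<le> b \<Longrightarrow>
    (\<exists>A\<in>dyadic_affine. \<forall>t\<in>{real_of_int i / 2 ^ N .. (real_of_int i + 1) / 2 ^ N}. f t = A t)"
    "\<And>N i. N \<ge> m \<Longrightarrow> b \<le> real_of_int i / 2 ^ N \<Longrightarrow> real_of_int i / 2 ^ N \<le> c \<Longrightarrow>
    (\<exists>A\<in>dyadic_affine. \<forall>t\<in>{real_of_int i / 2 ^ N .. (real_of_int i + 1) / 2 ^ N}. f t = A t)"
    by blast
  then show ?case
    by (intro exI[of _ "max n m"]) (metis le_cases max.bounded_iff)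
next
  case (local x)
  then obtain A B where AB: "A \<in> dyadic_affine" "B \<in> dyadic_affine"
     "agree f A x (-1)" "agree f B x 1" "dyadic x \<or> A = B"
    using assms(2)[of x] unfolding pl_at_def by blast
  obtain e where e: "e > 0" "\<And>u. 0 \<le> u \<Longrightarrow> u \<le> e \<Longrightarrow> f (x + -1 * u) = A (x + -1 * u)"
    using AB unfolding agree_def by blast
  obtain e' where e': "e' > 0" "\<And>u. 0 \<le> u \<Longrightarrow> u \<le> e' \<Longrightarrow> f (x + 1 * u) = B (x + 1 * u)"
    using AB unfolding agree_def by blast
  have fA: "f t = A t" if "x - e \<le> t" "t \<le> x" for t
    using e(2)[of "x - t"] that by simp
  have fB: "f t = B t" if "x \<le> t" "t \<le> x + e'" for t
    using e'(2)[of "t - x"] that by simp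
  \<comment> \<open>Interval and cell are each shorter than \<open>d\<close>, so the cell stays
    within \<open>2 * d\<close> of \<open>x\<close>, where the germs \<open>A\<close> and
    \<open>B\<close> are valid.\<close>
  define d where "d = min e e' / 2"
  have d: "d > 0" "2 * d \<le> e" "2 * d \<le> e'" using e e' by (auto simp: d_def)
  obtain n0 :: nat where n0: "1 / d < 2 ^ n0"
    using real_arch_pow[of 2] by auto
  \<comment> \<open>If \<open>x\<close> is dyadic, it is a grid point from some level on.\<close>
  obtain n1 where n1: "\<And>N. dyadic x \<Longrightarrow> N \<ge> n1 \<Longrightarrow> \<exists>j::int. x * 2 ^ N = of_int j"
  proof (cases "dyadic x")
    case True
    then obtain c k where c: "x = real_of_int c / 2 ^ k" unfolding dyadic_def by blast
    have "x * 2 ^ N = of_int (c * 2 ^ (N - k))" if "N \<ge> k" for N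
      using that by (simp add: c power_add[symmetric] field_simps)
    then show ?thesis using that by blast
  qed (use that in blast)
  show ?case
  proof (intro exI[of _ d] conjI allI impI)
    fix a' b' assume ab: "a' \<le> x \<and> x \<le> b' \<and> b' - a' < d"
    show "\<exists>n. \<forall>N\<ge>n. \<forall>i::int. a' \<le> of_int i / 2 ^ N \<longrightarrow> of_int i / 2 ^ N \<le> b' \<longrightarrow>
      (\<exists>A\<in>dyadic_affine. \<forall>t\<in>{of_int i / 2 ^ N .. (of_int i + 1) / 2 ^ N}. f t = A t)"
    proof (intro exI[of _ "max n0 n1"] allI impI)
      fix N i assume N: "max n0 n1 \<le> N" and i: "a' \<le> real_of_int i / 2 ^ N" "real_of_int i / 2 ^ N \<le> b'"
      have "(2::real) ^ n0 \<le> 2 ^ N"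
        using N by (intro power_increasing) auto
      then have "1 / d < 2 ^ N"
        using n0 by linarith
      then have "1 / 2 ^ N < d"
        using d by (simp add: field_simps)
      then have *: "x - e \<le> real_of_int i / 2 ^ N" "(real_of_int i + 1) / 2 ^ N \<le> x + e'"
        using i ab d by (auto simp: add_divide_distrib)
      consider "A = B" | "(real_of_int i + 1) / 2 ^ N \<le> x" | "x \<le> real_of_int i / 2 ^ N"
      proof (cases "A = B")
        case False
        then obtain j :: int where j: "x * 2 ^ N = of_int j" using AB n1[of N] N by auto
        then have x: "x = of_int j / 2 ^ N" by (simp add: field_simps)
        have "real_of_int (i + 1) \<le> of_int j \<or> real_of_int j \<le> of_int i"
          unfolding of_int_le_iff by linarith
        then have "(real_of_int i + 1) / 2 ^ N \<le> x \<or> x \<le> real_of_int i / 2 ^ N"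
          unfolding x by (auto simp: divide_right_mono)
        then show ?thesis using that by blast
      qed (use that in blast)
      then show "\<exists>A\<in>dyadic_affine. \<forall>t\<in>{real_of_int i / 2 ^ N .. (real_of_int i + 1) / 2 ^ N}. f t = A t"
      proof cases
        case 1
        then have "f t = A t" if "x - e \<le> t" "t \<le> x + e'" for t
          using that fA fB by (cases "t \<le> x") auto
        then show ?thesis using * AB by (intro bexI[of _ A]) auto
      next
        case 2
        then show ?thesis using * AB fA by (intro bexI[of _ A]) auto
      next
        case 3
        then show ?thesis using * AB fB by (intro bexI[of _ B]) auto
      qed
    qed
  qed (use d in auto)
qed

text \<open>\<open>p\<close> magnifies the domain so that grid cells become unit intervals,
  \<open>q\<close> magnifies the range so that no slope is below \<open>1\<close>. Then
  \<open>q + f - p\<close> falls under \<open>integral_slopes_Lam\<close>, and \<open>p\<close> and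
  \<open>q\<close> are themselves in \<open>Lam\<close>.\<close>

lemma PL_subset_Lam:
  assumes f: "f \<in> PL" and l: "\<And>t. t \<le> - real M \<Longrightarrow> app f t = t"
    and r: "\<And>t. t \<ge> real M \<Longrightarrow> app f t = t + of_int l"
  shows "f \<in> Lam"
proof -
  have "\<exists>n. \<forall>N\<ge>n. \<forall>i::int. - real M \<le> of_int i / 2 ^ N \<longrightarrow> of_int i / 2 ^ N \<le> real M \<longrightarrow>
    (\<exists>A\<in>dyadic_affine. \<forall>t\<in>{of_int i / 2 ^ N .. (of_int i + 1) / 2 ^ N}. app f t = A t)"
    by (rule grid) (use f in \<open>auto simp: PL_def\<close>)
  then obtain n where n: "\<And>i::int. - real M \<le> of_int i / 2 ^ n \<Longrightarrow> of_int i / 2 ^ n \<le> real M \<Longrightarrow>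
    (\<exists>A\<in>dyadic_affine. \<forall>t\<in>{of_int i / 2 ^ n .. (of_int i + 1) / 2 ^ n}. app f t = A t)"
    by blast
  \<comment> \<open>The number of cells of length \<open>1 / 2 ^ n\<close> in
    \<open>[- M, M]\<close>.\<close>
  define W where "W = 2 * M * 2 ^ n"
  have "\<exists>k::int. \<forall>t\<in>{- real M + real i / 2 ^ n .. - real M + (real i + 1) / 2 ^ n}.
      app f t = app f (- real M + real i / 2 ^ n) + 2 powr of_int k * (t - (- real M + real i / 2 ^ n))"
    if i: "i < W" for i
  proof -
    let ?i = "int i - int M * 2 ^ n"
    have eq: "of_int ?i / 2 ^ n = - real M + real i / 2 ^ n" "(of_int ?i + 1) / 2 ^ n = - real M + (real i + 1) / 2 ^ n"
      by (auto simp: field_simps)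
    have "real W = 2 * real M * 2 ^ n"
      by (simp add: W_def)
    then have "real i \<le> 2 * real M * 2 ^ n"
      using i by linarith
    then have "real i / 2 ^ n \<le> 2 * real M"
      by (simp add: field_simps)
    then obtain A where A: "A \<in> dyadic_affine" "\<forall>t\<in>{of_int ?i / 2 ^ n .. (of_int ?i + 1) / 2 ^ n}. app f t = A t"
      using n[of ?i] unfolding eq by auto
    obtain k c where "A = (\<lambda>x. 2 powr of_int k * x + c)"
      using A unfolding dyadic_affine_def by blast
    then show ?thesis
      using A(2) unfolding eq by (intro exI[of _ k]) (auto simp: algebra_simps divide_right_mono)
  qed
  then obtain k :: "nat \<Rightarrow> int" where k: "\<And>i t. i < W \<Longrightarrow> - real M + real i / 2 ^ n \<le> t \<Longrightarrow>
      t \<le> - real M + (real i + 1) / 2 ^ n \<Longrightarrow>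
      app f t = app f (- real M + real i / 2 ^ n) + 2 powr of_int (k i) * (t - (- real M + real i / 2 ^ n))"
    by (metis atLeastAtMost_iff)
  \<comment> \<open>A crude bound: the sum dominates each of its terms, so every exponent
    \<open>N + k i - n\<close> is nonnegative.\<close>
  define N where "N = (\<Sum>i<W. nat \<bar>int n - k i\<bar>)"
  have N: "int N + k i - int n \<ge> 0" if "i < W" for i
  proof -
    have "nat \<bar>int n - k i\<bar> \<le> N"
      unfolding N_def by (rule member_le_sum) (use that in auto)
    then show ?thesis by linarith
  qed
  have "app f (real M) \<ge> app f (- real M)" by simp
  then have Ml: "0 \<le> 2 * int M + l" using l[of "- real M"] r[of "real M"] by simp
  \<comment> \<open>The length of the image \<open>[- M, M + l]\<close> of \<open>[- M, M]\<close>
    under \<open>f\<close>.\<close>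
  define L where "L = nat (2 * int M + l)"
  have L: "real L = 2 * real M + of_int l" using Ml by (simp add: L_def)
  define p where "p = stretch (of_int (- int M)) (real (2 * M)) n"
  define q where "q = stretch (of_int (- int M)) (real L) N"
  have p_inv: "app (- p) t = - real M + (t + real M) / 2 ^ n" if "- real M \<le> t" "t \<le> - real M + W" for t
  proof -
    have "(t + real M) / 2 ^ n \<le> 2 * real M" "0 \<le> (t + real M) / 2 ^ n"
      using that by (auto simp: W_def field_simps)
    then show ?thesis
      by (simp add: p_def app_uminus_eq_iff app_stretch)
  qed
  have p_inv': "app (- p) t = t - (2 ^ n - 1) * (2 * real M)" if "t \<ge> - real M + W" for t
  proof -
    define y where "y = t - (2 ^ n - 1) * (2 * real M)"
    then have t: "t = y + (2 ^ n - 1) * (2 * real M)" by simp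
    have "y = real M \<or> y > real M"
      using that by (auto simp: y_def W_def algebra_simps)
    then have "app p y = t"
      unfolding t p_def by (subst app_stretch) (auto simp: algebra_simps)
    then show ?thesis by (simp only: app_uminus_eq_iff y_def)
  qed
  have q_app: "app q t = - real M + 2 ^ N * (t + real M)" if "- real M \<le> t" "t \<le> real M + of_int l" for t
    using that by (auto simp: q_def app_stretch L)
  have q_app': "app q t = t + (2 ^ N - 1) * real L" if "t \<ge> real M + of_int l" for t
  proof -
    obtain y where t: "t = y + real L" by (metis diff_add_cancel)
    have "y = - real M \<or> y > - real M"
      using that L t by auto
    then show ?thesis
      unfolding t q_def by (subst app_stretch) (auto simp: algebra_simps)
  qed
  define g where "g = q + f - p"
  have "g \<in> Lam"
  \<comment> \<open>The exponent collects \<open>N\<close> from \<open>q\<close>, \<open>k i\<close>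
    from \<open>f\<close> and \<open>- n\<close> from the inverse of \<open>p\<close>.\<close>
  proof (rule integral_slopes_Lam[of "- int M" _ "\<lambda>i. if i < W then nat (int N + k i - int n) else 0" W])
    fix t :: real assume t: "t \<le> of_int (- int M)"
    then have "app (- p) t = t"
      by (simp add: p_def app_uminus_eq_iff app_stretch)
    then show "app g t = t"
      using t l[of t] by (simp add: g_def q_def app_stretch)
  next
    fix i t
    assume it: "of_int (- int M) + real i \<le> t" "t \<le> of_int (- int M) + real i + 1"
    let ?t0 = "of_int (- int M) + real i"
    show "app g t = app g ?t0 + 2 ^ (if i < W then nat (int N + k i - int n) else 0) * (t - ?t0)"
    proof (cases "i < W")
      case True
      then have "real i + 1 \<le> real W" by linarith
      have "app f (real M) = real M + of_int l" using r by simp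
      have g_app: "app g s = - real M + 2 ^ N * (app f (- real M + (s + real M) / 2 ^ n) + real M)"
        if s: "?t0 \<le> s" "s \<le> ?t0 + 1" for s
      proof -
        let ?y = "- real M + (s + real M) / 2 ^ n"
        have "app (- p) s = ?y"
          using s \<open>real i + 1 \<le> real W\<close> by (intro p_inv) auto
        moreover have "- real M \<le> ?y" "?y \<le> real M"
        proof -
          have "(s + real M) / 2 ^ n \<le> 2 * real M" "0 \<le> (s + real M) / 2 ^ n"
            using s \<open>real i + 1 \<le> real W\<close> by (auto simp: W_def field_simps)
          then show "- real M \<le> ?y" "?y \<le> real M" by auto
        qed
        then have "- real M \<le> app f ?y" "app f ?y \<le> real M + of_int l"
          using app_le_iff[of f "- real M" ?y] app_le_iff[of f ?y "real M"] l[of "- real M"] r[of "real M"] by auto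
        ultimately show ?thesis
          using q_app by (simp add: g_def)
      qed
      have e: "(2::real) ^ nat (int N + k i - int n) = 2 ^ N * 2 powr of_int (k i) / 2 ^ n"
      proof -
        have "(2::real) ^ nat (int N + k i - int n) = 2 powr (of_int (int N + k i - int n))"
          using N[OF True] powr_realpow[of 2 "nat (int N + k i - int n)"] by simp
        also have "\<dots> = 2 ^ N * 2 powr of_int (k i) / 2 ^ n"
          by (simp add: powr_add powr_diff powr_realpow)
        finally show ?thesis .
      qed
      have "- real M + real i / 2 ^ n \<le> - real M + (t + real M) / 2 ^ n"
        "- real M + (t + real M) / 2 ^ n \<le> - real M + (real i + 1) / 2 ^ n"
        using it by (auto intro!: divide_right_mono)
      then have "app f (- real M + (t + real M) / 2 ^ n) =
          app f (- real M + real i / 2 ^ n) + 2 powr of_int (k i) * ((t - ?t0) / 2 ^ n)"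
        by (subst k[OF True]) (auto simp: field_simps)
      then show ?thesis
        using True it by (simp add: g_app e algebra_simps)
    next
      case False
      then have W: "real W \<le> real i" by simp
      have g_app: "app g s = s - (2 ^ n - 1) * (2 * real M) + of_int l + (2 ^ N - 1) * real L" if s: "?t0 \<le> s" for s
      proof -
        let ?y = "s - (2 ^ n - 1) * (2 * real M)"
        have "app (- p) s = ?y"
          using s W by (intro p_inv') auto
        moreover have "?y \<ge> real M"
          using s W by (simp add: W_def algebra_simps)
        ultimately show ?thesis
          using r[of ?y] q_app'[of "?y + of_int l"] by (simp add: g_def)
      qed
      show ?thesis using False it by (simp add: g_app)
    qed
  qed auto
  moreover have "p \<in> Lam" "q \<in> Lam"
    unfolding p_def q_def by (rule stretch_Lam)+
  ultimately have "- q + g + p \<in> Lam"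
    using Lam_D by metis
  moreover have "- q + g + p = f"
    by (rule incr_eqI) (simp add: g_def)
  ultimately show ?thesis by simp
qed

subsection \<open>Perfectness and finite index subgroups\<close>

text \<open>Modulo \<open>N\<close> all \<open>lam i\<close> coincide, so an element of
  \<open>FC\<close>, being a word in them, is a multiple of \<open>lam 0\<close> modulo
  \<open>N\<close>. Its length at the right end is the multiplier, which is therefore zero.\<close>

lemma FC_subset_if_commutators:
  assumes N: "add_subgroup N" "N \<subseteq> FC" "add_normalizes FR N"
    and comm: "\<And>h f. h \<in> FR \<Longrightarrow> f \<in> FC \<Longrightarrow> h + f - h - f \<in> N"
  shows "FC \<subseteq> N"
proof
  have d: "lam i - lam (i - 1) \<in> FC" for i
    using lam_FR FR_D(4) by (auto simp: FC_def ends_def chi_diff)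
  have succ: "lam (i + 1) - lam i \<in> N" for i
    unfolding lam_succ_minus_lam using comm lam_FR d by blast
  have "lam i - lam 0 \<in> N" for i
  proof (induction i rule: int_induct[where k = 0])
    case base
    then show ?case using N add_subgroupD by simp
  next
    case (step1 i)
    have "(lam (i + 1) - lam i) + (lam i - lam 0) \<in> N"
      using step1 succ N add_subgroupD by blast
    then show ?case by (simp add: algebra_simps)
  next
    case (step2 i)
    have "- (lam i - lam (i - 1)) + (lam i - lam 0) \<in> N"
      using step2 succ[of "i - 1"] N add_subgroupD by (metis diff_add_cancel)
    then show ?case by (simp add: add_group_simps del: add_uminus_conv_diff)
  qed
  then have lam: "\<exists>n. \<exists>x\<in>N. lam i = zmult n (lam 0) + x" for i
    using add_conjugate_uminus[OF FR_add_subgroup N(3) lam_FR[of 0], of "lam i - lam 0"]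
    by (intro exI[of _ 1] bexI[of _ "- lam 0 + (lam i - lam 0) + lam 0"]) (auto simp: add.assoc[symmetric])
  fix f assume f: "f \<in> FC"
  then obtain M where M: "M > 0" "\<And>t. \<bar>t\<bar> \<ge> M \<Longrightarrow> app f t = t"
    using FC_bounded by blast
  obtain m :: nat where m: "real m \<ge> M"
    using real_arch_simple by blast
  have "f \<in> Lam"
    by (rule PL_subset_Lam[of f m 0]) (use f M m in \<open>auto simp: FC_iff\<close>)
  then obtain n x where nx: "x \<in> N" "f = zmult n (lam 0) + x"
    using span_group_cyclic_mod[OF FR_add_subgroup N(1,3) lam_FR[of 0], of "range lam" f] lam by blast
  \<comment> \<open>\<open>lam 0\<close> has length \<open>1\<close> at the right end, and
    \<open>N\<close> lies in \<open>FC\<close>.\<close>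
  have "chi at_top f = n"
    using nx N(2) zmult_in_add_subgroup[OF FR_add_subgroup lam_FR[of 0], of n] lam_FR[of 0]
    by (auto simp: chi_add chi_zmult FC_def)
  then have "n = 0"
    using f by (simp add: FC_def)
  then show "f \<in> N"
    using nx by simp
qed

text \<open>The support of \<open>f\<close> is invariant under \<open>f\<close>, and a conjugate of
  \<open>f\<close> sees the conjugator only there.\<close>

lemma conj_eq_if_agree:
  assumes "\<And>t. app f t \<noteq> t \<Longrightarrow> app h t = app h' t"
  shows "h + f - h = h' + f - h'"
proof -
  have "h + f = (h' + f - h') + h"
  proof (rule incr_eqI)
    fix t
    show "app (h + f) t = app (h' + f - h' + h) t"
    proof (cases "app f t = t")
      case True
      have "app f (app (- h') (app h t)) = app (- h') (app h t)"
        using assms[of "app (- h') (app h t)"] True by (metis app_app_uminus app_eq_iff)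
      then show ?thesis using True by simp
    next
      case False
      then have "app h t = app h' t" "app h (app f t) = app h' (app f t)"
        using assms[of t] assms[of "app f t"] by auto
      then show ?thesis by simp
    qed
  qed
  then show ?thesis by (simp add: diff_eq_eq)
qed

text \<open>Cutting \<open>h\<close> off outside the support of \<open>f\<close> does not change the
  commutator, so commutators of \<open>FR\<close> with \<open>FC\<close> are commutators inside
  \<open>FC\<close>.\<close>

lemma commutator_replace_FC:
  assumes "h \<in> FR" "f \<in> FC"
  obtains h' where "h' \<in> FC" "h + f - h - f = h' + f - h' - f"
proof -
  obtain M where M: "\<And>t. \<bar>t\<bar> \<ge> M \<Longrightarrow> app f t = t"
    using FC_bounded assms(2) by metis
  obtain h' where h': "h' \<in> FC" "\<And>t. \<bar>t\<bar> \<le> M \<Longrightarrow> app h' t = app h t"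
    using FC_agree[of h M] assms by (auto simp: FR_def)
  have "h + f - h = h' + f - h'"
  proof (rule conj_eq_if_agree)
    fix t assume "app f t \<noteq> t"
    then have "\<not> M \<le> \<bar>t\<bar>" using M by blast
    then show "app h t = app h' t" by (simp add: h'(2))
  qed
  then show ?thesis using that h' by auto
qed

definition FC_commutators :: "incr set" where
  "FC_commutators = {h + f - h - f | h f. h \<in> FC \<and> f \<in> FC}"

text \<open>The derived group of \<open>FC\<close> is normalized by \<open>FR\<close> and contains
  the mixed commutators by \<open>commutator_replace_FC\<close>, so
  \<open>FC_subset_if_commutators\<close> applies to it.\<close>

lemma FC_perfect: "FC \<subseteq> span_group FC_commutators"
proof (rule FC_subset_if_commutators)
  show "add_subgroup (span_group FC_commutators)"
    by (rule add_subgroup_span_group)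
  show "span_group FC_commutators \<subseteq> FC"
    by (rule span_group_minimal[OF FC_add_subgroup])
       (use commutator_FC FC_subset_FR in \<open>auto simp: FC_commutators_def\<close>)
  have "g + x - g \<in> span_group FC_commutators" if g: "g \<in> FR" and "x \<in> span_group FC_commutators" for g x
    using that(2)
  proof induction
    case (base x)
    then obtain h f where hf: "h \<in> FC" "f \<in> FC" "x = h + f - h - f"
      by (auto simp: FC_commutators_def)
    have "g + x - g = (g + h - g) + (g + f - g) - (g + h - g) - (g + f - g)"
      by (simp add: hf add_group_simps del: add_uminus_conv_diff)
    moreover have "g + h - g \<in> FC" "g + f - g \<in> FC"
      using FC_normal g hf by (auto simp: add_normalizes_def)
    ultimately have "g + x - g \<in> FC_commutators"
      unfolding FC_commutators_def by blast
    then show ?case by (rule span_group.base)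
  next
    case (plus x y)
    have "g + (x + y) - g = (g + x - g) + (g + y - g)"
      by (simp add: add_group_simps del: add_uminus_conv_diff)
    then show ?case using plus span_group.plus by metis
  next
    case (uminus x)
    have "g + - x - g = - (g + x - g)"
      by (simp add: add_group_simps del: add_uminus_conv_diff)
    then show ?case using uminus span_group.uminus by metis
  qed (auto intro: span_group.zero)
  then show "add_normalizes FR (span_group FC_commutators)"
    unfolding add_normalizes_def by blast
  fix h f assume "h \<in> FR" "f \<in> FC"
  then obtain h' where "h' \<in> FC" "h + f - h - f = h' + f - h' - f"
    using commutator_replace_FC by metis
  then show "h + f - h - f \<in> span_group FC_commutators"
    using \<open>f \<in> FC\<close> by (intro span_group.base) (auto simp: FC_commutators_def)
qed

lemma FC_subset_if_FC_commutators:
  assumes "add_subgroup N" "\<And>h f. h \<in> FC \<Longrightarrow> f \<in> FC \<Longrightarrow> h + f - h - f \<in> N"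
  shows "FC \<subseteq> N"
proof -
  have "span_group FC_commutators \<subseteq> N"
    by (rule span_group_minimal) (use assms in \<open>auto simp: FC_commutators_def\<close>)
  then show ?thesis using FC_perfect by blast
qed

text \<open>Some power of a long translation lies in \<open>N\<close> and carries the support of
  \<open>h\<close> off that of \<open>f\<close>. Replacing \<open>h\<close> by its commutator with
  that power does not change \<open>[h, f]\<close> and exhibits it as an element of
  \<open>N\<close>.\<close>

lemma finite_index_FC_subset:
  assumes N: "add_subgroup N" "add_normalizes FR N"
    and fin: "\<And>u. u \<in> FR \<Longrightarrow> \<exists>m>0. nmult m u \<in> N"
  shows "FC \<subseteq> N"
proof (rule FC_subset_if_FC_commutators[OF N(1)])
  fix h f assume hf: "h \<in> FC" "f \<in> FC"
  obtain M where M: "\<And>t. \<bar>t\<bar> \<ge> M \<Longrightarrow> app f t = t"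
    using FC_bounded hf(2) by metis
  obtain M' where M': "\<And>t. \<bar>t\<bar> \<ge> M' \<Longrightarrow> app h t = t"
    using FC_bounded hf(1) by metis
  obtain c :: nat where c: "real c \<ge> \<bar>M\<bar> + \<bar>M'\<bar>"
    using real_arch_simple by blast
  let ?u = "aff 0 (real c)"
  have "translates F ?u (int c)" for F
    by (simp add: translates_def)
  then have "?u \<in> FR"
    unfolding FR_def using aff_PL[of "real c" 0] by auto
  then obtain m where m: "m > 0" "nmult m ?u \<in> N"
    using fin by blast
  have app_w: "app (nmult n ?u) t = t + real n * real c" for n t
    by (induction n) (auto simp: algebra_simps)
  define w where "w = nmult m ?u"
  have w: "app w t = t + real m * real c" for t
    by (simp add: w_def app_w)
  have w': "app (- w) t = t - real m * real c" for t
    by (simp add: app_uminus_eq_iff w)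
  have mc: "real m * real c \<ge> \<bar>M\<bar> + \<bar>M'\<bar>"
  proof -
    have "1 * real c \<le> real m * real c"
      using m by (intro mult_right_mono) auto
    then show ?thesis using c by linarith
  qed
  \<comment> \<open>The commutator of \<open>h\<close> with the long translation \<open>w\<close> lies in \<open>N\<close> and acts like \<open>h\<close> on the support of \<open>f\<close>.\<close>
  define h' where "h' = h + w - h - w"
  have "h + w - h \<in> N"
    using N(2) hf m FC_subset_FR unfolding add_normalizes_def w_def by blast
  then have h': "h' \<in> N"
    using m N(1) add_subgroupD unfolding h'_def w_def by blast
  have "h + f - h = h' + f - h'"
  proof (rule conj_eq_if_agree)
    fix t assume "app f t \<noteq> t"
    then have "\<bar>t\<bar> < M" using M[of t] by force
    then have "\<bar>t - real m * real c\<bar> \<ge> M'"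
      using mc by linarith
    then have "app (- h) (t - real m * real c) = t - real m * real c"
      using M' by (simp add: app_uminus_eq_iff)
    then show "app h t = app h' t"
      by (simp add: h'_def w w')
  qed
  then have "h + f - h - f = h' + (f + - h' - f)"
    by (simp add: add_group_simps del: add_uminus_conv_diff)
  moreover have "f + - h' - f \<in> N"
    using N(2) hf add_subgroupD(3)[OF N(1) h'] FC_subset_FR unfolding add_normalizes_def by blast
  ultimately show "h + f - h - f \<in> N"
    using h' add_subgroupD(2)[OF N(1)] by simp
qed

lemma disjoint_supports_commute:
  assumes "\<And>t. app f t = t \<or> app g t = t"
  shows "f + g = g + f"
  unfolding incr_commute_iff
proof
  fix t
  show "app f (app g t) = app g (app f t)"
    using assms[of t] assms[of "app f t"] assms[of "app g t"] by auto
qed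

text \<open>Higman's commutator trick: \<open>k\<close> displaces an interval, into which
  \<open>g\<close> conjugates the supports of \<open>a\<close> and \<open>b\<close>. Then
  \<open>c\<close> is supported off the interval and commutes with \<open>b'\<close>, while
  \<open>a' + c\<close> is the commutator of \<open>a'\<close> and \<open>k\<close> and lies in
  \<open>K\<close>. Hence \<open>[a', b'] = [a' + c, b']\<close> lies in \<open>K\<close>.\<close>

lemma normal_FC_subset:
  assumes K: "add_subgroup K" "add_normalizes H K" "k \<in> K" "k \<noteq> 0" and H: "add_subgroup H" "FC \<subseteq> H"
  shows "FC \<subseteq> K"
proof (rule FC_subset_if_FC_commutators[OF K(1)])
  fix a b assume ab: "a \<in> FC" "b \<in> FC"
  obtain t where t: "app k t \<noteq> t"
    using K(4) by (metis app_zero incr_eqI)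
  \<comment> \<open>The interval between \<open>t\<close> and its preimage; \<open>- k\<close> maps
    it to a disjoint one.\<close>
  define u v where "u = min t (app (- k) t)" and "v = max t (app (- k) t)"
  have "app (- k) t \<noteq> t"
    using t by (metis app_app_uminus)
  then have uv: "u < v"
    by (auto simp: u_def v_def)
  have disj: "\<not> (u < app (- k) s \<and> app (- k) s < v)" if "u < s" "s < v" for s
  proof (cases "app (- k) t < t")
    case True
    then have "app (- k) s < app (- k) t"
      using that unfolding app_less_iff by (simp add: v_def)
    then show ?thesis using True by (simp add: u_def)
  next
    case False
    then have "app (- k) t < app (- k) s"
      using that unfolding app_less_iff by (simp add: u_def)
    then show ?thesis using False by (simp add: v_def)
  qed
  obtain M where M: "\<And>t. \<bar>t\<bar> \<ge> M \<Longrightarrow> app a t = t"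
    using FC_bounded ab(1) by metis
  obtain M' where M': "\<And>t. \<bar>t\<bar> \<ge> M' \<Longrightarrow> app b t = t"
    using FC_bounded ab(2) by metis
  obtain g where g: "g \<in> FC" "\<And>t. \<bar>t\<bar> \<le> max M M' \<Longrightarrow> u < app g t \<and> app g t < v"
    using FC_shrink[OF uv, of "max M M'"] by blast
  define a' b' where "a' = g + a - g" and "b' = g + b - g"
  have a': "u < s \<and> s < v" if "app a' s \<noteq> s" for s
  proof -
    have "app a (app (- g) s) \<noteq> app (- g) s"
      using that unfolding a'_def by auto
    then have "\<bar>app (- g) s\<bar> \<le> max M M'" using M by force
    then show ?thesis using g(2) by fastforce
  qed
  have b': "u < s \<and> s < v" if "app b' s \<noteq> s" for s
  proof -
    have "app b (app (- g) s) \<noteq> app (- g) s"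
      using that unfolding b'_def by auto
    then have "\<bar>app (- g) s\<bar> \<le> max M M'" using M' by force
    then show ?thesis using g(2) by fastforce
  qed
  have in_H: "a' \<in> H" "b' \<in> H" "g \<in> H"
  proof -
    have *: "a \<in> H" "b \<in> H" "g \<in> H" using ab g H by auto
    then show "a' \<in> H" "b' \<in> H" "g \<in> H"
      by (simp_all add: a'_def b'_def add_subgroupD(2,4)[OF H(1)])
  qed
  define c where "c = k - a' - k"
  have "c + b' = b' + c"
  proof (rule disjoint_supports_commute)
    fix s
    show "app c s = s \<or> app b' s = s"
    proof (rule ccontr)
      assume *: "\<not> ?thesis"
      then have "app (- a') (app (- k) s) \<noteq> app (- k) s"
        unfolding c_def by auto
      then have "app a' (app (- k) s) \<noteq> app (- k) s"
        by (metis app_uminus_app)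
      with * a' b' disj show False by blast
    qed
  qed
  then have cb: "c + b' - c = b'" by (simp add: diff_eq_eq)
  have "a' + k - a' \<in> K"
    using K in_H by (auto simp: add_normalizes_def)
  then have x: "a' + c \<in> K"
    using K add_subgroupD(4)[OF K(1)] by (simp add: c_def add_diff_eq)
  then have "b' + (a' + c) - b' \<in> K"
    using K in_H by (auto simp: add_normalizes_def)
  then have "(a' + c) - (b' + (a' + c) - b') \<in> K"
    using x add_subgroupD(4)[OF K(1)] by blast
  \<comment> \<open>Since \<open>c\<close> commutes with \<open>b'\<close>, it drops out of the
    bracket on the right.\<close>
  moreover have "(a' + c) - (b' + (a' + c) - b') = a' + (c + b' - c) - a' - b'"
    by (simp add: add_group_simps del: add_uminus_conv_diff)
  ultimately have "a' + b' - a' - b' \<in> K"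
    by (simp only: cb)
  then have "- g + (a' + b' - a' - b') + g \<in> K"
    using add_conjugate_uminus[OF H(1) K(2) in_H(3)] by blast
  moreover have "- g + (a' + b' - a' - b') + g = a + b - a - b"
    by (rule incr_eqI) (simp add: a'_def b'_def diff_conv_add_uminus minus_add del: add_uminus_conv_diff)
  ultimately show "a + b - a - b \<in> K" by simp
qed

subsection \<open>Centralizers\<close>

text \<open>The direction \<open>d\<close> of an end allows the two ends to be treated simultaneously.\<close>

lemma ends_direction:
  assumes "F \<in> ends"
  obtains d :: real where "d = 1 \<or> d = - 1" "\<And>P. eventually P F \<longleftrightarrow> (\<exists>s. \<forall>t. d * t \<ge> s \<longrightarrow> P t)"
proof (cases "F = at_top")
  case True
  then show ?thesis
    by (intro that[of 1]) (auto simp: eventually_at_top_linorder)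
next
  case False
  then have F: "F = at_bot" using assms by (simp add: ends_def)
  have "eventually P F \<longleftrightarrow> (\<exists>s. \<forall>t. - 1 * t \<ge> s \<longrightarrow> P t)" for P
  proof
    assume "eventually P F"
    then obtain s where "\<And>t. t \<le> s \<Longrightarrow> P t" unfolding F eventually_at_bot_linorder by blast
    then show "\<exists>s. \<forall>t. - 1 * t \<ge> s \<longrightarrow> P t" by (intro exI[of _ "- s"]) auto
  next
    assume "\<exists>s. \<forall>t. - 1 * t \<ge> s \<longrightarrow> P t"
    then obtain s where "\<And>t. - 1 * t \<ge> s \<Longrightarrow> P t" by blast
    then show "eventually P F"
      unfolding F eventually_at_bot_linorder by (intro exI[of _ "- s"]) auto
  qed
  then show ?thesis by (intro that[of "- 1"]) auto
qed

text \<open>\<open>b\<close> is the identity far out, and commuting with \<open>f\<close> spreads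
  this along the orbits of \<open>f\<close> over the whole region where \<open>f\<close> is a
  translation. That region \<open>P\<close> depends on \<open>f\<close> alone, not on
  \<open>b\<close>.\<close>

lemma commute_trivial_at_end:
  assumes F: "F \<in> ends" and f: "f \<in> FR" "chi F f \<noteq> 0"
  shows "\<exists>P. eventually P F \<and> (\<forall>b\<in>FC. b + f = f + b \<longrightarrow> (\<forall>t. P t \<longrightarrow> app b t = t))"
proof -
  obtain d :: real where d: "d = 1 \<or> d = - 1" "\<And>P. eventually P F \<longleftrightarrow> (\<exists>s. \<forall>t. d * t \<ge> s \<longrightarrow> P t)"
    using ends_direction[OF F] by blast
  \<comment> \<open>Only the case in which \<open>f\<close> moves points inwards is treated;
    otherwise \<open>- f\<close> does so and commutes with the same elements.\<close>
  have main: "\<exists>P. eventually P F \<and> (\<forall>b\<in>FC. b + f = f + b \<longrightarrow> (\<forall>t. P t \<longrightarrow> app b t = t))"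
    if f: "f \<in> FR" "d * chi F f < 0" for f
  proof -
    let ?k = "real_of_int (chi F f)"
    have "translates F f (chi F f)" using translates_chi[OF F f(1)] .
    then obtain s where s: "\<And>t. d * t \<ge> s \<Longrightarrow> app f t = t + ?k"
      unfolding translates_def d(2) by blast
    have "app b t = t" if b: "b \<in> FC" "b + f = f + b" and t: "d * t \<ge> s" for b t
    proof -
      have "translates F b 0"
        using b F translates_chi[of F b] by (auto simp: FC_def)
      then obtain s0 where s0: "\<And>t. d * t \<ge> s0 \<Longrightarrow> app b t = t"
        unfolding translates_def d(2) by auto
      \<comment> \<open>The point \<open>t - ?k\<close> lies further out than \<open>t\<close> and
        is mapped to \<open>t\<close> by \<open>f\<close>; after \<open>n\<close> such steps back
        the point is beyond \<open>s0\<close>.\<close>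
      have *: "app b t = t" if "d * t \<ge> s" "d * t \<ge> s0 + real n * (d * ?k)" for n t
        using that
      proof (induction n arbitrary: t)
        case 0
        then show ?case using s0 by simp
      next
        case (Suc n)
        have "d * (t - ?k) \<ge> s" "d * (t - ?k) \<ge> s0 + real n * (d * ?k)"
          using Suc.prems f by (auto simp: algebra_simps)
        then have "app b (t - ?k) = t - ?k" "app f (t - ?k) = t"
          using Suc.IH s[of "t - ?k"] by auto
        then show ?case
          using b(2) by (metis incr_commute_iff)
      qed
      obtain n :: nat where n: "real n \<ge> (s0 - d * t) / (- (d * ?k))"
        using real_arch_simple by blast
      have "d * t \<ge> s0 + real n * (d * ?k)"
        using n f pos_divide_le_eq[of "- (d * ?k)" "s0 - d * t" "real n"] by simp
      then show ?thesis using * t by blast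
    qed
    then show ?thesis
      using d(2) by (intro exI[of _ "\<lambda>t. d * t \<ge> s"]) auto
  qed
  show ?thesis
  proof (cases "d * chi F f < 0")
    case True
    then show ?thesis using main f by blast
  next
    case False
    then have "d * chi F (- f) < 0" "- f \<in> FR"
      using d(1) f chi_uminus[OF F f(1)] FR_D(3) by auto
    then obtain P where P: "eventually P F" "\<And>b t. b \<in> FC \<Longrightarrow> b + - f = - f + b \<Longrightarrow> P t \<Longrightarrow> app b t = t"
      using main by blast
    have "b + - f = - f + b" if "b + f = f + b" for b
      using that by (metis add.assoc add.right_neutral add_0 left_minus right_minus)
    then show ?thesis using P by blast
  qed
qed

text \<open>Provides an element of \<open>FC\<close> without fixed points in a prescribed bounded
  interval. On \<open>(p, q + 1)\<close> the graph of \<open>lam p\<close> lies above that of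
  \<open>lam q\<close>, and \<open>lam q\<close> maps \<open>q + 1\<close> to
  \<open>q + 2\<close>.\<close>

lemma lam_diff_moves_up:
  assumes "p < q" "of_int p < t" "t < of_int q + 2"
  shows "app (lam p - lam q) t > t"
proof -
  define u where "u = app (- lam q) t"
  have t: "t = app (lam q) u" by (simp add: u_def)
  have "app (lam q) (of_int p) < app (lam q) u" "app (lam q) u < app (lam q) (of_int q + 1)"
    using assms unfolding t[symmetric] by (auto simp: app_lam)
  then have "of_int p < u" "u < of_int q + 1" by simp_all
  moreover have "real_of_int p + 1 \<le> of_int q" using assms by linarith
  ultimately have "app (lam p) u > app (lam q) u" by (auto simp: app_lam)
  then show ?thesis by (simp add: t)
qed

text \<open>By \<open>commute_trivial_at_end\<close> every such \<open>b\<close> is trivial outside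
  an interval fixed by \<open>f\<close> alone, and \<open>g\<close> moves all points of a larger
  interval upwards. If \<open>b\<close> were nontrivial, \<open>g\<close> would have to preserve the
  initial segment on which \<open>b\<close> is the identity, yet it pushes its supremum up.\<close>

lemma no_common_centralizer:
  assumes f: "f \<in> FR" "\<And>F. F \<in> ends \<Longrightarrow> chi F f \<noteq> 0"
  obtains g where "g \<in> FC" "\<And>b. b \<in> FC \<Longrightarrow> b + f = f + b \<Longrightarrow> b + g = g + b \<Longrightarrow> b = 0"
proof -
  obtain P where P: "eventually P at_bot" "\<And>b t. b \<in> FC \<Longrightarrow> b + f = f + b \<Longrightarrow> P t \<Longrightarrow> app b t = t"
    using commute_trivial_at_end[of at_bot f] f by auto
  obtain Q where Q: "eventually Q at_top" "\<And>b t. b \<in> FC \<Longrightarrow> b + f = f + b \<Longrightarrow> Q t \<Longrightarrow> app b t = t"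
    using commute_trivial_at_end[of at_top f] f by auto
  obtain s where s: "\<And>t. t \<le> s \<Longrightarrow> P t" using P unfolding eventually_at_bot_linorder by blast
  obtain r where r: "\<And>t. t \<ge> r \<Longrightarrow> Q t" using Q unfolding eventually_at_top_linorder by blast
  define p where "p = min (\<lfloor>s\<rfloor> - 1) 0"
  define q where "q = max \<lceil>r\<rceil> 1"
  have pq: "p < q" "of_int p < s" "r < of_int q + 2"
    unfolding p_def q_def by (auto simp: min_def max_def) linarith+
  define g where "g = lam p - lam q"
  have "g \<in> FC"
    unfolding g_def using lam_FR FR_D(4) by (auto simp: FC_def ends_def chi_diff)
  moreover have "b = 0" if b: "b \<in> FC" "b + f = f + b" "b + g = g + b" for b
  proof (rule ccontr)
    assume "b \<noteq> 0"
    then obtain t0 where t0: "app b t0 \<noteq> t0" by (metis app_zero incr_eqI)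
    define S where "S = {x. \<forall>t\<le>x. app b t = t}"
    have "s \<in> S" using s P(2)[OF b(1,2)] by (auto simp: S_def)
    have up: "x \<le> t0" if "x \<in> S" for x using that t0 by (intro leI notI) (auto simp: S_def)
    then have bdd: "bdd_above S" by (auto simp: bdd_above_def)
    have "t0 < r" using t0 r[of t0] Q(2)[OF b(1,2), of t0] by (meson not_le)
    have "s \<le> Sup S" using \<open>s \<in> S\<close> bdd by (rule cSup_upper)
    moreover have "Sup S \<le> t0" using up \<open>s \<in> S\<close> by (intro cSup_least) auto
    ultimately have "app g (Sup S) > Sup S"
      unfolding g_def using pq \<open>t0 < r\<close> by (intro lam_diff_moves_up) auto
    then have "app (- g) (Sup S) < Sup S" by (simp add: app_uminus_less_iff)
    then obtain x where x: "x \<in> S" "app (- g) (Sup S) < x"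
      using \<open>s \<in> S\<close> less_cSupE by blast
    have "app b t = t" if "t \<le> app g x" for t
    proof -
      have "app (- g) t \<le> x" using that by (simp add: app_uminus_le_iff)
      then have "app b (app (- g) t) = app (- g) t" using x by (simp add: S_def)
      then show ?thesis using b(3) by (metis app_app_uminus incr_commute_iff)
    qed
    then have "app g x \<in> S" by (simp add: S_def)
    then have "app g x \<le> Sup S" using bdd by (rule cSup_upper)
    with x(2) show False by (simp add: app_uminus_less_iff)
  qed
  ultimately show ?thesis using that by blast
qed

section \<open>Extreme fixed points\<close>

definition extreme_fixed_point :: "real \<Rightarrow> incr \<Rightarrow> real \<Rightarrow> bool" where
  "extreme_fixed_point d f m \<longleftrightarrow> app f m = m \<and> (\<forall>x. app f x = x \<longrightarrow> d * x \<le> d * m)"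

text \<open>\<open>f\<close> and its inverse permute the fixed points of \<open>g\<close>, so
  neither moves the extreme one outwards.\<close>

lemma extreme_fixed_point_commute_aux:
  assumes d: "d = 1 \<or> d = - 1" and "extreme_fixed_point d g n" "f + g = g + f"
  shows "app f n = n"
proof -
  have "app g (app f n) = app f n"
    using assms(2,3) unfolding extreme_fixed_point_def by (metis incr_commute_iff)
  moreover have "app g (app (- f) n) = app (- f) n"
    using assms(2,3) unfolding extreme_fixed_point_def by (metis app_app_uminus app_uminus_app incr_commute_iff)
  ultimately have "d * app f n \<le> d * n" "d * app (- f) n \<le> d * n"
    using assms(2) unfolding extreme_fixed_point_def by auto
  then show ?thesis
    using d by (auto simp: app_uminus_le_iff le_app_uminus_iff)
qed

lemma extreme_fixed_point_commute:
  assumes "d = 1 \<or> d = - 1" "extreme_fixed_point d f m" "extreme_fixed_point d g n" "f + g = g + f"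
  shows "m = n"
proof -
  have "app f n = n" "app g m = m"
    using extreme_fixed_point_commute_aux assms by metis+
  then have "d * n \<le> d * m" "d * m \<le> d * n"
    using assms unfolding extreme_fixed_point_def by auto
  then show ?thesis using assms(1) by auto
qed

lemma extreme_fixed_point_conj:
  assumes "d = 1 \<or> d = - 1" "extreme_fixed_point d f m"
  shows "extreme_fixed_point d (g + f - g) (app g m)"
proof -
  have "d * x \<le> d * app g m" if "app (g + f - g) x = x" for x
  proof -
    have "app f (app (- g) x) = app (- g) x" using that by (simp add: eq_app_uminus_iff)
    then have "d * app (- g) x \<le> d * m" using assms unfolding extreme_fixed_point_def by blast
    then show ?thesis using assms(1) by (auto simp: app_uminus_le_iff le_app_uminus_iff)
  qed
  then show ?thesis using assms unfolding extreme_fixed_point_def by auto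
qed

text \<open>The nonzero length bounds the fixed points towards \<open>F\<close>, the zero length
  provides some, so there is an extreme one \<open>m\<close>. A conjugate by \<open>g\<close> has
  extreme fixed point \<open>app g m\<close>; commuting with \<open>f\<close> forces this to be
  \<open>m\<close>, commuting with the conjugate by \<open>h\<close> forces it to be
  \<open>app h m\<close>.\<close>

lemma no_commuting_conjugate:
  assumes F: "F \<in> ends" "F' \<in> ends" and f: "f \<in> FR" "chi F f \<noteq> 0" "chi F' f = 0"
  obtains h where "h \<in> FC"
    "\<And>g. (g + f - g) + f = f + (g + f - g) \<Longrightarrow>
      (g + f - g) + (h + f - h) \<noteq> (h + f - h) + (g + f - g)"
proof -
  obtain d :: real where d: "d = 1 \<or> d = - 1" "\<And>P. eventually P F \<longleftrightarrow> (\<exists>s. \<forall>t. d * t \<ge> s \<longrightarrow> P t)"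
    using ends_direction[OF F(1)] by blast
  have "translates F f (chi F f)" using translates_chi[OF F(1) f(1)] .
  then obtain s where s: "\<And>t. d * t \<ge> s \<Longrightarrow> app f t = t + chi F f"
    unfolding translates_def d(2) by blast
  have bd: "d * x \<le> s" if "app f x = x" for x
    using s[of x] that f by force
  define S where "S = {x. app f x = x}"
  have S: "closed S"
    unfolding S_def by (intro closed_Collect_eq continuous_on_app continuous_on_id)
  have "translates F' f 0" using translates_chi[OF F(2) f(1)] f by simp
  then have "S \<noteq> {}"
    unfolding translates_def S_def using ends_ne_bot[OF F(2)] eventually_happens by force
  have "\<exists>m. extreme_fixed_point d f m"
    using d(1)
  proof
    assume d1: "d = 1"
    then have "bdd_above S" using bd by (auto simp: S_def bdd_above_def)
    then have "Sup S \<in> S" "\<forall>x\<in>S. x \<le> Sup S"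
      using S \<open>S \<noteq> {}\<close> by (auto intro: closed_contains_Sup cSup_upper)
    then show ?thesis unfolding extreme_fixed_point_def d1 S_def by auto
  next
    assume d1: "d = - 1"
    then have "- s \<le> x" if "x \<in> S" for x using that bd[of x] by (auto simp: S_def)
    then have "bdd_below S" by (auto simp: bdd_below_def)
    then have "Inf S \<in> S" "\<forall>x\<in>S. x \<ge> Inf S"
      using S \<open>S \<noteq> {}\<close> by (auto intro: closed_contains_Inf cInf_lower)
    then show ?thesis unfolding extreme_fixed_point_def d1 S_def by auto
  qed
  then obtain m where m: "extreme_fixed_point d f m" by blast
  \<comment> \<open>The translation by one, cut off so that it still moves \<open>m\<close>.\<close>
  obtain h where h: "h \<in> FC" "\<And>t. \<bar>t\<bar> \<le> \<bar>m\<bar> \<Longrightarrow> app h t = app (aff 0 1) t"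
    using FC_agree[OF aff_PL[OF dyadic_1, of 0], of "\<bar>m\<bar>"] by blast
  then have "app h m \<noteq> m" by simp
  show ?thesis
  proof (rule that[OF h(1)], rule notI)
    fix g
    assume "(g + f - g) + f = f + (g + f - g)" "(g + f - g) + (h + f - h) = (h + f - h) + (g + f - g)"
    then have "app g m = m" "app g m = app h m"
      using extreme_fixed_point_commute[OF d(1)] extreme_fixed_point_conj[OF d(1) m] m by blast+
    with \<open>app h m \<noteq> m\<close> show False by simp
  qed
qed

section \<open>Geometrically proper copies of finite index subgroups\<close>

lemma int_subgroup_multiples:
  assumes S: "add_subgroup (S :: int set)" and "S \<noteq> {0}"
  obtains a where "a > 0" "S = {k. a dvd k}"
proof -
  have "x \<in> S" if "x \<in> group_closure S" for x
    using that by induction (use add_subgroupD[OF S] in auto)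
  then have "S = group_closure S"
    using group_closure.base by blast
  then have "S = {k. Gcd S dvd k}"
    using group_closure_eq[of S] by (auto simp: dvd_def)
  moreover have "Gcd S \<noteq> 0"
    using assms(2) add_subgroupD(1)[OF S] by (auto simp: Gcd_0_iff)
  then have "Gcd S > 0"
    using Gcd_int_greater_eq_0[of S] by linarith
  ultimately show ?thesis
    using that by blast
qed

text \<open>The situation after transfer: \<open>H\<close> acts on the line, \<open>Y\<close> still
  on the interval. Finite index is recorded by \<open>FC \<subseteq> H\<close> and
  \<open>fin\<close>.\<close>

locale proper_copy =
  fixes H Y :: "incr set" and phi :: "incr \<Rightarrow> incr"
  assumes H: "add_subgroup H" "H \<subseteq> FR" "FC \<subseteq> H"
    and fin: "\<And>u. u \<in> FR \<Longrightarrow> \<exists>m>0. nmult m u \<in> H"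
    and Y_homeo: "Y \<subseteq> homeo_incr"
    and Y_proper: "geometrically_proper (app ` Y)"
    and phi_bij: "bij_betw phi H (span_group Y)"
    and phi_additive: "additive_on H phi"
begin

abbreviation G :: "incr set" where
  "G \<equiv> span_group Y"

lemmas G_sub = add_subgroup_span_group[of Y]
lemmas G_D = add_subgroupD[OF G_sub]
lemmas H_D = add_subgroupD[OF H(1)]

lemma phi_in_G: "f \<in> H \<Longrightarrow> phi f \<in> G"
  using phi_bij by (auto simp: bij_betw_def)

lemma phi_surj: "g \<in> G \<Longrightarrow> \<exists>f\<in>H. phi f = g"
  using phi_bij by (force simp: bij_betw_def)

lemma phi_inj: "f \<in> H \<Longrightarrow> g \<in> H \<Longrightarrow> phi f = phi g \<Longrightarrow> f = g"
  using phi_bij by (auto simp: bij_betw_def inj_on_def)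

lemmas phi_zero = additive_on_zero[OF H(1) phi_additive]
lemmas phi_uminus = additive_on_uminus[OF H(1) phi_additive]
lemmas phi_diff = additive_on_diff[OF H(1) phi_additive]

lemma phi_add: "f \<in> H \<Longrightarrow> g \<in> H \<Longrightarrow> phi (f + g) = phi f + phi g"
  using phi_additive by (simp add: additive_on_def)

lemma phi_zmult: "f \<in> H \<Longrightarrow> phi (zmult n f) = zmult n (phi f)"
  using additive_on_nmult[OF H(1) phi_additive] by (auto simp: zmult_def phi_uminus)

lemma phi_commute_iff: "f \<in> H \<Longrightarrow> g \<in> H \<Longrightarrow> phi f + phi g = phi g + phi f \<longleftrightarrow> f + g = g + f"
  using phi_inj[of "f + g" "g + f"] H_D(2) by (metis phi_add)

lemma H_chi:
  assumes "E \<in> ends"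
  obtains u where "u \<in> H" "chi E u \<noteq> 0" "\<And>E'. E' \<in> ends \<Longrightarrow> E' \<noteq> E \<Longrightarrow> chi E' u = 0"
proof -
  have t1: "translates F (aff 0 1) 1" for F by (simp add: translates_def)
  then have a: "aff 0 1 \<in> FR" "\<And>F. F \<in> ends \<Longrightarrow> chi F (aff 0 1) = 1"
    unfolding FR_def using aff_PL[OF dyadic_1, of 0] by (auto intro: chi_eqI)
  \<comment> \<open>Translation by one has length \<open>1\<close> at both ends,
    \<open>lam 0\<close> only at the right end; the difference isolates the left end.\<close>
  define v where "v = (if E = at_top then lam 0 else aff 0 1 - lam 0)"
  have v: "v \<in> FR"
    unfolding v_def using lam_FR a FR_D(4) by auto
  have v1: "chi E v = 1" "\<And>E'. E' \<in> ends \<Longrightarrow> E' \<noteq> E \<Longrightarrow> chi E' v = 0"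
    using assms a lam_FR by (auto simp: v_def ends_def chi_diff)
  obtain m where m: "m > 0" "nmult m v \<in> H" using fin[OF v] by blast
  have "chi F (nmult m v) = int m * chi F v" if "F \<in> ends" for F
    using chi_zmult[OF that v, of "int m"] by (simp add: zmult_def)
  then show ?thesis using that[OF m(2)] v1 m(1) assms by auto
qed

lemma G_homeo: "G \<subseteq> homeo_incr"
  using span_group_minimal[OF homeo_incr_sub Y_homeo] .

text \<open>\<open>FC\<close> is perfect and nontrivial.\<close>

lemma nontrivial_commutator:
  obtains x y where "x \<in> FC" "y \<in> FC" "x + y - x - y \<noteq> 0"
proof (rule ccontr)
  assume "\<not> thesis"
  then have "FC \<subseteq> {0}"
    using that by (intro FC_subset_if_FC_commutators) (auto simp: add_subgroup_def)
  moreover have "lam 0 - lam 1 \<in> FC"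
    using lam_FR FR_D(4) by (auto simp: FC_def ends_def chi_diff)
  moreover have "app (lam 0 - lam 1) 1 > 1"
    by (rule lam_diff_moves_up) auto
  ultimately show False by fastforce
qed

end

text \<open>\<open>p\<close> and \<open>q\<close> are adjacent common fixed points of
  \<open>G\<close>. The component is chosen to meet the support of the image of a nontrivial element
  of \<open>FC\<close>, which makes the action on it faithful.\<close>

locale proper_copy_component = proper_copy +
  fixes p q :: real and x0 y0 :: incr
  assumes pq: "p < q" "0 \<le> p" "q \<le> 1"
    and fix_pq: "\<And>g. g \<in> G \<Longrightarrow> app g p = p" "\<And>g. g \<in> G \<Longrightarrow> app g q = q"
    and moved: "\<And>s. p < s \<Longrightarrow> s < q \<Longrightarrow> \<exists>g\<in>G. app g s \<noteq> s"
    and x0y0: "x0 \<in> FC" "y0 \<in> FC"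
    and c0_moves: "\<exists>t. p < t \<and> t < q \<and> app (phi (x0 + y0 - x0 - y0)) t \<noteq> t"

lemma (in proper_copy) component_exists:
  "\<exists>p q x0 y0. proper_copy_component H Y phi p q x0 y0"
proof -
  obtain x y where xy: "x \<in> FC" "y \<in> FC" "x + y - x - y \<noteq> 0"
    using nontrivial_commutator .
  let ?c = "x + y - x - y"
  have "?c \<in> H" using xy H H_D by (meson subsetD)
  then have "phi ?c \<in> G"
    by (rule phi_in_G)
  have "phi ?c \<noteq> 0"
    using xy(3) phi_inj[OF \<open>?c \<in> H\<close> H_D(1)] phi_zero by metis
  then obtain t where t: "app (phi ?c) t \<noteq> t"
    by (metis app_zero incr_eqI)
  define Fix where "Fix = {s. \<forall>g\<in>G. app g s = s}"
  have "closed Fix"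
  proof -
    have "Fix = (\<Inter>g\<in>G. {s. app g s = s})" by (auto simp: Fix_def)
    moreover have "closed {s. app g s = s}" for g
      by (intro closed_Collect_eq continuous_on_app continuous_on_id)
    ultimately show ?thesis by auto
  qed
  have F01: "0 \<in> Fix" "1 \<in> Fix" using homeo_incr_endpoints G_homeo by (auto simp: Fix_def)
  have tF: "t \<notin> Fix" using t \<open>phi ?c \<in> G\<close> by (auto simp: Fix_def)
  have "t \<in> {0..1}" using t \<open>phi ?c \<in> G\<close> G_homeo unfolding homeo_incr_def by blast
  then have t01: "0 < t" "t < 1" using tF F01 by (auto simp: order_le_less)
  \<comment> \<open>The common fixed points nearest to \<open>t\<close> on either side; they exist
    because \<open>Fix\<close> is closed.\<close>
  define p q where "p = Sup (Fix \<inter> {0..t})" and "q = Inf (Fix \<inter> {t..1})"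
  have p: "p \<in> Fix \<inter> {0..t}" "\<And>s. s \<in> Fix \<Longrightarrow> s \<le> t \<Longrightarrow> s \<le> p"
  proof -
    show "p \<in> Fix \<inter> {0..t}"
      unfolding p_def using F01 t01 \<open>closed Fix\<close>
      by (intro closed_contains_Sup) (auto intro!: closed_Int)
    fix s assume s: "s \<in> Fix" "s \<le> t"
    show "s \<le> p"
    proof (cases "0 \<le> s")
      case True
      then show ?thesis unfolding p_def using s by (intro cSup_upper) auto
    next
      case False
      then show ?thesis using \<open>p \<in> Fix \<inter> {0..t}\<close> by auto
    qed
  qed
  have q: "q \<in> Fix \<inter> {t..1}" "\<And>s. s \<in> Fix \<Longrightarrow> t \<le> s \<Longrightarrow> q \<le> s"
  proof -
    show "q \<in> Fix \<inter> {t..1}"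
      unfolding q_def using F01 t01 \<open>closed Fix\<close>
      by (intro closed_contains_Inf) (auto intro!: closed_Int)
    fix s assume s: "s \<in> Fix" "t \<le> s"
    show "q \<le> s"
    proof (cases "s \<le> 1")
      case True
      then show ?thesis unfolding q_def using s by (intro cInf_lower) auto
    next
      case False
      then show ?thesis using \<open>q \<in> Fix \<inter> {t..1}\<close> by auto
    qed
  qed
  have ptq: "p < t" "t < q" using p q tF by (auto simp: order_le_less)
  have "proper_copy_component H Y phi p q x y"
  proof unfold_locales
    fix s assume "p < s" "s < q"
    then have "s \<notin> Fix" using p(2)[of s] q(2)[of s] by force
    then show "\<exists>g\<in>G. app g s \<noteq> s" by (auto simp: Fix_def)
  qed (use p q ptq xy t in \<open>auto simp: Fix_def\<close>)
  then show ?thesis by blast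
qed

section \<open>Germs at the two ends of the component\<close>

context proper_copy_component
begin

text \<open>The kernel of the germ map at \<open>F\<close>; the germs themselves are represented by
  its cosets in \<open>G\<close>.\<close>

definition germ :: "real filter \<Rightarrow> incr set" where
  "germ F = {g \<in> G. \<forall>\<^sub>F s in F. app g s = s}"

definition sides :: "real filter set" where
  "sides = {at_right p, at_left q}"

lemma sides_simps [simp]: "at_right p \<in> sides" "at_left q \<in> sides"
  by (auto simp: sides_def)

lemma interval_iff:
  assumes "g \<in> G"
  shows "p < app g s \<longleftrightarrow> p < s" "app g s < q \<longleftrightarrow> s < q"
  using app_less_iff[of g p s] app_less_iff[of g s q] fix_pq[OF assms] by auto

lemma eventually_sides:
  assumes "F \<in> sides" "eventually P F" "g \<in> G"
  shows "eventually (\<lambda>s. P (app g s)) F"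
proof (cases "F = at_right p")
  case True
  then obtain b where b: "b > p" "\<And>y. p < y \<Longrightarrow> y < b \<Longrightarrow> P y"
    using assms unfolding True eventually_at_right_field by blast
  show ?thesis
    unfolding True eventually_at_right_field
  proof (intro exI[of _ "app (- g) b"] conjI allI impI)
    show "p < app (- g) b" using b fix_pq[OF assms(3)] by (simp add: less_app_uminus_iff)
    fix y assume "p < y" "y < app (- g) b"
    then show "P (app g y)"
      using interval_iff[OF assms(3)] by (intro b) (auto simp: less_app_uminus_iff)
  qed
next
  case False
  then have F: "F = at_left q" using assms by (simp add: sides_def)
  obtain b where b: "b < q" "\<And>y. b < y \<Longrightarrow> y < q \<Longrightarrow> P y"
    using assms unfolding F eventually_at_left_field by blast
  show ?thesis
    unfolding F eventually_at_left_field
  proof (intro exI[of _ "app (- g) b"] conjI allI impI)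
    show "app (- g) b < q" using b fix_pq[OF assms(3)] by (simp add: app_uminus_less_iff)
    fix y assume "app (- g) b < y" "y < q"
    then show "P (app g y)"
      using interval_iff[OF assms(3)] by (intro b) (auto simp: app_uminus_less_iff)
  qed
qed

lemma germ_sub:
  assumes "F \<in> sides"
  shows "add_subgroup (germ F)"
  unfolding add_subgroup_def
proof (intro conjI ballI)
  show "0 \<in> germ F" using G_D(1) by (simp add: germ_def)
  fix f assume f: "f \<in> germ F"
  then have "\<forall>\<^sub>F s in F. app f s = s" "f \<in> G" by (auto simp: germ_def)
  then show "- f \<in> germ F"
    using G_D(3) by (auto simp: germ_def app_uminus_eq_iff elim: eventually_mono)
  fix g assume g: "g \<in> germ F"
  then have "\<forall>\<^sub>F s in F. app g s = s" "g \<in> G" by (auto simp: germ_def)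
  from \<open>\<forall>\<^sub>F s in F. app f s = s\<close> \<open>\<forall>\<^sub>F s in F. app g s = s\<close> have "\<forall>\<^sub>F s in F. app (f + g) s = s"
    by eventually_elim simp
  then show "f + g \<in> germ F" using G_D(2) \<open>f \<in> G\<close> \<open>g \<in> G\<close> by (simp add: germ_def)
qed

lemma germ_normal:
  assumes "F \<in> sides"
  shows "add_normalizes G (germ F)"
  unfolding add_normalizes_def
proof (intro ballI)
  fix g x assume g: "g \<in> G" and x: "x \<in> germ F"
  then have "\<forall>\<^sub>F s in F. app x (app (- g) s) = app (- g) s"
    using eventually_sides[OF assms _ G_D(3)[OF g]] by (auto simp: germ_def)
  then have "\<forall>\<^sub>F s in F. app (g + x - g) s = s"
    by eventually_elim simp
  then show "g + x - g \<in> germ F"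
    using g x G_D by (simp add: germ_def)
qed

lemma germ_subset: "germ F \<subseteq> G"
  by (auto simp: germ_def)

text \<open>This is the only place where geometric properness is used.\<close>

lemma germ_generator_unique:
  assumes "F \<in> sides" "u \<in> Y" "v \<in> Y" "u \<notin> germ F" "v \<notin> germ F"
  shows "u = v"
proof -
  have left: "left_transition (app y) p" if y: "y \<in> Y" "y \<notin> germ (at_right p)" for y
  proof -
    have yG: "y \<in> G" using y by (auto intro: span_group.base)
    have "{p<..<p + e} \<inter> supp (app y) \<noteq> {}" if "e > 0" for e
    proof
      assume *: "{p<..<p + e} \<inter> supp (app y) = {}"
      have "\<forall>\<^sub>F s in at_right p. app y s = s"
        unfolding eventually_at_right_field
      proof (intro exI[of _ "min (p + e) q"] conjI allI impI)
        fix s assume "p < s" "s < min (p + e) q"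
        then show "app y s = s" using * pq by (auto simp: supp_def)
      qed (use that pq in auto)
      then show False using y yG by (simp add: germ_def)
    qed
    then show ?thesis
      using pq fix_pq[OF yG] by (auto simp: left_transition_def supp_def)
  qed
  have right: "right_transition (app y) q" if y: "y \<in> Y" "y \<notin> germ (at_left q)" for y
  proof -
    have yG: "y \<in> G" using y by (auto intro: span_group.base)
    have "{q - e<..<q} \<inter> supp (app y) \<noteq> {}" if "e > 0" for e
    proof
      assume *: "{q - e<..<q} \<inter> supp (app y) = {}"
      have "\<forall>\<^sub>F s in at_left q. app y s = s"
        unfolding eventually_at_left_field
      proof (intro exI[of _ "max (q - e) p"] conjI allI impI)
        fix s assume "max (q - e) p < s" "s < q"
        then show "app y s = s" using * pq by (auto simp: supp_def)
      qed (use that pq in auto)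
      then show False using y yG by (simp add: germ_def)
    qed
    then show ?thesis
      using pq fix_pq[OF yG] by (auto simp: right_transition_def supp_def)
  qed
  have "app u = app v"
    using Y_proper left right assms unfolding geometrically_proper_def sides_def by blast
  then show ?thesis by (simp add: app_inject)
qed

text \<open>All generators but at most one have trivial germ, so the group of germs is generated by
  the germ of the remaining one, called \<open>z\<close>; if there is none, \<open>z\<close> is
  \<open>0\<close>.\<close>

lemma germ_cyclic:
  assumes "F \<in> sides"
  obtains z where "z \<in> G" "\<And>w. w \<in> G \<Longrightarrow> \<exists>n. \<exists>x\<in>germ F. w = zmult n z + x"
proof -
  define z where "z = (if Y \<subseteq> germ F then 0 else SOME y. y \<in> Y - germ F)"
  have z: "z \<in> Y - germ F" if "\<not> Y \<subseteq> germ F"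
    using that someI_ex[of "\<lambda>y. y \<in> Y - germ F"] unfolding z_def by auto
  have zG: "z \<in> G"
  proof (cases "Y \<subseteq> germ F")
    case True
    then show ?thesis by (simp add: z_def G_D(1))
  next
    case False
    then show ?thesis using z by (auto intro: span_group.base)
  qed
  have "\<exists>n. \<exists>x\<in>germ F. y = zmult n z + x" if "y \<in> Y" for y
  proof (cases "y \<in> germ F")
    case True
    then show ?thesis by (intro exI[of _ 0] bexI[of _ y]) auto
  next
    case False
    then have "y = z" using germ_generator_unique[OF assms that] z that by blast
    then show ?thesis
      using add_subgroupD(1)[OF germ_sub[OF assms]] by (intro exI[of _ 1] bexI[of _ 0]) auto
  qed
  then have "\<exists>n. \<exists>x\<in>germ F. w = zmult n z + x" if "w \<in> G" for w
    using span_group_cyclic_mod[OF G_sub germ_sub[OF assms] germ_normal[OF assms] zG _ that] by blast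
  then show ?thesis using that zG by blast
qed

lemma commutator_germ:
  assumes "F \<in> sides" "f \<in> G" "g \<in> G"
  shows "f + g - f - g \<in> germ F"
proof -
  obtain z where z: "z \<in> G" "\<And>w. w \<in> G \<Longrightarrow> \<exists>n. \<exists>x\<in>germ F. w = zmult n z + x"
    using germ_cyclic[OF assms(1)] by blast
  show ?thesis
    by (rule commutator_cyclic_mod[OF G_sub germ_sub[OF assms(1)] germ_normal[OF assms(1)] z(1) germ_subset
          z(2)[OF assms(2)] z(2)[OF assms(3)]])
qed

text \<open>The elements of \<open>H\<close> acting trivially on \<open>(p, q)\<close> form a normal
  subgroup. If it were nontrivial it would contain \<open>FC\<close> by
  \<open>normal_FC_subset\<close>, hence also the chosen commutator, which moves a point of
  \<open>(p, q)\<close>.\<close>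

lemma faithful:
  assumes g: "g \<in> G" and triv: "\<And>s. p < s \<Longrightarrow> s < q \<Longrightarrow> app g s = s"
  shows "g = 0"
proof (rule ccontr)
  assume "g \<noteq> 0"
  define K where "K = {f \<in> H. \<forall>s. p < s \<longrightarrow> s < q \<longrightarrow> app (phi f) s = s}"
  have "add_subgroup K"
    unfolding add_subgroup_def K_def
    using H_D by (auto simp: phi_zero phi_add phi_uminus app_uminus_eq_iff)
  moreover have "add_normalizes H K"
    unfolding add_normalizes_def
  proof (intro ballI)
    fix h k assume h: "h \<in> H" and k: "k \<in> K"
    have "app (phi (h + k - h)) s = s" if "p < s" "s < q" for s
    proof -
      have "p < app (- phi h) s" "app (- phi h) s < q"
        using interval_iff[OF G_D(3)[OF phi_in_G[OF h]]] that by auto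
      then show ?thesis
        using h k H_D(2)[of h k] by (auto simp: K_def phi_add phi_diff)
    qed
    then show "h + k - h \<in> K" using h k H_D by (auto simp: K_def)
  qed
  moreover obtain k where k: "k \<in> H" "phi k = g" using phi_surj[OF g] by blast
  ultimately have "FC \<subseteq> K"
    using triv \<open>g \<noteq> 0\<close> phi_zero H by (intro normal_FC_subset[of K H k]) (auto simp: K_def)
  moreover have "x0 + y0 - x0 - y0 \<in> FC"
    using x0y0 commutator_FC FC_subset_FR by blast
  ultimately show False
    using c0_moves by (auto simp: K_def)
qed

text \<open>Outside \<open>(p, q)\<close> nothing has to be checked, by faithfulness.\<close>

lemma commute_if_commute_inside:
  assumes "f \<in> G" "g \<in> G" "\<And>s. p < s \<Longrightarrow> s < q \<Longrightarrow> app f s = s \<or> app g s = s"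
  shows "f + g = g + f"
proof -
  have *: "app (f + g) s = app (g + f) s" if "p < s" "s < q" for s
    using assms(3)[of s] assms(3)[of "app f s"] assms(3)[of "app g s"] that
      interval_iff[OF assms(1)] interval_iff[OF assms(2)] by auto
  have G: "f + g \<in> G" "g + f \<in> G" using assms G_D by auto
  have "(f + g) - (g + f) = 0"
  proof (rule faithful)
    show "(f + g) - (g + f) \<in> G" using G G_D by blast
    fix s assume "p < s" "s < q"
    then have "p < app (- (g + f)) s" "app (- (g + f)) s < q"
      using interval_iff[OF G_D(3)[OF G(2)]] by auto
    then have "app (f + g) (app (- (g + f)) s) = app (g + f) (app (- (g + f)) s)"
      by (rule *)
    then show "app ((f + g) - (g + f)) s = s"
      unfolding app_minus app_app_uminus .
  qed
  then show ?thesis by simp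
qed

text \<open>The infimum of an orbit in direction \<open>d\<close> cannot lie inside
  \<open>(p, q)\<close>, since some element of \<open>G\<close> would carry orbit points near it
  beyond it; so it is the end point \<open>e\<close>.\<close>

lemma orbit_accumulates:
  assumes d: "d = 1 \<or> d = - 1" and e: "e = (if d = 1 then p else q)" and s: "p < s" "s < q" and r: "d * e < d * r"
  shows "\<exists>g\<in>G. d * app g s < d * r"
proof -
  define U where "U = (\<lambda>g. d * app g s) ` G"
  have "d * s \<in> U" unfolding U_def using G_D(1) by (auto intro: image_eqI[of _ _ 0])
  have low: "d * e < x" if "x \<in> U" for x
    using that d e s interval_iff by (auto simp: U_def)
  then have bdd: "bdd_below U" by (auto simp: bdd_below_def intro: less_imp_le)
  define i where "i = d * Inf U"
  have di: "Inf U = d * i" using d by (auto simp: i_def)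
  have "d * e \<le> d * i"
    unfolding di[symmetric] using low \<open>d * s \<in> U\<close> by (intro cInf_greatest) (auto intro: less_imp_le)
  moreover have "d * i \<le> d * s"
    unfolding di[symmetric] by (rule cInf_lower[OF \<open>d * s \<in> U\<close> bdd])
  moreover have "\<not> (p < i \<and> i < q)"
  proof
    assume "p < i \<and> i < q"
    then obtain h where h: "h \<in> G" "app h i \<noteq> i" using moved by blast
    \<comment> \<open>Whichever of \<open>h\<close> and \<open>- h\<close> moves \<open>i\<close>
      towards \<open>e\<close> serves as \<open>g\<close>.\<close>
    have "\<exists>g\<in>G. d * i < d * app (- g) i"
    proof (cases "d * app h i < d * i")
      case True
      then show ?thesis using h(1) d by (auto simp: less_app_uminus_iff app_uminus_less_iff)
    next
      case False
      then have "d * i < d * app h i" using h d by auto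
      then show ?thesis using G_D(3)[OF h(1)] by (intro bexI[of _ "- h"]) simp_all
    qed
    then obtain g where g: "g \<in> G" "d * i < d * app (- g) i" by blast
    then obtain k where k: "k \<in> G" "d * app k s < d * app (- g) i"
      using cInf_less_iff[OF _ bdd] \<open>d * s \<in> U\<close> unfolding di[symmetric] U_def by blast
    have "d * app (g + k) s \<in> U" unfolding U_def using g k G_D(2) by blast
    then have "d * i \<le> d * app (g + k) s" unfolding di[symmetric] by (rule cInf_lower[OF _ bdd])
    with k(2) d show False by (auto simp: less_app_uminus_iff app_uminus_less_iff)
  qed
  ultimately have "Inf U < d * r" using d e s r di by (auto split: if_splits)
  then show ?thesis
    using cInf_less_iff[OF _ bdd, of "d * r"] \<open>d * s \<in> U\<close> unfolding U_def by blast
qed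

text \<open>By monotonicity it is enough to push the end of \<open>[u, v]\<close> that is farther
  from the side.\<close>

lemma move_to_side:
  assumes "F \<in> sides" "p < u" "u \<le> v" "v < q" "eventually P F"
  shows "\<exists>g\<in>G. \<forall>s. u \<le> s \<longrightarrow> s \<le> v \<longrightarrow> P (app g s)"
proof (cases "F = at_right p")
  case True
  then obtain b where b: "b > p" "\<And>y. p < y \<Longrightarrow> y < b \<Longrightarrow> P y"
    using assms unfolding True eventually_at_right_field by blast
  obtain g where g: "g \<in> G" "app g v < b"
    using orbit_accumulates[of 1 p v b] assms b by auto
  show ?thesis
  proof (intro bexI[OF _ g(1)] allI impI)
    fix s assume s: "u \<le> s" "s \<le> v"
    then have "app g s \<le> app g v" by simp
    then have "app g s < b" using g(2) by linarith
    then show "P (app g s)"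
      using s assms interval_iff[OF g(1), of s] by (intro b) auto
  qed
next
  case False
  then have F: "F = at_left q" using assms by (simp add: sides_def)
  obtain b where b: "b < q" "\<And>y. b < y \<Longrightarrow> y < q \<Longrightarrow> P y"
    using assms unfolding F eventually_at_left_field by blast
  obtain g where g: "g \<in> G" "app g u > b"
    using orbit_accumulates[of "- 1" q u b] assms b by auto
  show ?thesis
  proof (intro bexI[OF _ g(1)] allI impI)
    fix s assume s: "u \<le> s" "s \<le> v"
    then have "app g u \<le> app g s" by simp
    then have "b < app g s" using g(2) by linarith
    then show "P (app g s)"
      using s assms interval_iff[OF g(1), of s] by (intro b) auto
  qed
qed

lemma compact_support:
  assumes "f \<in> germ (at_right p)" "f \<in> germ (at_left q)" "g \<in> germ (at_right p)" "g \<in> germ (at_left q)"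
  obtains u v where "p < u" "u \<le> v" "v < q"
    "\<And>s. p < s \<Longrightarrow> s < q \<Longrightarrow> app f s \<noteq> s \<or> app g s \<noteq> s \<Longrightarrow> u \<le> s \<and> s \<le> v"
proof -
  have "\<forall>\<^sub>F s in at_right p. app f s = s \<and> app g s = s" "\<forall>\<^sub>F s in at_left q. app f s = s \<and> app g s = s"
    using assms by (auto simp: germ_def intro: eventually_conj)
  then obtain a b where
    a: "p < a" "\<And>s. p < s \<Longrightarrow> s < a \<Longrightarrow> app f s = s \<and> app g s = s" and
    b: "b < q" "\<And>s. b < s \<Longrightarrow> s < q \<Longrightarrow> app f s = s \<and> app g s = s"
    unfolding eventually_at_right_field eventually_at_left_field by blast
  \<comment> \<open>The midpoint guarantees \<open>u \<le> v\<close> even when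
    \<open>b < a\<close>.\<close>
  define m where "m = (p + q) / 2"
  have "min a m \<le> s \<and> s \<le> max b m" if "p < s" "s < q" "app f s \<noteq> s \<or> app g s \<noteq> s" for s
    using that a(2)[of s] b(2)[of s] by force
  then show ?thesis
    using that[of "min a m" "max b m"] a b pq by (auto simp: m_def)
qed

section \<open>Germ kernels and translation lengths\<close>

definition kernel :: "real filter \<Rightarrow> incr set" where
  "kernel F = {f \<in> H. phi f \<in> germ F}"

lemma kernel_sub:
  assumes "F \<in> sides"
  shows "add_subgroup (kernel F)"
  unfolding add_subgroup_def kernel_def
  using H_D add_subgroupD[OF germ_sub[OF assms]] by (auto simp: phi_zero phi_add phi_uminus)

text \<open>The group of germs is abelian and \<open>FC\<close> is perfect.\<close>

lemma FC_subset_kernel: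
  assumes "F \<in> sides"
  shows "FC \<subseteq> kernel F"
proof (rule FC_subset_if_FC_commutators[OF kernel_sub[OF assms]])
  fix h f assume "h \<in> FC" "f \<in> FC"
  then have hf: "h \<in> H" "f \<in> H" using H by auto
  then have "h + f \<in> H" "h + f - h \<in> H" "h + f - h - f \<in> H" using H_D by auto
  then show "h + f - h - f \<in> kernel F"
    using hf commutator_germ[OF assms phi_in_G phi_in_G, of h f] by (simp add: kernel_def phi_add phi_diff)
qed

text \<open>Disjointness of supports is seen in \<open>G\<close>, commutation is transported back to
  \<open>H\<close>; the hypothesis says that \<open>phi f\<close> is trivial on the image of the
  support of \<open>phi c\<close> under \<open>phi h\<close>.\<close>

lemma conjugate_commutes:
  assumes "f \<in> H" "c \<in> H" "h \<in> H"
    and disj: "\<And>s. p < s \<Longrightarrow> s < q \<Longrightarrow> app (phi c) s \<noteq> s \<Longrightarrow> app (phi f) (app (phi h) s) = app (phi h) s"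
  shows "(h + c - h) + f = f + (h + c - h)"
proof -
  have b: "h + c - h \<in> H" "phi (h + c - h) = phi h + phi c - phi h"
    using assms H_D(2)[of h c] H_D(4) by (simp_all add: phi_add phi_diff)
  have "app (phi f) s = s \<or> app (phi (h + c - h)) s = s" if "p < s" "s < q" for s
    using disj[of "app (- phi h) s"] that interval_iff[OF G_D(3)[OF phi_in_G[OF assms(3)]], of s]
    by (cases "app (phi c) (app (- phi h) s) = app (- phi h) s") (auto simp: b(2))
  then have "phi f + phi (h + c - h) = phi (h + c - h) + phi f"
    by (intro commute_if_commute_inside phi_in_G assms(1) b(1))
  then show ?thesis
    using phi_commute_iff[OF assms(1) b(1)] by simp
qed

text \<open>The image of an element of \<open>FC\<close> has compact support in
  \<open>(p, q)\<close>. It is pushed so close to the side \<open>F\<close> that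
  \<open>phi f\<close> and \<open>phi g\<close> are both trivial there. This contradicts
  \<open>no_common_centralizer\<close> unless some length of \<open>f\<close> vanishes.\<close>

lemma kernel_common_centralizer:
  assumes F: "F \<in> sides" and f: "f \<in> kernel F" and g: "g \<in> kernel F"
  obtains b where "b \<in> FC" "b \<noteq> 0" "b + f = f + b" "b + g = g + b"
proof -
  define c0 where "c0 = x0 + y0 - x0 - y0"
  have c0: "c0 \<in> FC" "c0 \<in> H"
    using x0y0 commutator_FC FC_subset_FR H unfolding c0_def by blast+
  then have "phi c0 \<in> germ (at_right p)" "phi c0 \<in> germ (at_left q)"
    using FC_subset_kernel[OF sides_simps(1)] FC_subset_kernel[OF sides_simps(2)] by (auto simp: kernel_def)
  then obtain u v where uv: "p < u" "u \<le> v" "v < q"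
    "\<And>s. p < s \<Longrightarrow> s < q \<Longrightarrow> app (phi c0) s \<noteq> s \<Longrightarrow> u \<le> s \<and> s \<le> v"
    using compact_support[of "phi c0" "phi c0"] by metis
  have "\<forall>\<^sub>F s in F. app (phi f) s = s \<and> app (phi g) s = s"
    using f g by (auto simp: kernel_def germ_def intro: eventually_conj)
  then obtain h where h: "h \<in> G" "\<And>s. u \<le> s \<Longrightarrow> s \<le> v \<Longrightarrow> app (phi f) (app h s) = app h s \<and> app (phi g) (app h s) = app h s"
    using move_to_side[OF F uv(1,2,3)] by blast
  obtain h0 where h0: "h0 \<in> H" "phi h0 = h" using phi_surj[OF h(1)] by blast
  define b where "b = h0 + c0 - h0"
  have b: "b \<in> FC" using FC_normal h0 c0 H by (auto simp: b_def add_normalizes_def)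
  have "b + f = f + b" "b + g = g + b"
    unfolding b_def using f g h0 c0(2) h(2) uv(4) by (auto intro!: conjugate_commutes simp: kernel_def)
  moreover have "b \<noteq> 0"
  proof
    assume "b = 0"
    then have "c0 = - h0 + 0 + h0" unfolding b_def by (metis add.right_neutral add_diff_cancel diff_eq_eq left_minus minus_add_cancel add_0)
    then show False using c0_moves phi_zero by (auto simp: c0_def)
  qed
  ultimately show ?thesis using that b by blast
qed

text \<open>Each element of the kernel has a vanishing length by the two centralizer results. The
  reverse inclusion holds because \<open>H\<close> modulo the kernel is cyclic: since
  \<open>chi E\<close> is not zero on \<open>H\<close>, it is nonzero on the generator
  \<open>z0\<close>, so it detects the multiple of \<open>z0\<close>.\<close>

lemma kernel_eq:
  assumes F: "F \<in> sides"
  obtains E where "E \<in> ends" "kernel F = {f \<in> H. chi E f = 0}"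
proof -
  have K: "f \<in> H" "f \<in> FR" if "f \<in> kernel F" for f
    using that H by (auto simp: kernel_def)
  have zero: "chi at_bot f = 0 \<or> chi at_top f = 0" if f: "f \<in> kernel F" for f
  proof (rule ccontr)
    assume "\<not> ?thesis"
    then have "\<And>E. E \<in> ends \<Longrightarrow> chi E f \<noteq> 0" by (auto simp: ends_def)
    then obtain g where g: "g \<in> FC" "\<And>b. b \<in> FC \<Longrightarrow> b + f = f + b \<Longrightarrow> b + g = g + b \<Longrightarrow> b = 0"
      using no_common_centralizer K[OF f] by metis
    then have "g \<in> kernel F" using FC_subset_kernel[OF F] by blast
    then show False using kernel_common_centralizer[OF F f] g(2) by metis
  qed
  \<comment> \<open>A group is not the union of two proper subgroups: a sum of two elements with
    different vanishing ends would have both lengths nonzero.\<close>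
  have "\<exists>E\<in>ends. \<forall>f\<in>kernel F. chi E f = 0"
  proof (rule ccontr)
    assume "\<not> ?thesis"
    then obtain f g where fg: "f \<in> kernel F" "g \<in> kernel F" "chi at_bot f \<noteq> 0" "chi at_top g \<noteq> 0"
      by (auto simp: ends_def)
    then have "chi at_top f = 0" "chi at_bot g = 0" using zero[of f] zero[of g] by auto
    then have "chi at_bot (f + g) \<noteq> 0" "chi at_top (f + g) \<noteq> 0"
      using fg K by (auto simp: chi_add)
    moreover have "f + g \<in> kernel F" using fg add_subgroupD[OF kernel_sub[OF F]] by blast
    ultimately show False using zero by blast
  qed
  then obtain E where E: "E \<in> ends" "\<And>f. f \<in> kernel F \<Longrightarrow> chi E f = 0" by blast
  have "w \<in> kernel F" if w: "w \<in> H" "chi E w = 0" for w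
  proof -
    obtain z where z: "z \<in> G" "\<And>w. w \<in> G \<Longrightarrow> \<exists>n. \<exists>x\<in>germ F. w = zmult n z + x"
      using germ_cyclic[OF F] by blast
    obtain z0 where z0: "z0 \<in> H" "phi z0 = z" using phi_surj[OF z(1)] by blast
    have dec: "\<exists>n. \<exists>x\<in>kernel F. w = zmult n z0 + x" if w: "w \<in> H" for w
    proof -
      obtain n x where nx: "x \<in> germ F" "phi w = zmult n z + x"
        using z(2)[OF phi_in_G[OF w]] by blast
      obtain x' where x': "x' \<in> H" "phi x' = x" using phi_surj nx germ_subset by blast
      have zn: "zmult n z0 \<in> H" using zmult_in_add_subgroup[OF H(1) z0(1)] .
      have "phi w = phi (zmult n z0 + x')"
        using nx x' z0 zn by (simp add: phi_add phi_zmult)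
      then have "w = zmult n z0 + x'" using phi_inj[OF w] H_D(2)[OF zn x'(1)] by blast
      then show ?thesis using nx x' by (auto simp: kernel_def)
    qed
    have chi_dec: "chi E (zmult n z0 + x) = n * chi E z0" if "x \<in> kernel F" for n x
    proof -
      have "zmult n z0 \<in> FR" "z0 \<in> FR"
        using z0(1) H(2) zmult_in_add_subgroup[OF H(1) z0(1), of n] by auto
      then show ?thesis
        using E(2)[OF that] K[OF that] by (simp add: chi_add chi_zmult E(1))
    qed
    obtain u where u: "u \<in> H" "chi E u \<noteq> 0" using H_chi[OF E(1)] by blast
    then have z0E: "chi E z0 \<noteq> 0" using dec[OF u(1)] chi_dec by auto
    obtain n x where nx: "x \<in> kernel F" "w = zmult n z0 + x" using dec[OF w(1)] by blast
    then have "n = 0" using chi_dec w z0E by auto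
    then show ?thesis using nx by simp
  qed
  then have "kernel F = {f \<in> H. chi E f = 0}" using E K by blast
  then show ?thesis using that E by blast
qed

text \<open>If the kernels agreed, an element with exactly one nonzero length and a conjugate of it
  would both act with compact support in \<open>(p, q)\<close>. Pushing this support off itself
  gives a further conjugate that commutes with both, against
  \<open>no_commuting_conjugate\<close>.\<close>

lemma kernel_ne: "kernel (at_right p) \<noteq> kernel (at_left q)"
proof
  assume eq: "kernel (at_right p) = kernel (at_left q)"
  obtain E where E: "E \<in> ends" "kernel (at_right p) = {f \<in> H. chi E f = 0}"
    using kernel_eq[OF sides_simps(1)] by blast
  define E' where "E' = (if E = at_top then at_bot else at_top :: real filter)"
  have "(at_bot :: real filter) \<noteq> at_top"
  proof
    assume "(at_bot :: real filter) = at_top"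
    then have "eventually (\<lambda>x::real. x \<ge> 1) at_bot" using eventually_ge_at_top by simp
    moreover have "eventually (\<lambda>x::real. x \<le> 0) at_bot" by (rule eventually_le_at_bot)
    ultimately have "eventually (\<lambda>x::real. False) at_bot" by eventually_elim simp
    then show False by simp
  qed
  then have E': "E' \<in> ends" "E \<noteq> E'" using E(1) by (auto simp: E'_def ends_def)
  obtain f where f: "f \<in> H" "chi E' f \<noteq> 0" "chi E f = 0"
    using H_chi[OF E'(1)] E(1) E'(2) by metis
  have fFR: "f \<in> FR" using f H by auto
  obtain h where h: "h \<in> FC"
    "\<And>g. (g + f - g) + f = f + (g + f - g) \<Longrightarrow> (g + f - g) + (h + f - h) \<noteq> (h + f - h) + (g + f - g)"
    using no_commuting_conjugate[OF E'(1) E(1) fFR f(2,3)] by blast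
  define k where "k = h + f - h"
  have hH: "h \<in> H" using h H by auto
  have kH: "k \<in> H" unfolding k_def using hH f H_D by blast
  have "chi E k = 0"
    unfolding k_def using E(1) hH f H H_D(2)[OF hH f(1)] by (auto simp: chi_diff chi_add subset_iff)
  then have "f \<in> kernel (at_right p)" "k \<in> kernel (at_right p)" "f \<in> kernel (at_left q)" "k \<in> kernel (at_left q)"
    using E(2) eq f kH by auto
  then obtain u v where uv: "p < u" "u \<le> v" "v < q"
    "\<And>s. p < s \<Longrightarrow> s < q \<Longrightarrow> app (phi f) s \<noteq> s \<or> app (phi k) s \<noteq> s \<Longrightarrow> u \<le> s \<and> s \<le> v"
    using compact_support[of "phi f" "phi k"] unfolding kernel_def by (smt (verit) mem_Collect_eq)
  have "\<forall>\<^sub>F s in at_left q. s > v"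
    using uv(3) unfolding eventually_at_left_field by blast
  then obtain g where g: "g \<in> G" "\<And>s. u \<le> s \<Longrightarrow> s \<le> v \<Longrightarrow> app g s > v"
    using move_to_side[OF sides_simps(2) uv(1-3)] by blast
  obtain g0 where g0: "g0 \<in> H" "phi g0 = g" using phi_surj[OF g(1)] by blast
  have "(g0 + f - g0) + f = f + (g0 + f - g0)" "(g0 + f - g0) + k = k + (g0 + f - g0)"
  proof -
    have "app (phi f) (app (phi g0) s) = app (phi g0) s \<and> app (phi k) (app (phi g0) s) = app (phi g0) s"
      if s: "p < s" "s < q" "app (phi f) s \<noteq> s" for s
    proof -
      have "app g s > v" using uv(4) g(2) s by blast
      moreover have "p < app g s" "app g s < q" using s interval_iff[OF g(1)] by auto
      ultimately show ?thesis using uv(4)[of "app g s"] g0(2) by force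
    qed
    then show "(g0 + f - g0) + f = f + (g0 + f - g0)" "(g0 + f - g0) + k = k + (g0 + f - g0)"
      using f(1) kH g0(1) conjugate_commutes by blast+
  qed
  then show False using h(2) unfolding k_def by blast
qed

text \<open>Lengths add up along words, so only generators matter, and for these \<open>gen\<close>
  says that one of the two lengths is zero: the left part of a word collects the generators with
  vanishing right length.\<close>

lemma splits:
  assumes f: "f \<in> H"
  obtains f' where "f' \<in> H" "chi at_bot f' = chi at_bot f" "chi at_top f' = 0"
proof -
  obtain E where E: "E \<in> ends" "kernel (at_right p) = {f \<in> H. chi E f = 0}"
    using kernel_eq[OF sides_simps(1)] by blast
  obtain E' where E': "E' \<in> ends" "kernel (at_left q) = {f \<in> H. chi E' f = 0}"
    using kernel_eq[OF sides_simps(2)] by blast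
  have EE: "E \<noteq> E'" using kernel_ne E E' by auto
  \<comment> \<open>Otherwise \<open>phi f\<close> is the only generator with nontrivial germ at
    \<open>p\<close>, and also at \<open>q\<close>. Every other generator then lies in
    \<open>?B\<close>, and all pairs of lengths in \<open>H\<close> are multiples of that of
    \<open>f\<close>, contrary to \<open>H_chi\<close>.\<close>
  have gen: "chi at_bot f = 0 \<or> chi at_top f = 0" if f: "f \<in> H" "phi f \<in> Y" for f
  proof (rule ccontr)
    assume *: "\<not> ?thesis"
    let ?B = "germ (at_right p) \<inter> germ (at_left q)"
    have "f \<notin> kernel (at_right p)" "f \<notin> kernel (at_left q)"
      using * E E' by (auto simp: ends_def)
    then have not: "phi f \<notin> germ (at_right p)" "phi f \<notin> germ (at_left q)" using f by (auto simp: kernel_def)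
    have B: "add_subgroup ?B" "add_normalizes G ?B"
      using germ_sub[of "at_right p"] germ_sub[of "at_left q"] germ_normal[of "at_right p"] germ_normal[of "at_left q"]
      by (auto simp: add_subgroup_def add_normalizes_def)
    have "\<exists>n. \<exists>x\<in>?B. y = zmult n (phi f) + x" if "y \<in> Y" for y
    proof (cases "y \<in> ?B")
      case True
      then show ?thesis by (intro exI[of _ 0] bexI[of _ y]) auto
    next
      case False
      then have "y = phi f"
        using germ_generator_unique[OF _ that f(2)] not sides_simps by blast
      then show ?thesis
        using add_subgroupD(1)[OF B(1)] by (intro exI[of _ 1] bexI[of _ 0]) auto
    qed
    then have dec: "\<exists>n. \<exists>x\<in>?B. w = zmult n (phi f) + x" if "w \<in> G" for w
      using span_group_cyclic_mod[OF G_sub B phi_in_G[OF f(1)] _ that] by blast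
    have "\<exists>n. \<forall>D\<in>ends. chi D w = n * chi D f" if w: "w \<in> H" for w
    proof -
      obtain n x where nx: "x \<in> ?B" "phi w = zmult n (phi f) + x"
        using dec[OF phi_in_G[OF w]] by blast
      obtain x' where x': "x' \<in> H" "phi x' = x" using phi_surj nx germ_subset by blast
      have fn: "zmult n f \<in> H" using zmult_in_add_subgroup[OF H(1) f(1)] .
      have "phi w = phi (zmult n f + x')"
        using nx x' f fn by (simp add: phi_add phi_zmult)
      then have "w = zmult n f + x'" using phi_inj[OF w] H_D(2)[OF fn x'(1)] by blast
      moreover have "x' \<in> kernel (at_right p)" "x' \<in> kernel (at_left q)"
        using nx x' by (auto simp: kernel_def)
      then have "\<forall>D\<in>ends. chi D x' = 0" using E E' EE by (auto simp: ends_def)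
      moreover have "zmult n f \<in> FR" "x' \<in> FR" "f \<in> FR" using fn x' f H by auto
      ultimately show ?thesis by (intro exI[of _ n]) (auto simp: chi_add chi_zmult)
    qed
    moreover obtain w where w: "w \<in> H" "chi E w \<noteq> 0" "chi E' w = 0"
      using H_chi[OF E(1)] E'(1) EE by metis
    ultimately obtain n where n: "chi E w = n * chi E f" "chi E' w = n * chi E' f"
      using E(1) E'(1) by blast
    have "chi E' f \<noteq> 0" using * E' by (auto simp: ends_def)
    then have "n = 0" using n w by auto
    then show False using n w by simp
  qed
  \<comment> \<open>Induction over words in \<open>Y\<close>, with \<open>f'\<close> the part that
    carries only the length at the left end.\<close>
  have "\<exists>f\<in>H. \<exists>f'\<in>H. phi f = g \<and> chi at_bot f' = chi at_bot f \<and> chi at_top f' = 0" if "g \<in> G" for g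
    using that
  proof induction
    case zero
    then show ?case using H_D(1) phi_zero by (intro bexI[of _ 0]) auto
  next
    case (base y)
    then obtain f where f: "f \<in> H" "phi f = y" using phi_surj span_group.base by blast
    then have "chi at_bot f = 0 \<or> chi at_top f = 0" using gen base by blast
    then show ?case
    proof
      assume "chi at_bot f = 0"
      then show ?thesis using f H_D(1) by (intro bexI[of _ f] bexI[of _ 0]) auto
    qed (use f in blast)
  next
    case (plus g h)
    then obtain f f' k k' where *: "f \<in> H" "f' \<in> H" "phi f = g" "chi at_bot f' = chi at_bot f" "chi at_top f' = 0"
      "k \<in> H" "k' \<in> H" "phi k = h" "chi at_bot k' = chi at_bot k" "chi at_top k' = 0" by blast
    moreover from * have "f \<in> FR" "f' \<in> FR" "k \<in> FR" "k' \<in> FR" using H by auto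
    ultimately show ?case
      by (intro bexI[of _ "f + k"] bexI[of _ "f' + k'"]) (simp_all add: phi_add chi_add H_D(2))
  next
    case (uminus g)
    then obtain f f' where *: "f \<in> H" "f' \<in> H" "phi f = g" "chi at_bot f' = chi at_bot f" "chi at_top f' = 0"
      by blast
    moreover from * have "f \<in> FR" "f' \<in> FR" using H by auto
    ultimately show ?case
      by (intro bexI[of _ "- f"] bexI[of _ "- f'"]) (simp_all add: phi_uminus chi_uminus H_D(3))
  qed
  from this[OF phi_in_G[OF f]] obtain k f' where "k \<in> H" "f' \<in> H" "phi k = phi f"
    "chi at_bot f' = chi at_bot k" "chi at_top f' = 0" by blast
  then show ?thesis using that phi_inj[OF _ f] by metis
qed

end

text \<open>The lengths at each end form a subgroup of the integers. By \<open>splits\<close> the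
  two lengths can be prescribed independently, and the remaining freedom is \<open>FC\<close>, which
  lies in \<open>H\<close>.\<close>

theorem (in proper_copy) multiples:
  obtains a b where "a > 0" "b > 0" "H = {f \<in> FR. a dvd chi at_bot f \<and> b dvd chi at_top f}"
proof -
  obtain p q x0 y0 where "proper_copy_component H Y phi p q x0 y0"
    using component_exists by blast
  then interpret proper_copy_component H Y phi p q x0 y0 .
  have sub: "add_subgroup (chi E ` H)" "chi E ` H \<noteq> {0}" if E: "E \<in> ends" for E
  proof -
    show "add_subgroup (chi E ` H)"
      by (rule additive_on_image[OF H(1)]) (use E H(2) in \<open>auto simp: additive_on_def chi_add subset_iff\<close>)
    obtain u where "u \<in> H" "chi E u \<noteq> 0" using H_chi[OF E] by metis
    then show "chi E ` H \<noteq> {0}" by blast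
  qed
  obtain a where a: "a > 0" "chi at_bot ` H = {k. a dvd k}"
    using int_subgroup_multiples[OF sub[of at_bot]] by auto
  obtain b where b: "b > 0" "chi at_top ` H = {k. b dvd k}"
    using int_subgroup_multiples[OF sub[of at_top]] by auto
  have "f \<in> H" if f: "f \<in> FR" "a dvd chi at_bot f" "b dvd chi at_top f" for f
  proof -
    obtain g where g: "g \<in> H" "chi at_bot g = chi at_bot f" using a f by (metis (mono_tags) imageE mem_Collect_eq)
    obtain h where h: "h \<in> H" "chi at_top h = chi at_top f" using b f by (metis (mono_tags) imageE mem_Collect_eq)
    obtain g' where g': "g' \<in> H" "chi at_bot g' = chi at_bot g" "chi at_top g' = 0" using splits[OF g(1)] by blast
    obtain h' where h': "h' \<in> H" "chi at_bot h' = chi at_bot h" "chi at_top h' = 0" using splits[OF h(1)] by blast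
    \<comment> \<open>\<open>g'\<close> supplies the length at the left end only,
      \<open>h - h'\<close> the one at the right end only.\<close>
    have "f - (g' + (h - h')) \<in> FC"
    proof -
      have "g' \<in> FR" "h \<in> FR" "h' \<in> FR" using g' h h' H by auto
      moreover from this have "h - h' \<in> FR" "g' + (h - h') \<in> FR" "f - (g' + (h - h')) \<in> FR"
        using f by (simp_all add: FR_D(2,4))
      ultimately show ?thesis
        using f g g' h h' by (auto simp: FC_def ends_def chi_add chi_diff)
    qed
    then have "f - (g' + (h - h')) \<in> H" using H by auto
    moreover have "g' + (h - h') \<in> H" by (simp add: g' h h' H_D(2,4))
    ultimately have "f - (g' + (h - h')) + (g' + (h - h')) \<in> H" by (rule H_D(2))
    then show ?thesis by simp
  qed
  moreover have "f \<in> FR" "a dvd chi at_bot f" "b dvd chi at_top f" if "f \<in> H" for f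
    using that a b H by auto
  ultimately have "H = {f \<in> FR. a dvd chi at_bot f \<and> b dvd chi at_top f}" by blast
  then show ?thesis using that a b by blast
qed

section \<open>The subgroups of multiples are conjugate to the whole group\<close>

lemma strict_mono_unit_intervals:
  fixes f :: "real \<Rightarrow> real"
  assumes "\<And>(i::int) s t. of_int i \<le> s \<Longrightarrow> s < t \<Longrightarrow> t \<le> of_int i + 1 \<Longrightarrow> f s < f t"
  shows "strict_mono f"
proof (rule strict_monoI)
  fix s t :: real assume "s < t"
  have "f s < f t" if "s < t" "t \<le> of_int \<lfloor>s\<rfloor> + 1 + real n" for n t
    using that
  proof (induction n arbitrary: t)
    case 0
    then show ?case using assms[of "\<lfloor>s\<rfloor>" s t] by auto
  next
    case (Suc n)
    let ?m = "of_int \<lfloor>s\<rfloor> + 1 + real n"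
    show ?case
    proof (cases "t \<le> ?m")
      case False
      have "s < ?m" by linarith
      then have "f s < f ?m" by (intro Suc.IH) auto
      also have "\<dots> < f t"
        using assms[of "\<lfloor>s\<rfloor> + 1 + int n" ?m t] Suc.prems False by auto
      finally show ?thesis .
    qed (use Suc in auto)
  qed
  moreover obtain n :: nat where "real n \<ge> t - of_int \<lfloor>s\<rfloor> - 1"
    using real_arch_simple by blast
  ultimately show "f s < f t" using \<open>s < t\<close> by (simp add: algebra_simps)
qed

text \<open>Integers are dyadic, so a change of piece there is allowed once the values
  match.\<close>

lemma pl_at_floor:
  fixes A :: "int \<Rightarrow> real \<Rightarrow> real"
  assumes A: "\<And>i s. pl_at (A i) s" and match: "\<And>i. A i (of_int i + 1) = A (i + 1) (of_int i + 1)"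
  shows "pl_at (\<lambda>t. A \<lfloor>t\<rfloor> t) t"
proof (cases "t = of_int \<lfloor>t\<rfloor>")
  case True
  define i where "i = \<lfloor>t\<rfloor>"
  have t: "t = of_int i" using True by (simp add: i_def)
  have l: "A \<lfloor>s\<rfloor> s = A (i - 1) s" if "t - 1 / 2 \<le> s" "s \<le> t" for s
  proof (cases "s = t")
    case False
    then have "\<lfloor>s\<rfloor> = i - 1" using that t by linarith
    then show ?thesis by simp
  qed (use match[of "i - 1"] t in simp)
  have r: "A \<lfloor>s\<rfloor> s = A i s" if "t \<le> s" "s \<le> t + 1 / 2" for s
  proof -
    have "\<lfloor>s\<rfloor> = i" using that t by linarith
    then show ?thesis by simp
  qed
  have "dyadic t" by (simp add: t)
  then show ?thesis
    by (rule pl_at_glue[OF _ _ A[of "i - 1" t] A[of i t], where e = "1 / 2"]) (auto intro: l r)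
next
  case False
  define e where "e = min (t - of_int \<lfloor>t\<rfloor>) (of_int \<lfloor>t\<rfloor> + 1 - t)"
  have "of_int \<lfloor>t\<rfloor> < t" "t < of_int \<lfloor>t\<rfloor> + 1" using False by linarith+
  then have "e > 0" by (simp add: e_def)
  moreover have "A \<lfloor>s\<rfloor> s = A \<lfloor>t\<rfloor> s" if "\<bar>s - t\<bar> < e" for s
  proof -
    have "of_int \<lfloor>t\<rfloor> \<le> s" "s < of_int \<lfloor>t\<rfloor> + 1" using that unfolding e_def by linarith+
    then have "\<lfloor>s\<rfloor> = \<lfloor>t\<rfloor>" by (simp add: floor_unique)
    then show ?thesis by simp
  qed
  ultimately show ?thesis by (rule pl_at_cong[OF A])
qed

text \<open>\<open>n + 1\<close> need not be a power of two, so one affine piece does not suffice;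
  each factor doubles the last unit interval of the current image of \<open>[0, 1]\<close>.\<close>

primrec mu :: "nat \<Rightarrow> incr" where
  "mu 0 = 0"
| "mu (Suc n) = stretch (real n) 1 1 + mu n"

lemma mu_PL: "mu n \<in> PL"
  by (induction n) (auto intro!: PL_D(1,2) stretch_PL)

lemma mu_0: "app (mu n) 0 = 0" and mu_1: "app (mu n) 1 = real n + 1"
  by (induction n) (auto simp: app_stretch)

text \<open>The extension of \<open>mu n\<close>, which maps \<open>[0, 1]\<close> onto \<open>[0, n + 1]\<close>, to the line that turns translation
  by \<open>1\<close> into translation by \<open>n + 1\<close>.\<close>

definition dilate_fun :: "nat \<Rightarrow> real \<Rightarrow> real" where
  "dilate_fun n t = app (mu n) (t - of_int \<lfloor>t\<rfloor>) + (real n + 1) * of_int \<lfloor>t\<rfloor>"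

definition dilate :: "nat \<Rightarrow> incr" where
  "dilate n = Incr (dilate_fun n)"

lemma dilate_fun_on_unit_interval:
  assumes "of_int i \<le> s" "s \<le> of_int i + 1"
  shows "dilate_fun n s = app (mu n) (s - of_int i) + (real n + 1) * of_int i"
proof (cases "s = of_int i + 1")
  case True
  then show ?thesis by (simp add: dilate_fun_def mu_0 mu_1 algebra_simps)
next
  case False
  then have "\<lfloor>s\<rfloor> = i" using assms by linarith
  then show ?thesis by (simp add: dilate_fun_def)
qed

lemma app_dilate: "app (dilate n) = dilate_fun n"
  unfolding dilate_def
proof (rule app_Incr)
  show "strict_mono (dilate_fun n)"
  proof (rule strict_mono_unit_intervals)
    fix i :: int and s t :: real
    assume *: "of_int i \<le> s" "s < t" "t \<le> of_int i + 1"
    then show "dilate_fun n s < dilate_fun n t"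
      using dilate_fun_on_unit_interval[of i s n] dilate_fun_on_unit_interval[of i t n] by simp
  qed
  have "\<exists>t. dilate_fun n t = y" for y
  proof -
    define i where "i = \<lfloor>y / (real n + 1)\<rfloor>"
    define r where "r = y - (real n + 1) * of_int i"
    have "of_int i \<le> y / (real n + 1)" "y / (real n + 1) < of_int i + 1" by (auto simp: i_def)
    then have "0 \<le> r" "r < real n + 1" by (simp_all add: r_def field_simps)
    then have "0 \<le> app (- mu n) r" "app (- mu n) r \<le> 1"
      by (simp_all add: le_app_uminus_iff app_uminus_le_iff mu_0 mu_1)
    then have "dilate_fun n (app (- mu n) r + of_int i) = y"
      by (subst dilate_fun_on_unit_interval[of i]) (auto simp: r_def)
    then show ?thesis by blast
  qed
  then show "surj (dilate_fun n)" unfolding surj_def by metis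
qed

lemma app_dilate_add: "app (dilate n) (t + of_int k) = app (dilate n) t + (real n + 1) * of_int k"
  by (simp add: app_dilate dilate_fun_def algebra_simps)

lemma app_dilate_0: "app (dilate n) 0 = 0"
  by (simp add: app_dilate dilate_fun_def mu_0)

lemma dilate_PL: "dilate n \<in> PL"
proof -
  let ?A = "\<lambda>i t. app (mu n) (t - of_int i) + (real n + 1) * of_int i"
  have "pl_at (?A i) s" for i s
  proof -
    have "aff 0 (real_of_int i * (real n + 1)) + mu n + aff 0 (- real_of_int i) \<in> PL"
      by (intro PL_D(2) mu_PL aff_PL dyadic_intros) auto
    moreover have "app (aff 0 (real_of_int i * (real n + 1)) + mu n + aff 0 (- real_of_int i)) = ?A i"
      by (auto simp: algebra_simps)
    ultimately show ?thesis by (metis (no_types, lifting) PL_def mem_Collect_eq)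
  qed
  then have "pl_at (\<lambda>t. ?A \<lfloor>t\<rfloor> t) t" for t
    by (rule pl_at_floor) (simp add: mu_0 mu_1 algebra_simps)
  then show ?thesis
    by (auto simp: PL_def app_dilate dilate_fun_def[abs_def])
qed

text \<open>The threshold may depend on \<open>k\<close>, because \<open>t\<close> and
  \<open>t + k\<close> have to lie on the same side of the point where two dilations are
  glued.\<close>

definition rescales :: "real filter \<Rightarrow> incr \<Rightarrow> int \<Rightarrow> bool" where
  "rescales F h c \<longleftrightarrow> (\<forall>k::int. \<forall>\<^sub>F t in F. app h (t + of_int k) = app h t + of_int (c * k))"

lemma rescales_conj:
  assumes "F \<in> ends" "rescales F h c" "translates F f k"
  shows "translates F (h + f - h) (c * k)"
proof -
  have "\<forall>\<^sub>F t in F. app h (t + of_int k) = app h t + of_int (c * k)"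
    using assms(2) by (simp add: rescales_def)
  with assms(3)[unfolded translates_def] have "\<forall>\<^sub>F t in F. app h (app f t) = app h t + of_int (c * k)"
    by eventually_elim simp
  from eventually_app[OF assms(1) this, of "- h"] show ?thesis
    unfolding translates_def by eventually_elim simp
qed

lemma rescales_conj_inverse:
  assumes "F \<in> ends" "rescales F h c" "translates F g (c * k)"
  shows "translates F (- h + g + h) k"
proof -
  have "\<forall>\<^sub>F t in F. app h (t + of_int k) = app h t + of_int (c * k)"
    using assms(2) by (simp add: rescales_def)
  moreover have "\<forall>\<^sub>F t in F. app g (app h t) = app h t + of_int (c * k)"
    using eventually_app[OF assms(1) assms(3)[unfolded translates_def]] .
  ultimately show ?thesis
    unfolding translates_def by eventually_elim (simp add: app_uminus_eq_iff)
qed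

text \<open>Unless \<open>a = b = 1\<close>, the conjugator lies in \<open>PL\<close> but not in
  \<open>FR\<close>: it multiplies lengths by \<open>a\<close> at the left end and by
  \<open>b\<close> at the right end, and its inverse divides them.\<close>

lemma multiples_conj:
  assumes "a > 0" "b > 0"
  obtains h where "bij_betw (\<lambda>f. h + f - h) FR {f \<in> FR. a dvd chi at_bot f \<and> b dvd chi at_top f}"
proof -
  \<comment> \<open>\<open>dilate n\<close> multiplies translation lengths by \<open>n + 1\<close>,
    hence the shift by one; both halves fix \<open>0\<close>.\<close>
  define h where "h = glue 0 (dilate (nat (a - 1))) (dilate (nat (b - 1)))"
  have app_h: "app h t = (if t \<le> 0 then app (dilate (nat (a - 1))) t else app (dilate (nat (b - 1))) t)" for t
    unfolding h_def by (rule app_glue) (simp add: app_dilate_0)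
  have h: "h \<in> PL"
    unfolding h_def by (rule PL_glue) (auto simp: dilate_PL app_dilate_0)
  have bot: "rescales at_bot h a"
    unfolding rescales_def
  proof
    fix k :: int
    show "\<forall>\<^sub>F t in at_bot. app h (t + of_int k) = app h t + of_int (a * k)"
      unfolding eventually_at_bot_linorder
      by (rule exI[of _ "- \<bar>of_int k\<bar>"]) (use assms in \<open>auto simp: app_h app_dilate_add\<close>)
  qed
  have top: "rescales at_top h b"
    unfolding rescales_def
  proof
    fix k :: int
    show "\<forall>\<^sub>F t in at_top. app h (t + of_int k) = app h t + of_int (b * k)"
      unfolding eventually_at_top_linorder
      by (rule exI[of _ "\<bar>of_int k\<bar> + 1"]) (use assms in \<open>auto simp: app_h app_dilate_add\<close>)
  qed
  let ?K = "{f \<in> FR. a dvd chi at_bot f \<and> b dvd chi at_top f}"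
  have "h + f - h \<in> ?K" if f: "f \<in> FR" for f
  proof -
    have "translates at_bot (h + f - h) (a * chi at_bot f)" "translates at_top (h + f - h) (b * chi at_top f)"
      using rescales_conj[OF _ bot] rescales_conj[OF _ top] translates_chi f by auto
    moreover have "h + f - h \<in> PL"
      using h f PL_D(2,4) by (simp add: FR_def)
    ultimately show ?thesis
      by (auto simp: FR_def ends_def chi_eqI)
  qed
  moreover have "\<exists>f\<in>FR. g = h + f - h" if g: "g \<in> ?K" for g
  proof -
    obtain k l where kl: "chi at_bot g = a * k" "chi at_top g = b * l"
      using g by (auto simp: dvd_def)
    then have "translates at_bot g (a * k)" "translates at_top g (b * l)"
      using translates_chi[of at_bot g] translates_chi[of at_top g] g by auto
    then have "translates at_bot (- h + g + h) k" "translates at_top (- h + g + h) l"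
      using rescales_conj_inverse[OF _ bot] rescales_conj_inverse[OF _ top] by auto
    moreover have "- h + g + h \<in> PL"
      using h g PL_D(2,3) by (simp add: FR_def)
    ultimately have "- h + g + h \<in> FR"
      by (auto simp: FR_def ends_def)
    moreover have "g = h + (- h + g + h) - h"
      by (simp add: add.assoc[symmetric])
    ultimately show ?thesis by blast
  qed
  moreover have "f = g" if "h + f - h = h + g - h" for f g
    using that by (metis add_left_cancel diff_add_cancel)
  ultimately have "bij_betw (\<lambda>f. h + f - h) FR ?K"
    unfolding bij_betw_def inj_on_def by blast
  then show ?thesis using that by blast
qed

section \<open>Thompson's group on the interval and on the line\<close>

text \<open>A dyadic piecewise linear homeomorphism of the line onto \<open>(0, 1)\<close> that turns translations
  near the ends of the line into multiplications by powers of two near the ends of the interval.\<close>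

definition squeeze_piece :: "int \<Rightarrow> real \<Rightarrow> real" where
  "squeeze_piece i t = (if i < 0 then 2 powr of_int (i - 1) * (1 + (t - of_int i))
     else 1 - 2 powr of_int (- i - 2) * (2 - (t - of_int i)))"

definition squeeze :: "real \<Rightarrow> real" where
  "squeeze t = squeeze_piece \<lfloor>t\<rfloor> t"

text \<open>For \<open>i < 0\<close> the piece maps \<open>[i, i + 1]\<close> onto
  \<open>[2^(i-1), 2^i]\<close>, for \<open>i \<ge> 0\<close> onto
  \<open>[1 - 2^(-i-1), 1 - 2^(-i-2)]\<close>; the two families meet at \<open>0\<close> with value
  \<open>1 / 2\<close>.\<close>

lemma squeeze_piece_match: "squeeze_piece i (of_int i + 1) = squeeze_piece (i + 1) (of_int i + 1)"
proof -
  have "2 powr of_int (i + 1 - 1) = 2 * (2 powr of_int (i - 1) :: real)"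
    using powr_add[of "2::real" 1 "of_int (i - 1)"] by simp
  moreover have "2 powr of_int (- i - 2) = 2 * (2 powr of_int (- (i + 1) - 2) :: real)"
    using powr_add[of "2::real" 1 "of_int (- (i + 1) - 2)"] by (simp add: algebra_simps)
  moreover have "2 powr - 2 = (1 / 4 :: real)"
    by (simp add: powr_minus)
  ultimately show ?thesis
    by (cases "i = - 1") (auto simp: squeeze_piece_def)
qed

lemma squeeze_piece_less: "s < t \<Longrightarrow> squeeze_piece i s < squeeze_piece i t"
  by (simp add: squeeze_piece_def)

lemma squeeze_on_unit_interval:
  assumes "of_int i \<le> s" "s \<le> of_int i + 1"
  shows "squeeze s = squeeze_piece i s"
proof (cases "s = of_int i + 1")
  case True
  then show ?thesis using squeeze_piece_match[of i] by (simp add: squeeze_def)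
next
  case False
  then have "\<lfloor>s\<rfloor> = i" using assms by linarith
  then show ?thesis by (simp add: squeeze_def)
qed

lemma strict_mono_squeeze: "strict_mono squeeze"
proof (rule strict_mono_unit_intervals)
  fix i :: int and s t :: real
  assume *: "of_int i \<le> s" "s < t" "t \<le> of_int i + 1"
  then show "squeeze s < squeeze t"
    using squeeze_on_unit_interval[of i s] squeeze_on_unit_interval[of i t] squeeze_piece_less[of s t i] by simp
qed

lemma squeeze_less_iff: "squeeze s < squeeze t \<longleftrightarrow> s < t"
  using strict_mono_squeeze by (rule strict_mono_less)

lemma squeeze_0: "squeeze 0 = 1 / 2"
  by (simp add: squeeze_def squeeze_piece_def powr_minus)

lemma pl_at_squeeze: "pl_at squeeze t"
proof -
  have "pl_at (squeeze_piece i) s" for i s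
  proof (cases "i < 0")
    case True
    have "squeeze_piece i = (\<lambda>t. 2 powr of_int (i - 1) * t + 2 powr of_int (i - 1) * (1 - of_int i))"
      using True by (auto simp: squeeze_piece_def algebra_simps)
    moreover have "\<dots> \<in> dyadic_affine"
      by (intro dyadic_affineI dyadic_intros) auto
    ultimately show ?thesis by (simp add: pl_at_affine)
  next
    case False
    have "squeeze_piece i = (\<lambda>t. 2 powr of_int (- i - 2) * t + (1 - 2 powr of_int (- i - 2) * (2 + of_int i)))"
      using False by (auto simp: squeeze_piece_def algebra_simps)
    moreover have "\<dots> \<in> dyadic_affine"
      by (intro dyadic_affineI dyadic_intros) auto
    ultimately show ?thesis by (simp add: pl_at_affine)
  qed
  then have "pl_at (\<lambda>t. squeeze_piece \<lfloor>t\<rfloor> t) t"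
    by (rule pl_at_floor[OF _ squeeze_piece_match])
  then show ?thesis by (simp add: squeeze_def[abs_def])
qed

lemma squeeze_bounds: "0 < squeeze t" "squeeze t < 1"
proof -
  have f: "0 \<le> t - of_int \<lfloor>t\<rfloor>" "t - of_int \<lfloor>t\<rfloor> < 1" by linarith+
  show "0 < squeeze t"
  proof (cases "t < 0")
    case True
    moreover have "0 < 1 + (t - of_int \<lfloor>t\<rfloor>)" using f by linarith
    ultimately show ?thesis by (simp add: squeeze_def squeeze_piece_def zero_less_mult_iff)
  next
    case False
    then have "squeeze 0 \<le> squeeze t" using strict_mono_squeeze strict_mono_less_eq by force
    then show ?thesis by (simp add: squeeze_0)
  qed
  show "squeeze t < 1"
  proof (cases "t < 0")
    case True
    then have "squeeze t < squeeze 0" by (simp add: squeeze_less_iff)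
    then show ?thesis by (simp add: squeeze_0)
  next
    case False
    then show ?thesis using f by (simp add: squeeze_def squeeze_piece_def)
  qed
qed

lemma squeeze_surj:
  assumes "0 < y" "y < 1"
  shows "\<exists>t. squeeze t = y"
proof (cases "y < 1 / 2")
  case True
  \<comment> \<open>The index of the piece whose image \<open>[2^(i-1), 2^i]\<close> contains
    \<open>y\<close>; the other half is located by \<open>1 - y\<close> in the same way.\<close>
  define i where "i = \<lfloor>log 2 y\<rfloor> + 1"
  have "of_int (i - 1) \<le> log 2 y" "log 2 y < of_int i" by (simp_all add: i_def)
  then have i: "2 powr of_int (i - 1) \<le> y" "y < 2 powr of_int i"
    using assms by (simp_all add: le_log_iff log_less_iff)
  have "log 2 y < -1"
    using True assms by (simp add: log_less_iff powr_minus)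
  then have "i < 0" unfolding i_def by linarith
  let ?r = "y / 2 powr of_int (i - 1) - 1"
  have "2 powr of_int i = 2 * (2 powr of_int (i - 1) :: real)"
    using powr_add[of "2::real" 1 "of_int (i - 1)"] by simp
  then have "0 \<le> ?r" "?r \<le> 1"
    using i by (simp_all add: field_simps)
  then have "squeeze (of_int i + ?r) = squeeze_piece i (of_int i + ?r)"
    by (intro squeeze_on_unit_interval) auto
  also have "\<dots> = y"
    using \<open>i < 0\<close> by (simp add: squeeze_piece_def)
  finally show ?thesis by blast
next
  case False
  define i where "i = \<lfloor>- log 2 (1 - y)\<rfloor> - 1"
  have "- of_int i - 2 < log 2 (1 - y)" "log 2 (1 - y) \<le> - of_int i - 1"
    unfolding i_def by linarith+
  then have i: "2 powr of_int (- i - 2) < 1 - y" "1 - y \<le> 2 powr (of_int (- i - 1))"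
    using assms by (simp_all add: less_log_iff log_le_iff)
  have "log 2 (1 - y) \<le> -1"
    using False assms by (simp add: log_le_iff powr_minus)
  then have "i \<ge> 0" unfolding i_def by linarith
  let ?r = "2 - (1 - y) / 2 powr of_int (- i - 2)"
  have *: "real_of_int (- i - 1) = 1 + of_int (- i - 2)" by simp
  have "2 powr of_int (- i - 1) = 2 * (2 powr of_int (- i - 2) :: real)"
    unfolding * powr_add by simp
  then have "0 \<le> ?r" "?r \<le> 1"
    using i by (simp_all add: field_simps)
  then have "squeeze (of_int i + ?r) = squeeze_piece i (of_int i + ?r)"
    by (intro squeeze_on_unit_interval) auto
  also have "\<dots> = y"
    using \<open>i \<ge> 0\<close> by (simp add: squeeze_piece_def)
  finally show ?thesis by blast
qed

lemma squeeze_add_neg: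
  assumes "t < 0" "t + of_int k < 0"
  shows "squeeze (t + of_int k) = 2 powr of_int k * squeeze t"
proof -
  have "\<lfloor>t\<rfloor> < 0" "\<lfloor>t\<rfloor> + k < 0" using assms by linarith+
  then show ?thesis
    using powr_add[of "2::real" "of_int k" "of_int (\<lfloor>t\<rfloor> - 1)"] by (simp add: squeeze_def squeeze_piece_def algebra_simps)
qed

lemma squeeze_add_pos:
  assumes "t \<ge> 0" "t + of_int k \<ge> 0"
  shows "1 - squeeze (t + of_int k) = 2 powr of_int (- k) * (1 - squeeze t)"
proof -
  have "\<lfloor>t\<rfloor> \<ge> 0" "\<lfloor>t\<rfloor> + k \<ge> 0" using assms by linarith+
  then show ?thesis
    using powr_add[of "2::real" "of_int (- k)" "of_int (- \<lfloor>t\<rfloor> - 2)"] by (simp add: squeeze_def squeeze_piece_def algebra_simps)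
qed

definition unsqueeze :: "real \<Rightarrow> real" where
  "unsqueeze = inv_into UNIV squeeze"

lemma unsqueeze_squeeze [simp]: "unsqueeze (squeeze t) = t"
  unfolding unsqueeze_def using strict_mono_squeeze by (simp add: strict_mono_imp_inj_on)

lemma squeeze_unsqueeze: "0 < y \<Longrightarrow> y < 1 \<Longrightarrow> squeeze (unsqueeze y) = y"
  using squeeze_surj by force

lemma pl_at_unsqueeze: "0 < y \<Longrightarrow> y < 1 \<Longrightarrow> pl_at unsqueeze y"
  using pl_at_inverse[OF pl_at_squeeze unsqueeze_squeeze] squeeze_surj by metis

lemma unsqueeze_less_iff: "0 < x \<Longrightarrow> x < 1 \<Longrightarrow> 0 < y \<Longrightarrow> y < 1 \<Longrightarrow> unsqueeze x < unsqueeze y \<longleftrightarrow> x < y"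
  using squeeze_less_iff[of "unsqueeze x" "unsqueeze y"] by (simp add: squeeze_unsqueeze)

section \<open>The groups on the interval as sets of increasing bijections\<close>

lemma homeo_incr_interval:
  assumes "g \<in> homeo_incr"
  shows "0 < app g t \<longleftrightarrow> 0 < t" "app g t < 1 \<longleftrightarrow> t < 1" "0 \<le> app g t \<longleftrightarrow> 0 \<le> t" "app g t \<le> 1 \<longleftrightarrow> t \<le> 1"
  using app_less_iff[of g 0 t] app_less_iff[of g t 1] app_le_iff[of g 0 t] app_le_iff[of g t 1]
    homeo_incr_endpoints[OF assms] by auto

text \<open>Extended by the identity, an orientation preserving homeomorphism of the interval is an
  increasing bijection of the line, and conversely continuity is automatic.\<close>

lemma Homeo_plus_eq: "Homeo_plus = app ` homeo_incr"
proof (intro subset_antisym subsetI)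
  fix f assume f: "f \<in> Homeo_plus"
  then obtain g where g: "homeomorphism {0..1} {0..1} f g" and mono: "mono_on {0..1} f"
    and out: "\<And>t. t \<notin> {0..1} \<Longrightarrow> f t = t"
    unfolding Homeo_plus_def by blast
  have im: "f ` {0..1} = {0..1}" and inj: "inj_on f {0..1}"
  proof -
    show "f ` {0..1} = {0..1}" using g by (simp add: homeomorphism_def)
    show "inj_on f {0..1}" using g by (intro inj_on_inverseI[of _ g]) (simp add: homeomorphism_def)
  qed
  have f01: "0 \<le> f t \<and> f t \<le> 1" if "0 \<le> t" "t \<le> 1" for t
  proof -
    have "f t \<in> f ` {0..1}" using that by auto
    then show ?thesis unfolding im by simp
  qed
  have "strict_mono f"
  proof (rule strict_monoI)
    fix s t :: real assume st: "s < t"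
    show "f s < f t"
    proof (cases "s \<in> {0..1} \<and> t \<in> {0..1}")
      case True
      then have "f s \<le> f t" "f s \<noteq> f t"
        using st monotone_onD[OF mono, of s t] inj_onD[OF inj, of s t] by auto
      then show ?thesis by simp
    next
      case False
      then show ?thesis
        using st out[of s] out[of t] f01[of s] f01[of t] by (cases "s \<in> {0..1}"; cases "t \<in> {0..1}") auto
    qed
  qed
  moreover have "surj f"
  proof -
    have "\<exists>x. f x = y" for y
    proof (cases "y \<in> {0..1}")
      case True
      then have "y \<in> f ` {0..1}" unfolding im .
      then show ?thesis by auto
    next
      case False
      then show ?thesis using out by auto
    qed
    then show ?thesis unfolding surj_def by metis
  qed
  ultimately have "app (Incr f) = f" by (rule app_Incr)
  moreover from this have "Incr f \<in> homeo_incr" using out by (simp add: homeo_incr_def)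
  ultimately show "f \<in> app ` homeo_incr" by (metis imageI)
next
  fix f assume "f \<in> app ` homeo_incr"
  then obtain g where g: "g \<in> homeo_incr" "f = app g" by blast
  then have m: "- g \<in> homeo_incr" using add_subgroupD(3)[OF homeo_incr_sub] by blast
  have "homeomorphism {0..1} {0..1} (app g) (app (- g))"
    by (rule homeomorphismI)
       (use homeo_incr_interval[OF g(1)] homeo_incr_interval[OF m] in \<open>auto intro: continuous_on_app\<close>)
  then show "f \<in> Homeo_plus"
    using g unfolding Homeo_plus_def by (auto simp: homeo_incr_def mono_on_def)
qed

lemma list_switch:
  assumes "xs \<noteq> []" "P (hd xs)" "\<not> P (last xs)"
  shows "\<exists>i. Suc i < length xs \<and> P (xs ! i) \<and> \<not> P (xs ! Suc i)"
  using assms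
proof (induction xs)
  case (Cons x xs)
  show ?case
  proof (cases "xs \<noteq> [] \<and> P (hd xs)")
    case True
    then obtain i where "Suc i < length xs" "P (xs ! i)" "\<not> P (xs ! Suc i)"
      using Cons by (auto split: if_splits)
    then show ?thesis by (intro exI[of _ "Suc i"]) auto
  next
    case False
    then show ?thesis
      using Cons.prems by (intro exI[of _ 0]) (auto simp: hd_conv_nth split: if_splits)
  qed
qed simp

text \<open>\<open>Thompson_F_set\<close> asks for dyadic breakpoints but not for dyadic constants
  \<open>c\<close>. These are found to be dyadic by following the values at the breakpoints upwards
  from \<open>f 0 = 0\<close>.\<close>

lemma Thompson_F_set_pl:
  assumes "f \<in> Thompson_F_set"
  shows "pl_at f t"
proof -
  obtain g where g: "g \<in> homeo_incr" "f = app g"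
    using assms unfolding Thompson_F_set_def Homeo_plus_eq by blast
  have f01: "f 0 = 0" "f 1 = 1" and out: "\<And>t. t \<le> 0 \<or> t \<ge> 1 \<Longrightarrow> f t = t"
  proof -
    show "f 0 = 0" "f 1 = 1" using homeo_incr_endpoints[OF g(1)] g by auto
    then show "f t = t" if "t \<le> 0 \<or> t \<ge> 1" for t
      using that g by (cases "t = 0 \<or> t = 1") (auto simp: homeo_incr_def)
  qed
  obtain xs :: "real list" where xs: "xs \<noteq> []" "hd xs = 0" "last xs = 1" "\<And>x. x \<in> set xs \<Longrightarrow> dyadic x"
    "\<And>i. Suc i < length xs \<Longrightarrow> \<exists>(k::int) (c::real).
          \<forall>t\<in>{xs ! i .. xs ! Suc i}. f t = 2 powr (real_of_int k) * t + c" and sorted: "sorted_wrt (<) xs"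
    using assms unfolding Thompson_F_set_def by blast
  have less: "xs ! i < xs ! Suc i" if "Suc i < length xs" for i
    using sorted that by (simp add: sorted_wrt_nth_less)
  have dy: "dyadic (f (xs ! i))" if "i < length xs" for i
    using that
  proof (induction i)
    case 0
    then show ?case using xs(1,2) f01 by (simp add: hd_conv_nth)
  next
    case (Suc i)
    then obtain k c where kc: "\<forall>t\<in>{xs ! i .. xs ! Suc i}. f t = 2 powr (real_of_int k) * t + c"
      using xs(5) by blast
    have "f (xs ! Suc i) = f (xs ! i) + 2 powr (real_of_int k) * (xs ! Suc i - xs ! i)"
      using kc less[OF Suc.prems] by (simp add: algebra_simps)
    moreover have "dyadic (f (xs ! i) + 2 powr (real_of_int k) * (xs ! Suc i - xs ! i))"
      using Suc xs(4) by (intro dyadic_intros) auto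
    ultimately show ?case by simp
  qed
  have piece: "\<exists>A\<in>dyadic_affine. \<forall>s. xs ! i \<le> s \<longrightarrow> s \<le> xs ! Suc i \<longrightarrow> f s = A s" if i: "Suc i < length xs" for i
  proof -
    obtain k c where kc: "\<forall>t\<in>{xs ! i .. xs ! Suc i}. f t = 2 powr (real_of_int k) * t + c"
      using xs(5)[OF i] by blast
    then have "c = f (xs ! i) - 2 powr (real_of_int k) * xs ! i"
      using less[OF i] by simp
    moreover have "dyadic (f (xs ! i) - 2 powr (real_of_int k) * xs ! i)"
      using i by (intro dyadic_intros dy xs(4)) auto
    ultimately have "(\<lambda>x. 2 powr of_int k * x + c) \<in> dyadic_affine"
      by (intro dyadic_affineI) simp
    then show ?thesis using kc by (intro bexI[of _ "\<lambda>x. 2 powr of_int k * x + c"]) auto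
  qed
  have left: "\<exists>A\<in>dyadic_affine. \<exists>e>0. \<forall>s. t - e \<le> s \<longrightarrow> s \<le> t \<longrightarrow> f s = A s" for t
  proof -
    consider "t \<le> 0" | "t > 1" | "0 < t" "t \<le> 1" by linarith
    then show ?thesis
    proof cases
      case 1
      then show ?thesis using out by (intro bexI[OF _ dyadic_affine_id] exI[of _ 1]) auto
    next
      case 2
      then show ?thesis using out by (intro bexI[OF _ dyadic_affine_id] exI[of _ "t - 1"]) auto
    next
      case 3
      then obtain i where i: "Suc i < length xs" "xs ! i < t" "\<not> xs ! Suc i < t"
        using list_switch[of xs "\<lambda>x. x < t"] xs by auto
      then obtain A where "A \<in> dyadic_affine" "\<forall>s. xs ! i \<le> s \<longrightarrow> s \<le> xs ! Suc i \<longrightarrow> f s = A s"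
        using piece by blast
      then show ?thesis using i by (intro bexI[of _ A] exI[of _ "t - xs ! i"]) auto
    qed
  qed
  \<comment> \<open>A nondyadic point is no breakpoint, so the formula to its right also holds to
    its left.\<close>
  have right: "\<exists>A\<in>dyadic_affine. \<exists>e>0. (\<forall>s. t \<le> s \<longrightarrow> s \<le> t + e \<longrightarrow> f s = A s) \<and>
      (dyadic t \<or> (\<forall>s. t - e \<le> s \<longrightarrow> s \<le> t \<longrightarrow> f s = A s))" for t
  proof -
    consider "t < 0" | "t \<ge> 1" | "0 \<le> t" "t < 1" by linarith
    then show ?thesis
    proof cases
      case 1
      then show ?thesis using out by (intro bexI[OF _ dyadic_affine_id] exI[of _ "- t"]) auto
    next
      case 3
      then obtain i where i: "Suc i < length xs" "xs ! i \<le> t" "\<not> xs ! Suc i \<le> t"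
        using list_switch[of xs "\<lambda>x. x \<le> t"] xs by auto
      then obtain A where A: "A \<in> dyadic_affine" "\<forall>s. xs ! i \<le> s \<longrightarrow> s \<le> xs ! Suc i \<longrightarrow> f s = A s"
        using piece by blast
      show ?thesis
      proof (cases "dyadic t")
        case True
        then show ?thesis using A i by (intro bexI[of _ A] exI[of _ "xs ! Suc i - t"]) auto
      next
        case False
        then have "xs ! i \<noteq> t" using xs(4)[of "xs ! i"] i(1) by auto
        then show ?thesis
          using A i by (intro bexI[of _ A] exI[of _ "min (xs ! Suc i - t) (t - xs ! i)"]) auto
      qed
    next
      case 2
      show ?thesis
      proof (cases "t = 1")
        case True
        then show ?thesis using out by (intro bexI[OF _ dyadic_affine_id] exI[of _ 1]) auto
      next
        case False
        then show ?thesis using 2 out by (intro bexI[OF _ dyadic_affine_id] exI[of _ "t - 1"]) auto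
      qed
    qed
  qed
  obtain A e where A: "A \<in> dyadic_affine" "e > 0" "\<And>s. t - e \<le> s \<Longrightarrow> s \<le> t \<Longrightarrow> f s = A s"
    using left[of t] by blast
  obtain B e' where B: "B \<in> dyadic_affine" "e' > 0" "\<And>s. t \<le> s \<Longrightarrow> s \<le> t + e' \<Longrightarrow> f s = B s"
    "dyadic t \<or> (\<forall>s. t - e' \<le> s \<longrightarrow> s \<le> t \<longrightarrow> f s = B s)"
    using right[of t] by blast
  show ?thesis
  proof (cases "dyadic t")
    case True
    then show ?thesis
      by (rule pl_at_glue[OF _ _ pl_at_affine[OF A(1)] pl_at_affine[OF B(1)], of _ "min e e'"])
         (use A B in auto)
  next
    case False
    then have *: "\<forall>s. t - e' \<le> s \<longrightarrow> s \<le> t \<longrightarrow> f s = B s" using B(4) by blast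
    show ?thesis
    proof (rule pl_at_cong[OF pl_at_affine[OF B(1)] B(2)])
      fix s assume "\<bar>s - t\<bar> < e'"
      then show "f s = B s" using * B(3)[of s] by (cases "s \<le> t") auto
    qed
  qed
qed

text \<open>By \<open>grid\<close> the map is affine on every cell of some dyadic level, and all
  points of that level serve as breakpoints.\<close>

lemma PL_Thompson_F_set:
  assumes g: "g \<in> PL" "g \<in> homeo_incr"
  shows "app g \<in> Thompson_F_set"
proof -
  have "\<exists>n. \<forall>N\<ge>n. \<forall>i::int. 0 \<le> real_of_int i / 2 ^ N \<longrightarrow> of_int i / 2 ^ N \<le> (1::real) \<longrightarrow>
    (\<exists>A\<in>dyadic_affine. \<forall>t\<in>{of_int i / 2 ^ N .. (of_int i + 1) / 2 ^ N}. app g t = A t)"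
    by (rule grid) (use g in \<open>auto simp: PL_def\<close>)
  then obtain n where n: "\<And>i::int. 0 \<le> real_of_int i / 2 ^ n \<Longrightarrow> of_int i / 2 ^ n \<le> (1::real) \<Longrightarrow>
    (\<exists>A\<in>dyadic_affine. \<forall>t\<in>{of_int i / 2 ^ n .. (of_int i + 1) / 2 ^ n}. app g t = A t)"
    by blast
  let ?xs = "map (\<lambda>i. real i / 2 ^ n) [0..<Suc (2 ^ n)]"
  have nth: "?xs ! i = real i / 2 ^ n" if "i < Suc (2 ^ n)" for i
    using that by (simp del: upt_Suc)
  have 1: "sorted_wrt (<) ?xs"
    by (auto simp: sorted_wrt_iff_nth_less nth divide_strict_right_mono simp del: upt_Suc)
  have 2: "hd ?xs = 0" by (simp add: hd_map del: upt_Suc)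
  have 3: "last ?xs = 1" by simp
  have 4: "\<forall>x\<in>set ?xs. dyadic x"
  proof
    fix x assume "x \<in> set ?xs"
    then obtain i :: nat where "x = real_of_int (int i) / 2 ^ n" by auto
    then show "dyadic x" unfolding dyadic_def by blast
  qed
  have 5: "\<exists>(k::int) (c::real). \<forall>t\<in>{?xs ! i .. ?xs ! Suc i}. app g t = 2 powr (real_of_int k) * t + c"
    if i: "Suc i < length ?xs" for i
  proof -
    have i': "i < 2 ^ n" using i by simp
    then have "real i \<le> 2 ^ n" by (metis less_imp_le of_nat_le_iff of_nat_numeral of_nat_power)
    then obtain A where A: "A \<in> dyadic_affine"
      "\<forall>t\<in>{of_int (int i) / 2 ^ n .. (of_int (int i) + 1) / 2 ^ n}. app g t = A t"
      using n[of "int i"] by (auto simp: divide_le_eq)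
    obtain k c where "A = (\<lambda>x. 2 powr of_int k * x + c)"
      using A(1) unfolding dyadic_affine_def by blast
    moreover have "?xs ! i = of_int (int i) / 2 ^ n" "?xs ! Suc i = (of_int (int i) + 1) / 2 ^ n"
      using nth[of i] nth[of "Suc i"] i' by auto
    ultimately show ?thesis using A(2) by metis
  qed
  have "app g \<in> Homeo_plus" using g Homeo_plus_eq by blast
  then show ?thesis
    unfolding Thompson_F_set_def using 1 2 3 4 5 by (intro CollectI conjI exI[of _ ?xs]) auto
qed

definition Thompson_incr :: "incr set" where
  "Thompson_incr = PL \<inter> homeo_incr"

lemma Thompson_incr_sub: "add_subgroup Thompson_incr"
  using PL_add_subgroup homeo_incr_sub by (auto simp: Thompson_incr_def add_subgroup_def)

lemma Thompson_F_set_eq: "Thompson_F_set = app ` Thompson_incr"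
proof (intro subset_antisym subsetI)
  fix f assume f: "f \<in> Thompson_F_set"
  then obtain g where g: "g \<in> homeo_incr" "f = app g"
    unfolding Thompson_F_set_def Homeo_plus_eq by blast
  then have "g \<in> PL" using Thompson_F_set_pl[OF f] by (auto simp: PL_def)
  then show "f \<in> app ` Thompson_incr" using g by (auto simp: Thompson_incr_def)
qed (auto simp: Thompson_incr_def PL_Thompson_F_set)

section \<open>Conjugation from the interval to the line\<close>

definition to_line :: "incr \<Rightarrow> incr" where
  "to_line g = Incr (\<lambda>t. unsqueeze (app g (squeeze t)))"

lemma app_to_line:
  assumes g: "g \<in> homeo_incr"
  shows "app (to_line g) t = unsqueeze (app g (squeeze t))"
proof -
  have m: "- g \<in> homeo_incr" using g add_subgroupD(3)[OF homeo_incr_sub] by blast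
  have b: "0 < app g (squeeze t)" "app g (squeeze t) < 1" for t
    using homeo_incr_interval[OF g] squeeze_bounds by auto
  have "strict_mono (\<lambda>t. unsqueeze (app g (squeeze t)))"
    by (rule strict_monoI) (simp add: unsqueeze_less_iff b squeeze_less_iff)
  moreover have "surj (\<lambda>t. unsqueeze (app g (squeeze t)))"
  proof (rule surjI)
    fix y
    have "0 < app (- g) (squeeze y)" "app (- g) (squeeze y) < 1"
      using homeo_incr_interval[OF m] squeeze_bounds by auto
    then show "unsqueeze (app g (squeeze (unsqueeze (app (- g) (squeeze y))))) = y"
      by (simp add: squeeze_unsqueeze)
  qed
  ultimately show ?thesis
    unfolding to_line_def by (simp add: app_Incr)
qed

lemma squeeze_to_line:
  assumes "g \<in> homeo_incr"
  shows "squeeze (app (to_line g) t) = app g (squeeze t)"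
  using homeo_incr_interval[OF assms] squeeze_bounds by (simp add: app_to_line[OF assms] squeeze_unsqueeze)

lemma squeeze_eq_iff: "squeeze s = squeeze t \<longleftrightarrow> s = t"
  by (metis unsqueeze_squeeze)

lemma to_line_add:
  assumes "f \<in> homeo_incr" "g \<in> homeo_incr"
  shows "to_line (f + g) = to_line f + to_line g"
proof (rule incr_eqI)
  fix t
  have fg: "f + g \<in> homeo_incr" using assms add_subgroupD(2)[OF homeo_incr_sub] by blast
  have "squeeze (app (to_line (f + g)) t) = squeeze (app (to_line f + to_line g) t)"
    using assms fg by (simp add: squeeze_to_line)
  then show "app (to_line (f + g)) t = app (to_line f + to_line g) t"
    by (simp only: squeeze_eq_iff)
qed

lemma to_line_inj:
  assumes "f \<in> homeo_incr" "g \<in> homeo_incr" "to_line f = to_line g"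
  shows "f = g"
proof (rule incr_eqI)
  fix t
  have "app f (squeeze s) = app g (squeeze s)" for s
    using assms squeeze_to_line by metis
  then show "app f t = app g t"
    using squeeze_surj[of t] homeo_incr_endpoints[OF assms(1)] homeo_incr_endpoints[OF assms(2)] assms(1,2)
    by (cases "0 < t \<and> t < 1"; cases "t = 0 \<or> t = 1") (auto simp: homeo_incr_def)
qed

text \<open>Fixing \<open>0\<close> and \<open>1\<close> makes the germs there linear about these
  points. Slope \<open>2 ^ k\<close> becomes translation by \<open>k\<close> at the left end and by
  \<open>- k\<close> at the right end.\<close>

lemma to_line_FR:
  assumes g: "g \<in> Thompson_incr"
  shows "to_line g \<in> FR"
proof -
  have gh: "g \<in> homeo_incr" and gPL: "\<And>t. pl_at (app g) t"
    using g by (auto simp: Thompson_incr_def PL_def)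
  have "pl_at (unsqueeze \<circ> (app g \<circ> squeeze)) t" for t
    using homeo_incr_interval[OF gh] squeeze_bounds
    by (intro pl_at_comp pl_at_squeeze gPL pl_at_unsqueeze) auto
  moreover have "app (to_line g) = unsqueeze \<circ> (app g \<circ> squeeze)"
    by (auto simp: app_to_line[OF gh])
  ultimately have PL: "to_line g \<in> PL" by (auto simp: PL_def)
  have bot: "\<exists>k. translates at_bot (to_line g) k"
  proof -
    obtain B e where B: "B \<in> dyadic_affine" "e > 0" "\<And>u. 0 \<le> u \<Longrightarrow> u \<le> e \<Longrightarrow> app g (0 + 1 * u) = B (0 + 1 * u)"
      using gPL[of 0] unfolding pl_at_def agree_def by blast
    obtain k c where kc: "B = (\<lambda>x. 2 powr of_int k * x + c)" using B(1) unfolding dyadic_affine_def by blast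
    have "c = 0" using B(3)[of 0] B(2) kc homeo_incr_endpoints[OF gh] by simp
    then have near: "app g u = 2 powr of_int k * u" if "0 \<le> u" "u \<le> e" for u
      using B(3)[of u] that kc by simp
    obtain t0 where t0: "squeeze t0 = min e (1 / 2)" using squeeze_surj[of "min e (1 / 2)"] B(2) by (auto simp: min_less_iff_disj)
    \<comment> \<open>The second bound keeps both \<open>t\<close> and \<open>t + k\<close>
      negative, as \<open>squeeze_add_neg\<close> requires.\<close>
    have "app (to_line g) t = t + of_int k" if t: "t \<le> min t0 (- \<bar>of_int k\<bar> - 1)" for t
    proof -
      have "squeeze t \<le> squeeze t0" using t strict_mono_squeeze by (simp add: strict_mono_less_eq)
      then have "app g (squeeze t) = 2 powr of_int k * squeeze t"
        using t0 squeeze_bounds[of t] by (intro near) auto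
      also have "\<dots> = squeeze (t + of_int k)" using t by (intro squeeze_add_neg[symmetric]) auto
      finally show ?thesis by (simp add: app_to_line[OF gh])
    qed
    then show ?thesis unfolding translates_def eventually_at_bot_linorder by blast
  qed
  have top: "\<exists>k. translates at_top (to_line g) k"
  proof -
    obtain A e where A: "A \<in> dyadic_affine" "e > 0" "\<And>u. 0 \<le> u \<Longrightarrow> u \<le> e \<Longrightarrow> app g (1 + -1 * u) = A (1 + -1 * u)"
      using gPL[of 1] unfolding pl_at_def agree_def by blast
    obtain k c where kc: "A = (\<lambda>x. 2 powr of_int k * x + c)" using A(1) unfolding dyadic_affine_def by blast
    have "c = 1 - 2 powr of_int k" using A(3)[of 0] A(2) kc homeo_incr_endpoints[OF gh] by simp
    then have near: "app g (1 - u) = 1 - 2 powr of_int k * u" if "0 \<le> u" "u \<le> e" for u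
      using A(3)[of u] that kc by (simp add: algebra_simps)
    obtain t0 where t0: "squeeze t0 = 1 - min e (1 / 2)" using squeeze_surj[of "1 - min e (1 / 2)"] A(2) by (auto simp: min_less_iff_disj)
    have "app (to_line g) t = t + of_int (- k)" if t: "t \<ge> max t0 (\<bar>of_int k\<bar>)" for t
    proof -
      have "squeeze t0 \<le> squeeze t" using t strict_mono_squeeze by (simp add: strict_mono_less_eq)
      then have "app g (1 - (1 - squeeze t)) = 1 - 2 powr of_int k * (1 - squeeze t)"
        using t0 squeeze_bounds[of t] by (intro near) auto
      also have "\<dots> = squeeze (t + of_int (- k))"
        using t squeeze_add_pos[of t "- k"] by (simp add: abs_le_iff algebra_simps)
      finally show ?thesis by (simp add: app_to_line[OF gh])
    qed
    then show ?thesis unfolding translates_def eventually_at_top_linorder by blast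
  qed
  show ?thesis using PL bot top by (auto simp: FR_def ends_def)
qed

text \<open>The piecewise linear structure at \<open>0\<close> and \<open>1\<close>, where pieces of
  \<open>squeeze\<close> accumulate, comes from the eventual translations: they become affine
  germs.\<close>

lemma to_line_surj:
  assumes f: "f \<in> FR"
  shows "\<exists>g\<in>Thompson_incr. to_line g = f"
proof -
  define G where "G s = (if 0 < s \<and> s < 1 then squeeze (app f (unsqueeze s)) else s)" for s
  have G: "G s = squeeze (app f (unsqueeze s))" if "0 < s" "s < 1" for s using that by (simp add: G_def)
  have G_out: "G s = s" if "s \<le> 0 \<or> s \<ge> 1" for s using that by (auto simp: G_def)
  have "strict_mono G"
  proof (rule strict_monoI)
    fix s t :: real assume "s < t"
    then show "G s < G t"
      using squeeze_bounds[of "app f (unsqueeze s)"] squeeze_bounds[of "app f (unsqueeze t)"]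
      by (auto simp: G_def squeeze_less_iff unsqueeze_less_iff)
  qed
  moreover have "surj G"
  proof -
    have "\<exists>x. G x = y" for y
    proof (cases "0 < y \<and> y < 1")
      case True
      then have "G (squeeze (app (- f) (unsqueeze y))) = y"
        using squeeze_bounds by (simp add: G squeeze_unsqueeze)
      then show ?thesis by blast
    next
      case False
      then show ?thesis by (intro exI[of _ y]) (auto simp: G_def)
    qed
    then show ?thesis unfolding surj_def by metis
  qed
  ultimately have app_G: "app (Incr G) = G" by (rule app_Incr)
  have hom: "Incr G \<in> homeo_incr" by (auto simp: homeo_incr_def app_G G_def)
  have "to_line (Incr G) = f"
    by (rule incr_eqI) (use hom squeeze_bounds in \<open>simp add: app_to_line app_G G\<close>)
  moreover have "pl_at G s" for s
  proof -
    consider "s < 0" | "s = 0" | "0 < s" "s < 1" | "s = 1" | "s > 1" by linarith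
    then show ?thesis
    proof cases
      case 1
      then show ?thesis
        by (intro pl_at_cong[OF pl_at_affine[OF dyadic_affine_id], of "- s"]) (auto intro: G_out)
    next
      case 5
      then show ?thesis
        by (intro pl_at_cong[OF pl_at_affine[OF dyadic_affine_id], of "s - 1"]) (auto intro: G_out)
    next
      case 3
      have "pl_at (squeeze \<circ> (app f \<circ> unsqueeze)) s"
        using f 3 by (intro pl_at_comp pl_at_squeeze pl_at_unsqueeze) (auto simp: FR_def PL_def)
      then show ?thesis
        by (rule pl_at_cong[of _ _ "min s (1 - s)"]) (use 3 in \<open>auto simp: G_def\<close>)
    next
      case 2
      obtain k where "translates at_bot f k" using f ends_simps(1) unfolding FR_def by blast
      then obtain t0 where t0: "\<And>t. t \<le> t0 \<Longrightarrow> app f t = t + of_int k"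
        unfolding translates_def eventually_at_bot_linorder by blast
      define e where "e = squeeze (min t0 (- \<bar>of_int k\<bar> - 1))"
      have e: "0 < e" "e < 1" using squeeze_bounds by (auto simp: e_def)
      have "G s = 2 powr of_int k * s + 0" if "0 \<le> s" "s \<le> 0 + e" for s
      proof (cases "s = 0")
        case False
        then have s: "0 < s" "s < 1" using that e by auto
        then have "unsqueeze s \<le> unsqueeze e" using that e unsqueeze_less_iff[of e s] by force
        then have "unsqueeze s \<le> min t0 (- \<bar>of_int k\<bar> - 1)" by (simp add: e_def)
        then have "app f (unsqueeze s) = unsqueeze s + of_int k"
          "squeeze (unsqueeze s + of_int k) = 2 powr of_int k * squeeze (unsqueeze s)"
          by (auto intro!: t0 squeeze_add_neg)
        then show ?thesis using s by (simp add: G squeeze_unsqueeze)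
      qed (simp add: G_def)
      then show ?thesis unfolding 2
        by (intro pl_at_glue[OF dyadic_0 e(1) pl_at_affine[OF dyadic_affine_id]
              pl_at_affine[OF dyadic_affineI[OF dyadic_0, of k]]]) (auto intro: G_out)
    next
      case 4
      obtain k where "translates at_top f k" using f ends_simps(2) unfolding FR_def by blast
      then obtain t0 where t0: "\<And>t. t \<ge> t0 \<Longrightarrow> app f t = t + of_int k"
        unfolding translates_def eventually_at_top_linorder by blast
      define e where "e = 1 - squeeze (max t0 \<bar>of_int k\<bar>)"
      have e: "0 < e" "e < 1" using squeeze_bounds by (auto simp: e_def)
      have "G s = 2 powr of_int (- k) * s + (1 - 2 powr of_int (- k))" if "1 - e \<le> s" "s \<le> 1" for s
      proof (cases "s = 1")
        case False
        then have s: "0 < s" "s < 1" using that e by auto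
        then have "unsqueeze (1 - e) \<le> unsqueeze s" using that e unsqueeze_less_iff[of s "1 - e"] by force
        then have "max t0 \<bar>of_int k\<bar> \<le> unsqueeze s" by (simp add: e_def)
        then have "app f (unsqueeze s) = unsqueeze s + of_int k"
          "1 - squeeze (unsqueeze s + of_int k) = 2 powr of_int (- k) * (1 - squeeze (unsqueeze s))"
          by (intro t0 squeeze_add_pos; linarith)+
        then show ?thesis using s by (simp add: G squeeze_unsqueeze algebra_simps)
      qed (simp add: G_def)
      moreover have "dyadic (1 - 2 powr of_int (- k))" by (intro dyadic_intros) auto
      ultimately show ?thesis unfolding 4
        by (intro pl_at_glue[OF dyadic_1 e(1) pl_at_affine[OF dyadic_affineI[of "1 - 2 powr of_int (- k)" "- k"]]
              pl_at_affine[OF dyadic_affine_id]]) (auto intro: G_out)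
    qed
  qed
  then have "Incr G \<in> Thompson_incr" using hom by (auto simp: Thompson_incr_def PL_def app_G)
  ultimately show ?thesis by blast
qed

lemma to_line_bij: "bij_betw to_line Thompson_incr FR"
  unfolding bij_betw_def
proof
  show "inj_on to_line Thompson_incr"
    by (rule inj_onI, rule to_line_inj) (auto simp: Thompson_incr_def)
  show "to_line ` Thompson_incr = FR"
    using to_line_FR to_line_surj by blast
qed

section \<open>Transfer to groups of homeomorphisms of the interval\<close>

text \<open>Powers of \<open>u\<close> permute finitely many cosets by right multiplication, so two
  of them act alike. Their quotient fixes every coset, which puts it in every conjugate of
  \<open>H\<close>.\<close>

lemma (in group) finite_index_power:
  assumes H: "subgroup H G" "finite (rcosets H)" and u: "u \<in> carrier G"
  obtains m :: nat where "m > 0" "\<And>x. x \<in> carrier G \<Longrightarrow> x \<otimes> u [^] m \<otimes> inv x \<in> H"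
proof -
  \<comment> \<open>\<open>restrict\<close> puts all these maps into one finite \<open>PiE\<close>
    set, for the pigeonhole argument.\<close>
  define P where "P i = restrict (\<lambda>C. C #> u [^] i) (rcosets H)" for i :: nat
  have Hc: "H \<subseteq> carrier G" using H(1) by (rule subgroup.subset)
  have act: "(H #> x) #> u [^] i = H #> (x \<otimes> u [^] i)" if "x \<in> carrier G" for x and i :: nat
    using that u Hc by (simp add: coset_mult_assoc)
  have "P i \<in> rcosets H \<rightarrow>\<^sub>E rcosets H" for i
  proof (rule PiE_I)
    fix C assume C: "C \<in> rcosets H"
    then obtain x where "x \<in> carrier G" "C = H #> x" by (auto simp: RCOSETS_def)
    then show "P i C \<in> rcosets H" using C act u Hc by (auto simp: P_def intro: rcosetsI)
  qed (simp add: P_def)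
  moreover have "finite (rcosets H \<rightarrow>\<^sub>E rcosets H)" using H(2) by (rule finite_PiE) (rule H(2))
  ultimately have "finite (range P)" by (meson finite_subset image_subsetI)
  then have "\<not> inj P" using infinite_UNIV_nat finite_imageD by blast
  then obtain i j where "P i = P j" "i \<noteq> j" by (auto simp: inj_on_def)
  then obtain i j where ij: "P i = P j" "i < j" by (metis linorder_neqE_nat)
  have "x \<otimes> u [^] (j - i) \<otimes> inv x \<in> H" if x: "x \<in> carrier G" for x
  proof -
    have "H #> x \<in> rcosets H" using x Hc by (simp add: rcosetsI)
    then have "P i (H #> x) = (H #> x) #> u [^] i" "P j (H #> x) = (H #> x) #> u [^] j"
      by (auto simp: P_def)
    then have eq: "H #> (x \<otimes> u [^] i) = H #> (x \<otimes> u [^] j)" using act x ij by simp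
    have c: "x \<otimes> u [^] i \<in> carrier G" "x \<otimes> u [^] j \<in> carrier G" using x u by auto
    have "x \<otimes> u [^] j \<in> H #> (x \<otimes> u [^] i)" unfolding eq by (rule rcos_self[OF c(2) H(1)])
    then have "x \<otimes> u [^] j \<otimes> inv (x \<otimes> u [^] i) \<in> H"
      using subgroup.rcos_module_imp[OF H(1) is_group c(1)] by blast
    moreover have "x \<otimes> u [^] j = x \<otimes> u [^] (j - i) \<otimes> u [^] i"
      using x u ij(2) by (simp add: m_assoc nat_pow_mult)
    then have "x \<otimes> u [^] j \<otimes> inv (x \<otimes> u [^] i) = x \<otimes> u [^] (j - i) \<otimes> inv x"
      using x u by (simp add: inv_mult_group m_assoc) (simp add: m_assoc[symmetric])
    ultimately show ?thesis by simp
  qed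
  then show ?thesis using that[of "j - i"] ij by simp
qed

section \<open>Additive subgroups as algebraic structures\<close>

definition incr_group :: "incr set \<Rightarrow> incr monoid" where
  "incr_group S = \<lparr>carrier = S, mult = (+), one = 0\<rparr>"

lemma group_incr_group: "add_subgroup S \<Longrightarrow> group (incr_group S)"
proof (rule groupI)
  fix x assume "add_subgroup S" "x \<in> carrier (incr_group S)"
  then show "\<exists>y\<in>carrier (incr_group S). y \<otimes>\<^bsub>incr_group S\<^esub> x = \<one>\<^bsub>incr_group S\<^esub>"
    by (intro bexI[of _ "- x"]) (auto simp: incr_group_def add_subgroup_def)
qed (auto simp: incr_group_def add_subgroup_def add.assoc)

lemma incr_group_iso:
  assumes "bij_betw h S T" "\<And>x y. x \<in> S \<Longrightarrow> y \<in> S \<Longrightarrow> h (x + y) = h x + h y"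
  shows "incr_group S \<cong> incr_group T"
proof (rule is_isoI)
  show "h \<in> iso (incr_group S) (incr_group T)"
    using assms bij_betwE[OF assms(1)] by (auto simp: iso_def hom_def incr_group_def)
qed

abbreviation homeo_group :: "(real \<Rightarrow> real) set \<Rightarrow> (real \<Rightarrow> real) monoid" where
  "homeo_group C \<equiv> Homeo_grp\<lparr>carrier := C\<rparr>"

lemma inj_app: "inj app"
  by (rule injI) (simp add: app_inject)

lemma app_add: "app (f + g) = app f \<circ> app g"
  by auto

lemma incr_group_homeo_group: "incr_group S \<cong> homeo_group (app ` S)"
proof (rule is_isoI)
  show "app \<in> iso (incr_group S) (homeo_group (app ` S))"
    using inj_app by (auto simp: iso_def hom_def incr_group_def Homeo_grp_def app_add bij_betw_def inj_on_def)
qed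

lemma group_homeo_group:
  assumes "add_subgroup S"
  shows "group (homeo_group (app ` S))"
proof (rule groupI)
  fix f assume "f \<in> carrier (homeo_group (app ` S))"
  then obtain x where x: "x \<in> S" "f = app x" by auto
  then have "- x \<in> S" using assms add_subgroupD by blast
  moreover have "app (- x) \<circ> app x = id" by auto
  ultimately show "\<exists>y\<in>carrier (homeo_group (app ` S)). y \<otimes>\<^bsub>homeo_group (app ` S)\<^esub> f = \<one>\<^bsub>homeo_group (app ` S)\<^esub>"
    using x by (auto simp: Homeo_grp_def)
next
  have "app 0 = id" by auto
  then show "\<one>\<^bsub>homeo_group (app ` S)\<^esub> \<in> carrier (homeo_group (app ` S))"
    using add_subgroupD(1)[OF assms] by (auto simp: Homeo_grp_def intro: image_eqI[of _ _ 0])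
next
  fix f g assume "f \<in> carrier (homeo_group (app ` S))" "g \<in> carrier (homeo_group (app ` S))"
  then obtain x y where "x \<in> S" "y \<in> S" "f = app x" "g = app y" by auto
  then show "f \<otimes>\<^bsub>homeo_group (app ` S)\<^esub> g \<in> carrier (homeo_group (app ` S))"
    using add_subgroupD(2)[OF assms] by (auto simp: Homeo_grp_def app_add[symmetric])
qed (auto simp: Homeo_grp_def)

lemma homeo_group_inv:
  assumes "add_subgroup S" "x \<in> S"
  shows "inv\<^bsub>homeo_group (app ` S)\<^esub> app x = app (- x)"
proof -
  have "app (- x) \<circ> app x = id" by auto
  then show ?thesis
    using assms add_subgroupD(3)[OF assms]
    by (intro group.inv_equality[OF group_homeo_group]) (auto simp: Homeo_grp_def)
qed

lemma homeo_group_pow: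
  "app x [^]\<^bsub>homeo_group C\<^esub> (n::nat) = app (nmult n x)"
proof (induction n)
  case 0
  have "app 0 = id" by auto
  then show ?case by (simp add: Homeo_grp_def nat_pow_def)
next
  case (Suc n)
  have "app x [^]\<^bsub>homeo_group C\<^esub> Suc n = app (nmult n x) \<circ> app x"
    unfolding Suc[symmetric] by (simp add: Homeo_grp_def nat_pow_def)
  then show ?case by (simp add: app_add[symmetric] nmult_commute)
qed

lemma Homeo_grp_eq: "Homeo_grp = homeo_group (app ` homeo_incr)"
  by (simp add: Homeo_grp_def Homeo_plus_eq)

lemma Thompson_F_eq: "Thompson_F = homeo_group (app ` Thompson_incr)"
  by (simp add: Thompson_F_def Thompson_F_set_eq)

lemma Homeo_grp_mult: "app x \<otimes>\<^bsub>Homeo_grp\<^esub> app y = app (x + y)"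
  by (simp add: Homeo_grp_def app_add)

lemma generate_eq:
  assumes "Y \<subseteq> homeo_incr"
  shows "generate Homeo_grp (app ` Y) = app ` span_group Y"
proof (intro subset_antisym subsetI)
  have sub: "span_group Y \<subseteq> homeo_incr" using span_group_minimal[OF homeo_incr_sub assms] .
  fix f assume "f \<in> generate Homeo_grp (app ` Y)"
  then show "f \<in> app ` span_group Y"
  proof induction
    case one
    have "\<one>\<^bsub>Homeo_grp\<^esub> = app 0" by (auto simp: Homeo_grp_def)
    then show ?case using span_group.zero by (metis imageI)
  next
    case (incl h)
    then show ?case by (auto intro: span_group.base)
  next
    case (inv h)
    then obtain y where y: "y \<in> Y" "h = app y" by blast
    then have "inv\<^bsub>Homeo_grp\<^esub> h = app (- y)"
      using homeo_group_inv[OF homeo_incr_sub] assms unfolding Homeo_grp_eq[symmetric] by blast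
    then show ?case using y by (auto intro: span_group.base span_group.uminus)
  next
    case (eng h1 h2)
    then obtain x y where "x \<in> span_group Y" "y \<in> span_group Y" "h1 = app x" "h2 = app y" by blast
    then show ?case
      by (simp only: Homeo_grp_mult) (rule imageI, rule span_group.plus)
  qed
next
  have grp: "group Homeo_grp" using group_homeo_group[OF homeo_incr_sub] unfolding Homeo_grp_eq[symmetric] .
  have sub: "span_group Y \<subseteq> homeo_incr" using span_group_minimal[OF homeo_incr_sub assms] .
  have gsub: "subgroup (generate Homeo_grp (app ` Y)) Homeo_grp"
    by (rule group.generate_is_subgroup[OF grp]) (use assms in \<open>auto simp: Homeo_grp_def Homeo_plus_eq\<close>)
  fix f assume "f \<in> app ` span_group Y"
  then obtain x where x: "x \<in> span_group Y" "f = app x" by blast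
  have "app x \<in> generate Homeo_grp (app ` Y)"
    using x(1)
  proof induction
    case zero
    have "\<one>\<^bsub>Homeo_grp\<^esub> = app 0" by (auto simp: Homeo_grp_def)
    then show ?case using generate.one[of Homeo_grp "app ` Y"] by (simp only:)
  next
    case (base x)
    then show ?case by (auto intro: generate.incl)
  next
    case (plus x y)
    then show ?case using generate.eng[OF plus.IH] by (simp only: Homeo_grp_mult)
  next
    case (uminus x)
    then have "inv\<^bsub>Homeo_grp\<^esub> app x = app (- x)"
      using homeo_group_inv[OF homeo_incr_sub] sub unfolding Homeo_grp_eq[symmetric] by blast
    then show ?case using subgroup.m_inv_closed[OF gsub uminus.IH] by simp
  qed
  then show "f \<in> generate Homeo_grp (app ` Y)" using x by simp
qed

theorem theorem1p6:
  fixes H :: "(real \<Rightarrow> real) set" and Y :: "(real \<Rightarrow> real) set"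
  assumes "subgroup H Thompson_F"
    and "finite (rcosets\<^bsub>Thompson_F\<^esub> H)"
    and "Y \<subseteq> Homeo_plus"
    and "geometrically_proper Y"
    and "Thompson_F\<lparr>carrier := H\<rparr> \<cong> Homeo_grp\<lparr>carrier := generate Homeo_grp Y\<rparr>"
  shows "Thompson_F\<lparr>carrier := H\<rparr> \<cong> Thompson_F"
proof -
  let ?T = Thompson_incr
  have T: "homeo_group (app ` ?T) = Thompson_F" by (simp add: Thompson_F_eq)
  interpret TF: group Thompson_F
    using group_homeo_group[OF Thompson_incr_sub] unfolding T .
  define H0 where "H0 = {g \<in> ?T. app g \<in> H}"
  have "H \<subseteq> app ` ?T"
    using subgroup.subset[OF assms(1)] by (simp add: Thompson_F_eq)
  then have H_eq: "app ` H0 = H" by (auto simp: H0_def)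
  have H0T: "H0 \<subseteq> ?T" "H0 \<subseteq> homeo_incr" by (auto simp: H0_def Thompson_incr_def)
  have mult: "app x \<otimes>\<^bsub>Thompson_F\<^esub> app y = app (x + y)" for x y
    by (simp add: Thompson_F_eq Homeo_grp_def app_add)
  have minv: "inv\<^bsub>Thompson_F\<^esub> app x = app (- x)" if "x \<in> ?T" for x
    using homeo_group_inv[OF Thompson_incr_sub that] unfolding T .
  have H0: "add_subgroup H0"
    unfolding add_subgroup_def
  proof (intro conjI ballI)
    have "\<one>\<^bsub>Thompson_F\<^esub> = app 0" by (auto simp: Thompson_F_eq Homeo_grp_def)
    then show "0 \<in> H0"
      using subgroup.one_closed[OF assms(1)] add_subgroupD(1)[OF Thompson_incr_sub] by (simp add: H0_def)
    fix x assume x: "x \<in> H0"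
    then show "- x \<in> H0"
      using subgroup.m_inv_closed[OF assms(1), of "app x"] minv[of x] add_subgroupD(3)[OF Thompson_incr_sub]
      by (simp add: H0_def)
    fix y assume y: "y \<in> H0"
    show "x + y \<in> H0"
      using x y subgroup.m_closed[OF assms(1), of "app x" "app y"] mult[of x y] add_subgroupD(2)[OF Thompson_incr_sub]
      by (simp add: H0_def)
  qed
  define HR where "HR = to_line ` H0"
  have additive: "additive_on ?T to_line"
    using to_line_add by (simp add: additive_on_def Thompson_incr_def)
  then have add: "to_line (x + y) = to_line x + to_line y" if "x \<in> ?T" "y \<in> ?T" for x y
    using that by (simp add: additive_on_def)
  note T_D = add_subgroupD[OF Thompson_incr_sub]
  note diff = additive_on_diff[OF Thompson_incr_sub additive]
  note nmult = additive_on_nmult[OF Thompson_incr_sub additive]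
  have bij: "bij_betw to_line H0 HR"
    using to_line_bij H0T(1) unfolding HR_def by (auto simp: bij_betw_def intro: inj_on_subset)
  have HR: "add_subgroup HR"
    unfolding HR_def by (rule additive_on_image[OF H0]) (use add H0T(1) in \<open>auto simp: additive_on_def subset_iff\<close>)
  have HR_FR: "HR \<subseteq> FR" using to_line_bij H0T by (auto simp: HR_def bij_betw_def)
  \<comment> \<open>The normal core of \<open>HR\<close> in \<open>FR\<close>:
    \<open>finite_index_FC_subset\<close> needs a subgroup normalized by \<open>FR\<close>.\<close>
  define N where "N = {f \<in> FR. \<forall>x\<in>FR. x + f - x \<in> HR}"
  have N_sub: "add_subgroup N"
    unfolding add_subgroup_def
  proof (intro conjI ballI)
    show "0 \<in> N" using FR_D(1) add_subgroupD(1)[OF HR] by (simp add: N_def)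
    fix f assume f: "f \<in> N"
    have "x + - f - x \<in> HR" if "x \<in> FR" for x
    proof -
      have "- (x + f - x) \<in> HR"
        using f that by (intro add_subgroupD(3)[OF HR]) (simp add: N_def)
      then show ?thesis
        by (simp only: diff_conv_add_uminus minus_add minus_minus add.assoc)
    qed
    then show "- f \<in> N"
      using f FR_D(3) by (simp add: N_def)
    fix g assume g: "g \<in> N"
    have "x + (f + g) - x = (x + f - x) + (x + g - x)" for x
      by (simp add: add_group_simps del: add_uminus_conv_diff)
    then show "f + g \<in> N"
      using f g FR_D(2) add_subgroupD(2)[OF HR] by (simp add: N_def)
  qed
  have N_normal: "add_normalizes FR N"
    unfolding add_normalizes_def
  proof (intro ballI)
    fix g f assume g: "g \<in> FR" and f: "f \<in> N"
    have "x + (g + f - g) - x = (x + g) + f - (x + g)" for x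
      by (simp add: add_group_simps del: add_uminus_conv_diff)
    then show "g + f - g \<in> N"
      using f g FR_D(2,4) by (simp add: N_def)
  qed
  have power: "\<exists>m>0. nmult m u \<in> N" if u: "u \<in> FR" for u
  proof -
    obtain g where g: "g \<in> ?T" "to_line g = u" using to_line_surj[OF u] by blast
    then have "app g \<in> carrier Thompson_F" by (simp add: Thompson_F_eq)
    then obtain m :: nat where m: "m > 0"
      "\<And>x. x \<in> carrier Thompson_F \<Longrightarrow> x \<otimes>\<^bsub>Thompson_F\<^esub> (app g [^]\<^bsub>Thompson_F\<^esub> m) \<otimes>\<^bsub>Thompson_F\<^esub> inv\<^bsub>Thompson_F\<^esub> x \<in> H"
      using TF.finite_index_power[OF assms(1,2)] by blast
    have pow: "app g [^]\<^bsub>Thompson_F\<^esub> m = app (nmult m g)"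
      using homeo_group_pow[of "app ` ?T" g m] unfolding T .
    have "x + nmult m u - x \<in> HR" if x: "x \<in> FR" for x
    proof -
      obtain y where y: "y \<in> ?T" "to_line y = x" using to_line_surj[OF x] by blast
      then have "app (y + nmult m g + - y) \<in> H"
        using m(2)[of "app y"] minv[of y] by (simp only: pow mult) (simp add: Thompson_F_eq)
      then have "y + nmult m g - y \<in> H0"
        using y g nmult[OF g(1), where n = m] T_D by (simp add: H0_def)
      moreover have "to_line (y + nmult m g - y) = x + nmult m u - x"
        using y g nmult[OF g(1), where n = m] T_D(2)[OF y(1), of "nmult m g"] by (simp add: add diff)
      ultimately show ?thesis unfolding HR_def by (metis imageI)
    qed
    moreover have "nmult m u \<in> FR"
      using nmult[OF g(1), where n = m] g to_line_FR by metis
    ultimately show ?thesis using m by (auto simp: N_def)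
  qed
  have N_HR: "N \<subseteq> HR"
    using FR_D(1) by (force simp: N_def)
  have FC_HR: "FC \<subseteq> HR"
    using finite_index_FC_subset[OF N_sub N_normal power] N_HR by blast
  define Y0 where "Y0 = {y \<in> homeo_incr. app y \<in> Y}"
  have Y_eq: "app ` Y0 = Y" using assms(3) by (auto simp: Y0_def Homeo_plus_eq)
  have gen: "generate Homeo_grp Y = app ` span_group Y0"
    using generate_eq[of Y0] Y_eq by (auto simp: Y0_def)
  obtain psi where psi: "psi \<in> iso (Thompson_F\<lparr>carrier := H\<rparr>) (Homeo_grp\<lparr>carrier := generate Homeo_grp Y\<rparr>)"
    using assms(5) by (auto simp: is_iso_def)
  then have psi_bij: "bij_betw psi H (app ` span_group Y0)" by (simp add: iso_def gen)
  have psi_mult: "psi (f \<circ> g) = psi f \<circ> psi g" if "f \<in> H" "g \<in> H" for f g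
    using psi that by (auto simp: iso_def hom_def Thompson_F_def Homeo_grp_def)
  define pull where "pull = the_inv_into H0 to_line"
  have pull: "pull (to_line x) = x" if "x \<in> H0" for x
    using bij that by (simp add: pull_def bij_betw_def the_inv_into_f_f)
  have pull_bij: "bij_betw pull HR H0"
    unfolding pull_def using bij by (rule bij_betw_the_inv_into)
  \<comment> \<open>The given isomorphism, read on the line at its source and in type
    \<open>incr\<close> at its target.\<close>
  define phi where "phi f = Incr (psi (app (pull f)))" for f
  have bij_app: "bij_betw app S (app ` S)" for S
    using inj_app by (auto simp: bij_betw_def intro: inj_on_subset)
  have "bij_betw Incr (app ` S) S" for S
    by (rule bij_betwI[of _ _ _ app]) (auto simp: app_inverse)
  then have "bij_betw (Incr \<circ> (psi \<circ> (app \<circ> pull))) HR (span_group Y0)"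
    using bij_betw_trans[OF bij_betw_trans[OF bij_betw_trans[OF pull_bij bij_app[of H0, unfolded H_eq]] psi_bij]] by blast
  then have phi_bij: "bij_betw phi HR (span_group Y0)" by (simp add: phi_def[abs_def] comp_def)
  have phi_plus: "phi (f + g) = phi f + phi g" if fg: "f \<in> HR" "g \<in> HR" for f g
  proof -
    obtain x y where xy: "x \<in> H0" "y \<in> H0" "f = to_line x" "g = to_line y" using fg by (auto simp: HR_def)
    then have "f + g = to_line (x + y)" using add H0T by (simp add: subset_iff)
    moreover have "x + y \<in> H0" using xy add_subgroupD(2)[OF H0] by blast
    ultimately have 1: "phi (f + g) = Incr (psi (app x \<circ> app y))" by (simp add: phi_def pull app_add)
    have H: "app x \<in> H" "app y \<in> H" using xy by (auto simp: H0_def)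
    then obtain a b where ab: "psi (app x) = app a" "psi (app y) = app b"
      using bij_betwE[OF psi_bij] by blast
    have "phi (f + g) = a + b"
      unfolding 1 using psi_mult[OF H] ab by (simp add: app_add[symmetric] app_inverse)
    moreover have "phi f = a" "phi g = b" using ab xy by (simp_all add: phi_def pull app_inverse)
    ultimately show ?thesis by simp
  qed
  interpret proper_copy HR Y0 phi
  proof
    show "\<exists>m>0. nmult m u \<in> HR" if "u \<in> FR" for u using power[OF that] N_HR by blast
    show "geometrically_proper (app ` Y0)" using assms(4) Y_eq by simp
    show "Y0 \<subseteq> homeo_incr" by (auto simp: Y0_def)
    show "additive_on HR phi" using phi_plus by (simp add: additive_on_def)
  qed (use HR HR_FR FC_HR phi_bij in auto)
  obtain a b where ab: "a > 0" "b > 0" "HR = {f \<in> FR. a dvd chi at_bot f \<and> b dvd chi at_top f}"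
    using multiples by blast
  obtain h where h: "bij_betw (\<lambda>f. h + f - h) FR HR"
    using multiples_conj[OF ab(1,2)] unfolding ab(3) by blast
  have 1: "incr_group FR \<cong> incr_group HR"
    by (rule incr_group_iso[OF h])
       (simp add: add_group_simps del: add_uminus_conv_diff)
  have 2: "incr_group H0 \<cong> incr_group HR"
    by (rule incr_group_iso[OF bij]) (use add H0T in auto)
  have 3: "incr_group ?T \<cong> incr_group FR"
    by (rule incr_group_iso[OF to_line_bij]) (use add in auto)
  have 4: "incr_group H0 \<cong> homeo_group H"
    using incr_group_homeo_group[of H0] unfolding H_eq .
  have 5: "incr_group ?T \<cong> Thompson_F"
    using incr_group_homeo_group[of ?T] unfolding T .
  have "homeo_group H \<cong> incr_group H0"
    using group.iso_sym[OF group_incr_group[OF H0] 4] .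
  also have "incr_group H0 \<cong> incr_group HR" by (rule 2)
  also have "incr_group HR \<cong> incr_group FR"
    using group.iso_sym[OF group_incr_group[OF FR_add_subgroup] 1] .
  also have "incr_group FR \<cong> incr_group ?T"
    using group.iso_sym[OF group_incr_group[OF Thompson_incr_sub] 3] .
  also have "incr_group ?T \<cong> Thompson_F" by (rule 5)
  finally show ?thesis by (simp add: Thompson_F_def)
qed

end
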